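(* There exist constants $c_0>0$ and $c^*>0$ (depending only on $N,d,T,\lambda^0,\lambda^1,\ell,g$ and $c_a$) with $$|\alpha^*(\beta)(t)-\alpha^*(\tilde\beta)(t)|_2\le c_0|v^\beta(t)-v^{\tilde\beta}(t)|_2\quad\text{for all }\beta,\tilde\beta\in\mathscr{A},\ t\in[0,T],$$ $$|v^\beta(t)-v^{\tilde\beta}(t)|_2^2\le c^*\int_t^T|\tilde\beta(s)-\beta(s)|_2^2\,ds\quad\text{for all }\beta,\tilde\beta\in\mathscr{A}^*,\ t\in[0,T],$$ such that the following holds. Let $\rho\in(0,1)$, $\beta^{(0)}=\hat\beta^{(0)}\in\mathscr{A}^*$, and let $\varepsilon^{(n)}:[0,T]\times\mathscr{X}\to\mathbb{R}_+^{d-1}$, $n\ge1$, be Lipschitz continuous. Define for $n\ge1$ $$v^{(n)}=v^{\beta^{(n-1)}},\quad \alpha^{(n)}=\alpha^*(\beta^{(n-1)}),\quad \beta^{(n)}=\rho\beta^{(n-1)}+(1-\rho)\alpha^{(n)},$$ $$\hat v^{(n)}=v^{\hat\beta^{(n-1)}},\quad \hat\alpha^{(n)}=\alpha^*(\hat\beta^{(n-1)}),\quad \hat\beta^{(n)}=\rho\hat\beta^{(n-1)}+(1-\rho)(\hat\alpha^{(n)}+\varepsilon^{(n)}),$$ and $q^{(n)}(t)=|\hat v^{(n)}(t)-v^{(n)}(t)|_2^2$, $\gamma^{(n)}(t)=|\hat\beta^{(n)}(t)-\beta^{(n)}(t)|_2^2$. With $\hat c_\rho=2(1-\rho)\max\{c_0^2,1\}$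 and $c_{*,\rho}=c^*\hat c_\rho$, set for $n\ge2$ $$\Gamma^{(n-1)}(t)=\hat c_\rho\sum_{k=1}^{n-1}\|\varepsilon^{(n-k)}\|_{\mathcal{S}}^2\sum_{j=1}^k\binom{k-1}{j-1}\rho^{k-j}\frac{c_{*,\rho}^{j-1}(T-t)^{j-1}}{(j-1)!},$$ $$Q^{(n)}(t)=\sum_{k=1}^{n-1}\|\varepsilon^{(n-k)}\|_{\mathcal{S}}^2\sum_{j=1}^k\binom{k-1}{j-1}\rho^{k-j}\frac{c_{*,\rho}^{j}(T-t)^{j}}{j!}.$$ Then $$\gamma^{(n-1)}(t)\le\Gamma^{(n-1)}(t),\qquad q^{(n)}(t)\le Q^{(n)}(t),\qquad t\in[0,T],\ n\ge2.$$ In particular, for each $\rho\in(0,1)$ there exists a constant $\tilde c>0$, independent of $n$ (and of $\beta^{(0)}$ and the errors $(\varepsilon^{(n)})_{n\ge1}$), such that $$\sup_{n\ge1}\big(\|\gamma^{(n)}\|_\infty+\|q^{(n)}\|_\infty\big)\le\tilde c\,\sup_{n\ge1}\|\varepsilon^{(n)}\|_{\mathcal{S}}^2,$$ where $\|\cdot\|_\infty$ is the supremum norm over $t\in[0,T]$.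
   Context: Setting. $N,d$ are positive integers, $T>0$, $\mathcal{X}=\{1,\dots,d\}$, $\Sigma^{d-1}_N=\{\mu\in\{0,1/N,2/N,\dots,1\}^d:\mu_1+\dots+\mu_d=1\}$, $\mathscr{X}=\mathcal{X}\times\Sigma^{d-1}_N$, $\mathbb{R}_+=[0,\infty)$. For $\mu\in\Sigma_N^{d-1}$ put $n^\mu_x=N\mu_x$; $e_x$ is the $x$-th unit vector of $\mathbb{R}^d$ and $e_{x,z}=\frac1N(e_x-e_z)$. Vectors in $\mathbb{R}^{d-1}$ attached to a state $x$ are indexed by $y\in\mathcal{X}\setminus\{x\}$ (in increasing order); e.g. $\alpha_y(t,x,\mu)$, $y\ne x$, is the rate of moving from $x$ to $y$. $|\cdot|_2$ is the Euclidean norm on $\mathbb{R}^k$; for $\psi:[0,T]\times\mathscr{X}\to\mathbb{R}^k$, $\psi(t)$ denotes the function $\psi(t,\cdot,\cdot)$, $|\psi(t)|_2^2=\sum_{(x,\mu)\in\mathscr{X}}|\psi(t,x,\mu)|_2^2$, and for continuous $\psi$, $\|\psi\|_{\mathcal{S}}=\max_{t\in[0,T]}|\psi(t)|_2$. Data. Fixed functions $\lambda^0,\lambda^1:\mathscr{X}\to\mathbb{R}_+^{d-1}$, $g:\mathscr{X}\to\mathbb{R}_+$, and a continuous $\ell:\mathscr{X}\times\mathbb{R}_+^{d-1}\to\mathbb{R}_+$ for which there is $\gamma>0$ with $\tau\ell(x,\mu,a')+(1-\tau)\ell(x,\mu,a)-\ell(x,\mu,\tau a'+(1-\tau)a)\ge\gamma\tau(1-\tau)|a'-a|_2^2$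 for all $(x,\mu)\in\mathscr{X}$, $a,a'\in\mathbb{R}_+^{d-1}$, $\tau\in[0,1]$. Controls and dynamics. $\mathscr{A}$ is the set of Lipschitz continuous functions $\alpha:[0,T]\times\mathscr{X}\to\mathbb{R}_+^{d-1}$. For $\alpha,\beta\in\mathscr{A}$ and $\varphi:\mathscr{X}\to\mathbb{R}$, $$(\mathscr{L}^\alpha_x\varphi)(t,x,\mu)=\sum_{y\ne x}(\lambda^0_y(x,\mu)+\lambda^1_y(x,\mu)\alpha_y(t,x,\mu))[\varphi(y,\mu)-\varphi(x,\mu)],$$ $$(\mathscr{L}^\beta_\mu\varphi)(t,x,\mu)=\sum_{y\ne z}n^\mu_z\big(\lambda^0_y(z,\mu+e_{x,z})+\lambda^1_y(z,\mu+e_{x,z})\beta_y(t,z,\mu+e_{x,z})\big)[\varphi(x,\mu+e_{y,z})-\varphi(x,\mu)]$$ (sum over ordered pairs $y\neq z$ in $\mathcal{X}$; terms with $n^\mu_z=0$ are zero). $\Xi_t=(X_t,\mu_t)$ is the time-inhomogeneous Markov chain on $\mathscr{X}$ with generator $\mathscr{L}^\alpha_x+\mathscr{L}^\beta_\mu$, and $\mathbb{E}^{\alpha\otimes\beta}$ its expectation. Set $J(t,x,\mu,\alpha;\beta)=\mathbb{E}^{\alpha\otimes\beta}\big[\int_t^T\ell(\Xi_u,\alpha(u,\Xi_u))\,du+g(\Xi_T)\,\big|\,\Xi_t=(x,\mu)\big]$ and $v^\beta(t,x,\mu)=\inf_{\alpha\in\mathscr{A}}J(t,x,\mu,\alpha;\beta)$.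 Hamiltonian and best response. For $\varphi:\mathcal{X}\to\mathbb{R}$, $\Delta_x\varphi=(\varphi(y)-\varphi(x))_{y\ne x}\in\mathbb{R}^{d-1}$. $H(x,\mu,p)=\inf_{a\in\mathbb{R}_+^{d-1}}\{\ell(x,\mu,a)+\sum_{y\ne x}(\lambda^0_y(x,\mu)+\lambda^1_y(x,\mu)a_y)p_y\}$, and $\hat\alpha(x,\mu,p)$ is its unique minimizer. It is classical that $v^\beta$ is the unique classical solution of $-\frac{d}{dt}v^\beta(t,x,\mu)=H(x,\mu,\Delta_xv^\beta(t,\cdot,\mu))+(\mathscr{L}^\beta_\mu v^\beta(t))(t,x,\mu)$, $v^\beta(T,x,\mu)=g(x,\mu)$. The best response to $\beta$ is $\alpha^*(\beta)(t,x,\mu)=\hat\alpha(x,\mu,\Delta_xv^\beta(t,\cdot,\mu))$, which lies in $\mathscr{A}$. The set $\mathscr{A}^*$: $c_a>0$ is a fixed constant such that $|\alpha^*(\beta)(t,x,\mu)|_2\le c_a$ for all $\beta\in\mathscr{A}$, $(t,x,\mu)\in[0,T]\times\mathscr{X}$ (such a constant exists), and $\mathscr{A}^*=\{\alpha\in\mathscr{A}:\sup_{t\in[0,T]}|\alpha(t)|_2\le c_a\}$. *)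

theory Defs
  imports "HOL-Probability.Probability"
begin

text \<open>
  The set of positions \<open>{1,\<dots>,d}\<close> is the finite type \<^typ>\<open>'d\<close>, with \<open>d = CARD('d)\<close>. A vector of
  \<open>\<real>\<^sup>d\<^sup>-\<^sup>1\<close> attached to a position \<open>x\<close>, whose coordinates are indexed by the \<open>y \<noteq> x\<close>, is encoded as the
  vector of \<open>\<real>\<^sup>d\<close> with the same coordinates and with \<open>x\<close>-th coordinate 0; this is a linear isometry
  for the Euclidean norms and also covers \<open>d = 1\<close>.

  Functions on \<open>[0,T] \<times> S\<close> are total HOL functions; every condition is imposed on
  \<open>[0,T] \<times> S\<close> only.
\<close>

type_synonym 'd state = "'d \<times> (real ^ 'd)"
type_synonym 'd field = "real \<Rightarrow> 'd state \<Rightarrow> real ^ 'd"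

definition emp_measures :: "nat \<Rightarrow> (real ^ 'd::finite) set" where
  "emp_measures N = {\<mu>. (\<forall>x. \<exists>k\<in>{0..N}. \<mu> $ x = real k / real N) \<and> (\<Sum>x\<in>UNIV. \<mu> $ x) = 1}"

definition states :: "nat \<Rightarrow> 'd::finite state set" where
  "states N = UNIV \<times> emp_measures N"

text \<open>\<open>\<real>\<^sub>+\<^sup>d\<^sup>-\<^sup>1\<close>, attached to the position \<open>x\<close>\<close>
definition orthant :: "'d::finite \<Rightarrow> (real ^ 'd) set" where
  "orthant x = {a. a $ x = 0 \<and> (\<forall>y. 0 \<le> a $ y)}"

definition unit_shift :: "nat \<Rightarrow> 'd::finite \<Rightarrow> 'd \<Rightarrow> real ^ 'd" where
  "unit_shift N x z = (1 / real N) *\<^sub>R (axis x 1 - axis z 1)"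

definition Delta :: "'d::finite \<Rightarrow> ('d \<Rightarrow> real) \<Rightarrow> real ^ 'd" where
  "Delta x \<phi> = (\<chi> y. \<phi> y - \<phi> x)"

definition snorm :: "nat \<Rightarrow> ('d::finite state \<Rightarrow> 'b::real_normed_vector) \<Rightarrow> real" where
  "snorm N \<psi> = sqrt (\<Sum>\<xi>\<in>states N. (norm (\<psi> \<xi>))\<^sup>2)"

definition norm_S ::
  "nat \<Rightarrow> real \<Rightarrow> (real \<Rightarrow> 'd::finite state \<Rightarrow> 'b::real_normed_vector) \<Rightarrow> real" where
  "norm_S N T \<psi> = (SUP t\<in>{0..T}. snorm N (\<psi> t))"

text \<open>Since the state space is finite, Lipschitz continuity on \<open>[0,T] \<times> S\<close> is Lipschitz continuity
  in \<open>t\<close> with a constant that is uniform in the state.\<close>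
definition adm :: "nat \<Rightarrow> real \<Rightarrow> 'd::finite field set" where
  "adm N T = {\<alpha>. (\<forall>t\<in>{0..T}. \<forall>(x,\<mu>)\<in>states N. \<alpha> t (x,\<mu>) \<in> orthant x) \<and>
                 (\<exists>K. \<forall>\<xi>\<in>states N. K-lipschitz_on {0..T} (\<lambda>t. \<alpha> t \<xi>))}"

definition adm_star :: "nat \<Rightarrow> real \<Rightarrow> real \<Rightarrow> 'd::finite field set" where
  "adm_star N T ca = {\<alpha>\<in>adm N T. (SUP t\<in>{0..T}. snorm N (\<alpha> t)) \<le> ca}"

definition gen_x :: "('d::finite state \<Rightarrow> real ^ 'd) \<Rightarrow> ('d state \<Rightarrow> real ^ 'd) \<Rightarrow>
    'd field \<Rightarrow> ('d state \<Rightarrow> real) \<Rightarrow> real \<Rightarrow> 'd state \<Rightarrow> real" where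
  "gen_x lam0 lam1 \<alpha> \<phi> t = (\<lambda>(x,\<mu>).
     \<Sum>y\<in>UNIV - {x}. (lam0 (x,\<mu>) $ y + lam1 (x,\<mu>) $ y * \<alpha> t (x,\<mu>) $ y) * (\<phi> (y,\<mu>) - \<phi> (x,\<mu>)))"

text \<open>When \<open>N * \<mu> $ z = 0\<close> the data are evaluated outside the state space, but the whole term is 0.\<close>
definition gen_mu :: "nat \<Rightarrow> ('d::finite state \<Rightarrow> real ^ 'd) \<Rightarrow> ('d state \<Rightarrow> real ^ 'd) \<Rightarrow>
    'd field \<Rightarrow> ('d state \<Rightarrow> real) \<Rightarrow> real \<Rightarrow> 'd state \<Rightarrow> real" where
  "gen_mu N lam0 lam1 \<beta> \<phi> t = (\<lambda>(x,\<mu>).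
     \<Sum>(y,z)\<in>{(y,z). y \<noteq> z}.
       real N * \<mu> $ z *
       (lam0 (z, \<mu> + unit_shift N x z) $ y
        + lam1 (z, \<mu> + unit_shift N x z) $ y * \<beta> t (z, \<mu> + unit_shift N x z) $ y) *
       (\<phi> (x, \<mu> + unit_shift N y z) - \<phi> (x,\<mu>)))"

text \<open>
  \<open>Xi\<close> is, under the family of laws \<open>P t \<xi>\<close> (the process started from \<open>\<xi>\<close> at time \<open>t\<close>, i.e. the
  conditional law given \<open>Xi t = \<xi>\<close>), a time-inhomogeneous Markov chain on \<open>S\<close> over \<open>[0,T]\<close> with
  right-continuous, piecewise constant paths and with generator \<open>L\<close>. The generator is the derivative
  of the transition operators from both sides: the forward derivative alone would allow jumps at
  deterministic times.
\<close>
definition markov_chain :: "real \<Rightarrow> 's set \<Rightarrow> (('s \<Rightarrow> real) \<Rightarrow> real \<Rightarrow> 's \<Rightarrow> real) \<Rightarrow>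
    (real \<Rightarrow> 'w \<Rightarrow> 's) \<Rightarrow> (real \<Rightarrow> 's \<Rightarrow> 'w measure) \<Rightarrow> bool" where
  "markov_chain T S L Xi P \<longleftrightarrow>
     (\<forall>t\<in>{0..T}. \<forall>\<xi>\<in>S.
        prob_space (P t \<xi>) \<and>
        (\<forall>u\<in>{t..T}. Xi u \<in> P t \<xi> \<rightarrow>\<^sub>M count_space S) \<and>
        (AE \<omega> in P t \<xi>. Xi t \<omega> = \<xi>) \<and>
        (\<forall>\<omega>\<in>space (P t \<xi>).
           (\<forall>u\<in>{t..<T}. eventually (\<lambda>s. Xi s \<omega> = Xi u \<omega>) (at_right u)) \<and>
           (\<forall>u\<in>{t<..T}. \<exists>\<eta>. eventually (\<lambda>s. Xi s \<omega> = \<eta>) (at_left u)))) \<and>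
     (\<forall>t\<in>{0..T}. \<forall>s\<in>{t..T}. \<forall>u\<in>{s..T}. \<forall>\<xi>\<in>S. \<forall>\<zeta>\<in>S. \<forall>\<eta>\<in>S. \<forall>F f. finite F \<and> F \<subseteq> {t..s} \<longrightarrow>
        \<P>(\<omega> in P t \<xi>. (\<forall>r\<in>F. Xi r \<omega> = f r) \<and> Xi s \<omega> = \<zeta> \<and> Xi u \<omega> = \<eta>) =
        \<P>(\<omega> in P t \<xi>. (\<forall>r\<in>F. Xi r \<omega> = f r) \<and> Xi s \<omega> = \<zeta>) * \<P>(\<omega> in P s \<zeta>. Xi u \<omega> = \<eta>)) \<and>
     (\<forall>\<phi>. \<forall>\<xi>\<in>S.
        (\<forall>u\<in>{0..<T}. ((\<lambda>h. ((\<integral>\<omega>. \<phi> (Xi (u + h) \<omega>) \<partial>P u \<xi>) - \<phi> \<xi>) / h) \<longlongrightarrow> L \<phi> u \<xi>) (at_right 0)) \<and>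
        (\<forall>u\<in>{0<..T}. ((\<lambda>h. ((\<integral>\<omega>. \<phi> (Xi u \<omega>) \<partial>P (u - h) \<xi>) - \<phi> \<xi>) / h) \<longlongrightarrow> L \<phi> u \<xi>) (at_right 0)))"

text \<open>In what follows \<open>P \<alpha> \<beta> t \<xi>\<close> is the law of the chain with generator
  \<open>gen_x \<alpha> + gen_mu \<beta>\<close> started from \<open>\<xi>\<close> at time \<open>t\<close>.\<close>
definition is_controlled_chain :: "nat \<Rightarrow> real \<Rightarrow>
    ('d::finite state \<Rightarrow> real ^ 'd) \<Rightarrow> ('d state \<Rightarrow> real ^ 'd) \<Rightarrow>
    (real \<Rightarrow> 'w \<Rightarrow> 'd state) \<Rightarrow>
    ('d field \<Rightarrow> 'd field \<Rightarrow> real \<Rightarrow> 'd state \<Rightarrow> 'w measure) \<Rightarrow> bool" where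
  "is_controlled_chain N T lam0 lam1 Xi P \<longleftrightarrow>
     (\<forall>\<alpha>\<in>adm N T. \<forall>\<beta>\<in>adm N T.
        markov_chain T (states N)
          (\<lambda>\<phi> t \<xi>. gen_x lam0 lam1 \<alpha> \<phi> t \<xi> + gen_mu N lam0 lam1 \<beta> \<phi> t \<xi>) Xi (P \<alpha> \<beta>))"

definition cost :: "real \<Rightarrow>
    ('d::finite state \<Rightarrow> real ^ 'd \<Rightarrow> real) \<Rightarrow> ('d state \<Rightarrow> real) \<Rightarrow>
    (real \<Rightarrow> 'w \<Rightarrow> 'd state) \<Rightarrow>
    ('d field \<Rightarrow> 'd field \<Rightarrow> real \<Rightarrow> 'd state \<Rightarrow> 'w measure) \<Rightarrow>
    real \<Rightarrow> 'd state \<Rightarrow> 'd field \<Rightarrow> 'd field \<Rightarrow> real" where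
  "cost T l g Xi P t \<xi> \<alpha> \<beta> =
     (\<integral>\<omega>. ((LBINT u:{t..T}. l (Xi u \<omega>) (\<alpha> u (Xi u \<omega>))) + g (Xi T \<omega>)) \<partial>P \<alpha> \<beta> t \<xi>)"

definition value_fn :: "nat \<Rightarrow> real \<Rightarrow>
    ('d::finite state \<Rightarrow> real ^ 'd \<Rightarrow> real) \<Rightarrow> ('d state \<Rightarrow> real) \<Rightarrow>
    (real \<Rightarrow> 'w \<Rightarrow> 'd state) \<Rightarrow>
    ('d field \<Rightarrow> 'd field \<Rightarrow> real \<Rightarrow> 'd state \<Rightarrow> 'w measure) \<Rightarrow>
    'd field \<Rightarrow> real \<Rightarrow> 'd state \<Rightarrow> real" where
  "value_fn N T l g Xi P \<beta> t \<xi> = (INF \<alpha>\<in>adm N T. cost T l g Xi P t \<xi> \<alpha> \<beta>)"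

definition pre_hamiltonian ::
    "('d::finite state \<Rightarrow> real ^ 'd) \<Rightarrow> ('d state \<Rightarrow> real ^ 'd) \<Rightarrow>
    ('d state \<Rightarrow> real ^ 'd \<Rightarrow> real) \<Rightarrow> 'd state \<Rightarrow> real ^ 'd \<Rightarrow> real ^ 'd \<Rightarrow> real" where
  "pre_hamiltonian lam0 lam1 l \<xi> p a =
     l \<xi> a + (\<Sum>y\<in>UNIV - {fst \<xi>}. (lam0 \<xi> $ y + lam1 \<xi> $ y * a $ y) * p $ y)"

definition hamiltonian ::
    "('d::finite state \<Rightarrow> real ^ 'd) \<Rightarrow> ('d state \<Rightarrow> real ^ 'd) \<Rightarrow>
    ('d state \<Rightarrow> real ^ 'd \<Rightarrow> real) \<Rightarrow> 'd state \<Rightarrow> real ^ 'd \<Rightarrow> real" where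
  "hamiltonian lam0 lam1 l \<xi> p = (INF a\<in>orthant (fst \<xi>). pre_hamiltonian lam0 lam1 l \<xi> p a)"

definition hat_alpha ::
    "('d::finite state \<Rightarrow> real ^ 'd) \<Rightarrow> ('d state \<Rightarrow> real ^ 'd) \<Rightarrow>
    ('d state \<Rightarrow> real ^ 'd \<Rightarrow> real) \<Rightarrow> 'd state \<Rightarrow> real ^ 'd \<Rightarrow> real ^ 'd" where
  "hat_alpha lam0 lam1 l \<xi> p =
     (THE a. a \<in> orthant (fst \<xi>) \<and>
             pre_hamiltonian lam0 lam1 l \<xi> p a = hamiltonian lam0 lam1 l \<xi> p)"

definition best_response :: "nat \<Rightarrow> real \<Rightarrow>
    ('d::finite state \<Rightarrow> real ^ 'd) \<Rightarrow> ('d state \<Rightarrow> real ^ 'd) \<Rightarrow>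
    ('d state \<Rightarrow> real ^ 'd \<Rightarrow> real) \<Rightarrow> ('d state \<Rightarrow> real) \<Rightarrow>
    (real \<Rightarrow> 'w \<Rightarrow> 'd state) \<Rightarrow>
    ('d field \<Rightarrow> 'd field \<Rightarrow> real \<Rightarrow> 'd state \<Rightarrow> 'w measure) \<Rightarrow>
    'd field \<Rightarrow> 'd field" where
  "best_response N T lam0 lam1 l g Xi P \<beta> t = (\<lambda>(x,\<mu>).
     hat_alpha lam0 lam1 l (x,\<mu>) (Delta x (\<lambda>y. value_fn N T l g Xi P \<beta> t (y,\<mu>))))"

text \<open>Below, \<open>br\<close> is the best response map. The time-state dependent error is \<open>\<epsilon> n\<close>, used for \<open>n \<ge> 1\<close>.\<close>

primrec play :: "('d::finite field \<Rightarrow> 'd field) \<Rightarrow> real \<Rightarrow> 'd field \<Rightarrow> nat \<Rightarrow> 'd field" where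
  "play br \<rho> \<beta>0 0 = \<beta>0"
| "play br \<rho> \<beta>0 (Suc n) =
     (\<lambda>t \<xi>. \<rho> *\<^sub>R play br \<rho> \<beta>0 n t \<xi> + (1 - \<rho>) *\<^sub>R br (play br \<rho> \<beta>0 n) t \<xi>)"

primrec perturbed_play :: "('d::finite field \<Rightarrow> 'd field) \<Rightarrow> real \<Rightarrow> (nat \<Rightarrow> 'd field) \<Rightarrow>
    'd field \<Rightarrow> nat \<Rightarrow> 'd field" where
  "perturbed_play br \<rho> \<epsilon> \<beta>0 0 = \<beta>0"
| "perturbed_play br \<rho> \<epsilon> \<beta>0 (Suc n) =
     (\<lambda>t \<xi>. \<rho> *\<^sub>R perturbed_play br \<rho> \<epsilon> \<beta>0 n t \<xi>
            + (1 - \<rho>) *\<^sub>R (br (perturbed_play br \<rho> \<epsilon> \<beta>0 n) t \<xi> + \<epsilon> (Suc n) t \<xi>))"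

text \<open>\<open>q\<^sup>(\<^sup>n\<^sup>)(t)\<close> (for \<open>n \<ge> 1\<close>) and \<open>\<gamma>\<^sup>(\<^sup>n\<^sup>)(t)\<close>, where \<open>v\<close> is the map \<open>\<beta> \<mapsto> v\<^sup>\<beta>\<close>\<close>

definition q_err :: "nat \<Rightarrow> ('d::finite field \<Rightarrow> real \<Rightarrow> 'd state \<Rightarrow> real) \<Rightarrow>
    ('d field \<Rightarrow> 'd field) \<Rightarrow> real \<Rightarrow> (nat \<Rightarrow> 'd field) \<Rightarrow> 'd field \<Rightarrow> nat \<Rightarrow> real \<Rightarrow> real" where
  "q_err N v br \<rho> \<epsilon> \<beta>0 n t =
     (snorm N (\<lambda>\<xi>. v (perturbed_play br \<rho> \<epsilon> \<beta>0 (n - 1)) t \<xi> - v (play br \<rho> \<beta>0 (n - 1)) t \<xi>))\<^sup>2"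

definition gamma_err :: "nat \<Rightarrow>
    ('d::finite field \<Rightarrow> 'd field) \<Rightarrow> real \<Rightarrow> (nat \<Rightarrow> 'd field) \<Rightarrow> 'd field \<Rightarrow> nat \<Rightarrow> real \<Rightarrow> real" where
  "gamma_err N br \<rho> \<epsilon> \<beta>0 n t =
     (snorm N (\<lambda>\<xi>. perturbed_play br \<rho> \<epsilon> \<beta>0 n t \<xi> - play br \<rho> \<beta>0 n t \<xi>))\<^sup>2"

definition c_hat :: "real \<Rightarrow> real \<Rightarrow> real" where
  "c_hat c0 \<rho> = 2 * (1 - \<rho>) * max (c0\<^sup>2) 1"

definition c_star_rho :: "real \<Rightarrow> real \<Rightarrow> real \<Rightarrow> real" where
  "c_star_rho c0 cs \<rho> = cs * c_hat c0 \<rho>"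

text \<open>\<open>e n\<close> stands for the size of the \<open>n\<close>-th error; note that \<open>Gamma_bound \<dots> n\<close> is
  \<open>\<Gamma>\<^sup>(\<^sup>n\<^sup>-\<^sup>1\<^sup>)\<close>, while \<open>Q_bound \<dots> n\<close> is \<open>Q\<^sup>(\<^sup>n\<^sup>)\<close>.\<close>

definition Gamma_bound ::
    "real \<Rightarrow> real \<Rightarrow> real \<Rightarrow> real \<Rightarrow> (nat \<Rightarrow> real) \<Rightarrow> nat \<Rightarrow> real \<Rightarrow> real" where
  "Gamma_bound T c0 cs \<rho> e n t =
     c_hat c0 \<rho> * (\<Sum>k=1..n-1. (e (n - k))\<^sup>2 *
       (\<Sum>j=1..k. real ((k - 1) choose (j - 1)) * \<rho> ^ (k - j) *
          (c_star_rho c0 cs \<rho> ^ (j - 1) * (T - t) ^ (j - 1) / fact (j - 1))))"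

definition Q_bound ::
    "real \<Rightarrow> real \<Rightarrow> real \<Rightarrow> real \<Rightarrow> (nat \<Rightarrow> real) \<Rightarrow> nat \<Rightarrow> real \<Rightarrow> real" where
  "Q_bound T c0 cs \<rho> e n t =
     (\<Sum>k=1..n-1. (e (n - k))\<^sup>2 *
       (\<Sum>j=1..k. real ((k - 1) choose (j - 1)) * \<rho> ^ (k - j) *
          (c_star_rho c0 cs \<rho> ^ j * (T - t) ^ j / fact j)))"

end

theory Submission
  imports Defs
begin

text \<open>
  Dynkin's formula for the controlled chain shows that, for any smooth \<open>w\<close> with terminal value \<open>g\<close>, the
  cost of a pair of controls is \<open>w\<close> plus the expected accumulated defect of \<open>w\<close> in the backward
  equation. Applied to the solution of the Hamilton-Jacobi-Bellman system (Picard iteration after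
  truncating the controls; the truncation does not bind, because the solution lies between 0 and the
  cost of the zero control) this identifies the value function. Applied to the value function
  of \<open>\<beta>'\<close> under the pair (best response to \<open>\<beta>'\<close>, \<open>\<beta>\<close>) it leaves only the difference of the two
  mean field generators, which is linear in \<open>\<beta> - \<beta>'\<close>; hence the stability of the value for
  arbitrary admissible \<open>\<beta>, \<beta>'\<close>, so that the perturbed iterates need not stay in the set of controls
  bounded by \<open>ca\<close>. The best response is Lipschitz in the value by strong convexity. The two
  estimates give a recursion for the errors, which Pascal's rule solves in closed form and an exponential
  weight in time makes uniformly contractive.
\<close>

text \<open>The constants have to be fixed before the chain \<open>Xi\<close>, \<open>P\<close> is
  known, so everything that enters them must be bounded by the data alone. This works because the
  difference of the two mean field generators is tested on the value function of \<beta>', whose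
  range [0, \<open>value_bound\<close>] is the same for all controls; a Gronwall argument on the
  difference of the two equations would bring in the size of the rates, hence of the mean field
  controls. The price is that the value function, defined as an infimum of expectations, must be
  shown to solve its equation. The estimate obtained is one-sided, and exchanging \<beta> and
  \<beta>' gives the other side. The chain is known only through limits of difference quotients on
  both sides of a time. On the left the starting time moves with the step, so even continuity of the
  transition probabilities has to be derived. The explicit error bounds satisfy the recursion with
  equality. The uniform bound does not estimate these sums; it comes from a second, exponential
  supersolution of the same recursion.\<close>

section \<open>Finite Markov chains in continuous time\<close>

text \<open>Glues the two one-sided quotients that the generator provides, both with steps tending
  to 0 from above. At an endpoint of the interval only the inner one is required.\<close>

lemma has_field_derivative_IccI:
  fixes f :: "real \<Rightarrow> real"
  assumes "a < b" "x \<in> {a..b}"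
    and "x < b \<Longrightarrow> ((\<lambda>h. (f (x + h) - f x) / h) \<longlongrightarrow> D) (at_right 0)"
    and "a < x \<Longrightarrow> ((\<lambda>h. (f x - f (x - h)) / h) \<longlongrightarrow> D) (at_right 0)"
  shows "(f has_field_derivative D) (at x within {a..b})"
proof -
  have r: "((\<lambda>y. (f y - f x) / (y - x)) \<longlongrightarrow> D) (at_right x)" if "x < b"
    using assms(3)[OF that] by (simp add: filterlim_at_right_to_0[of _ _ x] add.commute)
  have l: "((\<lambda>y. (f y - f x) / (y - x)) \<longlongrightarrow> D) (at_left x)" if "a < x"
  proof -
    have "(f x - f (x - h)) / h = (f (x - h) - f x) / (- h)" for h
      by (simp add: minus_divide_right[symmetric] minus_divide_left)
    then show ?thesis
      using assms(4)[OF that] by (simp add: filterlim_at_left_to_right filterlim_at_right_to_0[of _ _ "- x"])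
  qed
  consider "x = a" | "x = b" | "a < x" "x < b" using assms(1,2) by fastforce
  then show ?thesis
  proof cases
    case 1 then show ?thesis using r assms(1) by (simp add: has_field_derivative_iff at_within_Icc_at_right)
  next
    case 2 then show ?thesis using l assms(1) by (simp add: has_field_derivative_iff at_within_Icc_at_left)
  next
    case 3 then show ?thesis using r l by (simp add: has_field_derivative_iff at_within_Icc_at filterlim_split_at)
  qed
qed

lemma expectation_finite_range:
  fixes \<phi> :: "'s \<Rightarrow> real"
  assumes "prob_space M" "finite S" "X \<in> M \<rightarrow>\<^sub>M count_space S"
  shows "(\<integral>\<omega>. \<phi> (X \<omega>) \<partial>M) = (\<Sum>\<eta>\<in>S. measure M {\<omega>\<in>space M. X \<omega> = \<eta>} * \<phi> \<eta>)"
proof -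
  interpret prob_space M by fact
  have ev: "{\<omega>\<in>space M. X \<omega> = \<eta>} \<in> sets M" if "\<eta> \<in> S" for \<eta>
    using measurable_sets[OF assms(3), of "{\<eta>}"] that by (auto simp: vimage_def Int_def conj_commute)
  have "(\<integral>\<omega>. \<phi> (X \<omega>) \<partial>M) = (\<integral>\<omega>. (\<Sum>\<eta>\<in>S. indicator {\<omega>\<in>space M. X \<omega> = \<eta>} \<omega> * \<phi> \<eta>) \<partial>M)"
  proof (rule Bochner_Integration.integral_cong[OF refl])
    fix \<omega> assume w: "\<omega> \<in> space M"
    then have "X \<omega> \<in> S" using measurable_space[OF assms(3)] by auto
    then show "\<phi> (X \<omega>) = (\<Sum>\<eta>\<in>S. indicator {\<omega>\<in>space M. X \<omega> = \<eta>} \<omega> * \<phi> \<eta>)"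
      using w assms(2) by (simp add: indicator_def if_distrib[of "\<lambda>x. x * _"] cong: if_cong)
  qed
  also have "\<dots> = (\<Sum>\<eta>\<in>S. (\<integral>\<omega>. indicator {\<omega>\<in>space M. X \<omega> = \<eta>} \<omega> * \<phi> \<eta> \<partial>M))"
    using ev by (intro Bochner_Integration.integral_sum) (simp add: less_top[symmetric])
  also have "\<dots> = (\<Sum>\<eta>\<in>S. measure M {\<omega>\<in>space M. X \<omega> = \<eta>} * \<phi> \<eta>)"
    using ev by (intro sum.cong refl) (simp add: Int_absorb2)
  finally show ?thesis .
qed

lemma sum_mult_indicator_singleton:
  fixes f :: "'s \<Rightarrow> real"
  assumes "finite S" "\<eta> \<in> S"
  shows "(\<Sum>\<zeta>\<in>S. f \<zeta> * indicator {\<eta>} \<zeta>) = f \<eta>"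
  using assms by (subst sum.remove[of _ \<eta>]) (auto intro!: sum.neutral simp: indicator_def)

text \<open>The generator is an operator on functions; linearity over indicators makes it a matrix.
  \<open>L (indicator {\<eta>}) t \<xi>\<close> is the rate from \<xi> to \<eta>, and on the
  diagonal minus the total rate of leaving \<xi>.\<close>

locale finite_markov_chain =
  fixes T :: real and S :: "'s set" and L :: "('s \<Rightarrow> real) \<Rightarrow> real \<Rightarrow> 's \<Rightarrow> real"
    and Xi :: "real \<Rightarrow> 'w \<Rightarrow> 's" and P :: "real \<Rightarrow> 's \<Rightarrow> 'w measure"
  assumes finite_S: "finite S" and chain: "markov_chain T S L Xi P"
    and L_linear: "\<And>t \<xi> \<phi>. t \<in> {0..T} \<Longrightarrow> \<xi> \<in> S \<Longrightarrow> L \<phi> t \<xi> = (\<Sum>\<eta>\<in>S. L (indicator {\<eta>}) t \<xi> * \<phi> \<eta>)"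
begin

text \<open>The transition matrix. Apart from measurability and Fubini for the running cost, all
  later arguments about the chain are finite sums against it.\<close>

definition tprob :: "real \<Rightarrow> real \<Rightarrow> 's \<Rightarrow> 's \<Rightarrow> real" where
  "tprob t s \<xi> \<eta> = measure (P t \<xi>) {\<omega>\<in>space (P t \<xi>). Xi s \<omega> = \<eta>}"

lemma
  assumes "t \<in> {0..T}" "\<xi> \<in> S"
  shows prob_P: "prob_space (P t \<xi>)"
    and Xi_start: "AE \<omega> in P t \<xi>. Xi t \<omega> = \<xi>"
    and Xi_right_const: "\<And>\<omega> u. \<omega> \<in> space (P t \<xi>) \<Longrightarrow> u \<in> {t..<T} \<Longrightarrow> \<forall>\<^sub>F s in at_right u. Xi s \<omega> = Xi u \<omega>"
    and Xi_measurable: "\<And>u. u \<in> {t..T} \<Longrightarrow> Xi u \<in> P t \<xi> \<rightarrow>\<^sub>M count_space S"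
proof -
  note * = bspec[OF bspec[OF conjunct1[OF chain[unfolded markov_chain_def]] assms(1)] assms(2)]
  show "prob_space (P t \<xi>)" "AE \<omega> in P t \<xi>. Xi t \<omega> = \<xi>"
    using * by (simp_all only:)
  show "\<forall>\<^sub>F s in at_right u. Xi s \<omega> = Xi u \<omega>" if "\<omega> \<in> space (P t \<xi>)" "u \<in> {t..<T}" for \<omega> u
    by (rule bspec[OF conjunct1[OF bspec[OF conjunct2[OF conjunct2[OF conjunct2[OF *]]] that(1)]] that(2)])
  show "Xi u \<in> P t \<xi> \<rightarrow>\<^sub>M count_space S" if "u \<in> {t..T}" for u
    by (rule bspec[OF conjunct1[OF conjunct2[OF *]] that])
qed

lemma Xi_event:
  assumes "t \<in> {0..T}" "\<xi> \<in> S" "u \<in> {t..T}"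
  shows "{\<omega>\<in>space (P t \<xi>). Xi u \<omega> = \<eta>} \<in> sets (P t \<xi>)"
proof (cases "\<eta> \<in> S")
  case True
  then show ?thesis
    using measurable_sets[OF Xi_measurable[OF assms], of "{\<eta>}"] by (auto simp: vimage_def Int_def conj_commute)
next
  case False
  then have "{\<omega>\<in>space (P t \<xi>). Xi u \<omega> = \<eta>} = {}"
    using measurable_space[OF Xi_measurable[OF assms]] by auto
  then show ?thesis by (metis sets.empty_sets)
qed

lemma expectation_Xi:
  assumes "t \<in> {0..T}" "\<xi> \<in> S" "u \<in> {t..T}"
  shows "(\<integral>\<omega>. \<phi> (Xi u \<omega>) \<partial>P t \<xi>) = (\<Sum>\<eta>\<in>S. tprob t u \<xi> \<eta> * \<phi> \<eta>)"
  unfolding tprob_def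
  by (rule expectation_finite_range[OF prob_P finite_S Xi_measurable]) (use assms in auto)

lemma tprob_nonneg: "0 \<le> tprob t s \<xi> \<eta>"
  by (simp add: tprob_def)

lemma sum_tprob:
  assumes "t \<in> {0..T}" "\<xi> \<in> S" "u \<in> {t..T}"
  shows "(\<Sum>\<eta>\<in>S. tprob t u \<xi> \<eta>) = 1"
proof -
  interpret prob_space "P t \<xi>" using assms by (intro prob_P)
  show ?thesis using expectation_Xi[OF assms, of "\<lambda>_. 1"] prob_space by simp
qed

lemma sum_tprob_start:
  assumes "t \<in> {0..T}" "\<xi> \<in> S"
  shows "(\<Sum>\<eta>\<in>S. tprob t t \<xi> \<eta> * \<phi> \<eta>) = \<phi> \<xi>"
proof -
  interpret prob_space "P t \<xi>" using assms by (intro prob_P)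
  have "t \<in> {t..T}" using assms by auto
  note m = Xi_measurable[OF assms this]
  have "(\<integral>\<omega>. \<phi> (Xi t \<omega>) \<partial>P t \<xi>) = (\<integral>\<omega>. \<phi> \<xi> \<partial>P t \<xi>)"
    using Xi_start[OF assms] measurable_compose[OF m, of \<phi> borel] by (intro integral_cong_AE) auto
  then show ?thesis using expectation_Xi[OF assms \<open>t \<in> {t..T}\<close>, of \<phi>] prob_space by simp
qed

text \<open>The Markov property is taken with an empty set of past times, and the event at time
  \<open>u\<close> is split over the finitely many values of \<open>Xi s\<close>.\<close>

lemma chapman_kolmogorov:
  assumes "t \<in> {0..T}" "\<xi> \<in> S" "s \<in> {t..T}" "u \<in> {s..T}" "\<eta> \<in> S"
  shows "tprob t u \<xi> \<eta> = (\<Sum>\<zeta>\<in>S. tprob t s \<xi> \<zeta> * tprob s u \<zeta> \<eta>)"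
proof -
  interpret prob_space "P t \<xi>" using assms by (intro prob_P)
  have u: "u \<in> {t..T}" using assms by auto
  have joint: "measure (P t \<xi>) {\<omega>\<in>space (P t \<xi>). Xi s \<omega> = \<zeta> \<and> Xi u \<omega> = \<eta>} = tprob t s \<xi> \<zeta> * tprob s u \<zeta> \<eta>"
    if "\<zeta> \<in> S" for \<zeta>
  proof -
    have *: "\<forall>t\<in>{0..T}. \<forall>s\<in>{t..T}. \<forall>u\<in>{s..T}. \<forall>\<xi>\<in>S. \<forall>\<zeta>\<in>S. \<forall>\<eta>\<in>S. \<forall>F f. finite F \<and> F \<subseteq> {t..s} \<longrightarrow>
        \<P>(\<omega> in P t \<xi>. (\<forall>r\<in>F. Xi r \<omega> = f r) \<and> Xi s \<omega> = \<zeta> \<and> Xi u \<omega> = \<eta>) =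
        \<P>(\<omega> in P t \<xi>. (\<forall>r\<in>F. Xi r \<omega> = f r) \<and> Xi s \<omega> = \<zeta>) * \<P>(\<omega> in P s \<zeta>. Xi u \<omega> = \<eta>)"
      by (rule conjunct1[OF conjunct2[OF chain[unfolded markov_chain_def]]])
    show ?thesis
      using *[rule_format, of t s u \<xi> \<zeta> \<eta> "{}"] assms that by (simp add: tprob_def)
  qed
  have "{\<omega>\<in>space (P t \<xi>). Xi u \<omega> = \<eta>} = (\<Union>\<zeta>\<in>S. {\<omega>\<in>space (P t \<xi>). Xi s \<omega> = \<zeta> \<and> Xi u \<omega> = \<eta>})"
    using measurable_space[OF Xi_measurable[OF assms(1-3)]] by auto
  moreover have "{\<omega>\<in>space (P t \<xi>). Xi s \<omega> = \<zeta> \<and> Xi u \<omega> = \<eta>} \<in> sets (P t \<xi>)" for \<zeta>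
  proof -
    have "{\<omega>\<in>space (P t \<xi>). Xi s \<omega> = \<zeta> \<and> Xi u \<omega> = \<eta>}
      = {\<omega>\<in>space (P t \<xi>). Xi s \<omega> = \<zeta>} \<inter> {\<omega>\<in>space (P t \<xi>). Xi u \<omega> = \<eta>}" by auto
    then show ?thesis using Xi_event[OF assms(1-3)] Xi_event[OF assms(1,2) u] by simp
  qed
  ultimately have "tprob t u \<xi> \<eta> = (\<Sum>\<zeta>\<in>S. measure (P t \<xi>) {\<omega>\<in>space (P t \<xi>). Xi s \<omega> = \<zeta> \<and> Xi u \<omega> = \<eta>})"
    unfolding tprob_def using finite_S
    by (simp only:) (rule finite_measure_finite_Union, auto simp: disjoint_family_on_def)
  then show ?thesis using joint by simp
qed

lemma generator_quotients:
  "\<forall>\<phi>. \<forall>\<xi>\<in>S.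
     (\<forall>u\<in>{0..<T}. ((\<lambda>h. ((\<integral>\<omega>. \<phi> (Xi (u + h) \<omega>) \<partial>P u \<xi>) - \<phi> \<xi>) / h) \<longlongrightarrow> L \<phi> u \<xi>) (at_right 0)) \<and>
     (\<forall>u\<in>{0<..T}. ((\<lambda>h. ((\<integral>\<omega>. \<phi> (Xi u \<omega>) \<partial>P (u - h) \<xi>) - \<phi> \<xi>) / h) \<longlongrightarrow> L \<phi> u \<xi>) (at_right 0))"
  by (rule conjunct2[OF conjunct2[OF chain[unfolded markov_chain_def]]])

lemma generator_right:
  assumes "u \<in> {0..<T}" "\<xi> \<in> S"
  shows "((\<lambda>h. ((\<Sum>\<eta>\<in>S. tprob u (u + h) \<xi> \<eta> * \<phi> \<eta>) - \<phi> \<xi>) / h) \<longlongrightarrow> L \<phi> u \<xi>) (at_right 0)"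
proof -
  have "((\<lambda>h. ((\<integral>\<omega>. \<phi> (Xi (u + h) \<omega>) \<partial>P u \<xi>) - \<phi> \<xi>) / h) \<longlongrightarrow> L \<phi> u \<xi>) (at_right 0)"
    by (rule bspec[OF conjunct1[OF bspec[OF spec[OF generator_quotients] assms(2)]] assms(1)])
  moreover have "\<forall>\<^sub>F h in at_right 0. ((\<integral>\<omega>. \<phi> (Xi (u + h) \<omega>) \<partial>P u \<xi>) - \<phi> \<xi>) / h
      = ((\<Sum>\<eta>\<in>S. tprob u (u + h) \<xi> \<eta> * \<phi> \<eta>) - \<phi> \<xi>) / h"
    by (rule eventually_at_rightI[of 0 "T - u"]) (use assms in \<open>auto simp: expectation_Xi\<close>)
  ultimately show ?thesis by (rule Lim_transform_eventually)
qed

lemma generator_left: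
  assumes "u \<in> {0<..T}" "\<xi> \<in> S"
  shows "((\<lambda>h. ((\<Sum>\<eta>\<in>S. tprob (u - h) u \<xi> \<eta> * \<phi> \<eta>) - \<phi> \<xi>) / h) \<longlongrightarrow> L \<phi> u \<xi>) (at_right 0)"
proof -
  have "((\<lambda>h. ((\<integral>\<omega>. \<phi> (Xi u \<omega>) \<partial>P (u - h) \<xi>) - \<phi> \<xi>) / h) \<longlongrightarrow> L \<phi> u \<xi>) (at_right 0)"
    by (rule bspec[OF conjunct2[OF bspec[OF spec[OF generator_quotients] assms(2)]] assms(1)])
  moreover have "\<forall>\<^sub>F h in at_right 0. ((\<integral>\<omega>. \<phi> (Xi u \<omega>) \<partial>P (u - h) \<xi>) - \<phi> \<xi>) / h
      = ((\<Sum>\<eta>\<in>S. tprob (u - h) u \<xi> \<eta> * \<phi> \<eta>) - \<phi> \<xi>) / h"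
    by (rule eventually_at_rightI[of 0 u]) (use assms in \<open>auto simp: expectation_Xi\<close>)
  ultimately show ?thesis by (rule Lim_transform_eventually)
qed

lemma tprob_le_1:
  assumes "t \<in> {0..T}" "\<xi> \<in> S"
  shows "tprob t s \<xi> \<eta> \<le> 1"
  using prob_space.prob_le_1[OF prob_P[OF assms]] by (simp add: tprob_def)

text \<open>To the right of \<open>s\<close>, Chapman-Kolmogorov splits at \<open>s\<close>, and the
  weights \<open>tprob t s\<close> do not depend on the step. To the left it splits at
  \<open>s - h\<close>, so the weights move with \<open>h\<close> and their convergence must be
  known before the limit of the sum can be taken.\<close>

lemma forward_kolmogorov:
  assumes "t \<in> {0..T}" "\<xi> \<in> S" "s \<in> {t..T}" "\<eta> \<in> S" "t < T"
  shows "((\<lambda>s. tprob t s \<xi> \<eta>) has_field_derivative (\<Sum>\<zeta>\<in>S. tprob t s \<xi> \<zeta> * L (indicator {\<eta>}) s \<zeta>)) (at s within {t..T})"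
proof (rule has_field_derivative_IccI)
  have ind: "(\<Sum>\<eta>'\<in>S. tprob r r' \<zeta> \<eta>' * indicator {\<eta>} \<eta>') = tprob r r' \<zeta> \<eta>" for r r' \<zeta>
    using assms(4) finite_S by (simp only: sum_mult_indicator_singleton)
  {
    assume "s < T"
    have "((\<lambda>h. \<Sum>\<zeta>\<in>S. tprob t s \<xi> \<zeta> * ((tprob s (s + h) \<zeta> \<eta> - indicator {\<eta>} \<zeta>) / h)) \<longlongrightarrow>
        (\<Sum>\<zeta>\<in>S. tprob t s \<xi> \<zeta> * L (indicator {\<eta>}) s \<zeta>)) (at_right 0)"
      using generator_right[of s _ "indicator {\<eta>}"] assms \<open>s < T\<close>
      by (intro tendsto_sum tendsto_mult tendsto_const) (simp add: ind del: sum_mult_indicator)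
    moreover have "\<forall>\<^sub>F h in at_right 0.
        (\<Sum>\<zeta>\<in>S. tprob t s \<xi> \<zeta> * ((tprob s (s + h) \<zeta> \<eta> - indicator {\<eta>} \<zeta>) / h))
        = (tprob t (s + h) \<xi> \<eta> - tprob t s \<xi> \<eta>) / h"
    proof (rule eventually_at_rightI[of 0 "T - s"])
      fix h assume h: "h \<in> {0<..<T - s}"
      have "tprob t (s + h) \<xi> \<eta> = (\<Sum>\<zeta>\<in>S. tprob t s \<xi> \<zeta> * tprob s (s + h) \<zeta> \<eta>)"
        by (rule chapman_kolmogorov) (use assms h in auto)
      then show "(\<Sum>\<zeta>\<in>S. tprob t s \<xi> \<zeta> * ((tprob s (s + h) \<zeta> \<eta> - indicator {\<eta>} \<zeta>) / h))
        = (tprob t (s + h) \<xi> \<eta> - tprob t s \<xi> \<eta>) / h"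
        by (simp add: sum_divide_distrib[symmetric] right_diff_distrib sum_subtractf ind del: sum_mult_indicator)
    qed (use \<open>s < T\<close> in auto)
    ultimately show "((\<lambda>h. (tprob t (s + h) \<xi> \<eta> - tprob t s \<xi> \<eta>) / h) \<longlongrightarrow>
        (\<Sum>\<zeta>\<in>S. tprob t s \<xi> \<zeta> * L (indicator {\<eta>}) s \<zeta>)) (at_right 0)"
      by (rule Lim_transform_eventually)
  }
  {
    assume "t < s"
    have q: "((\<lambda>h. (tprob (s - h) s \<zeta> \<eta>' - indicator {\<eta>'} \<zeta>) / h) \<longlongrightarrow> L (indicator {\<eta>'}) s \<zeta>) (at_right 0)"
      if "\<zeta> \<in> S" "\<eta>' \<in> S" for \<zeta> \<eta>'
      using generator_left[of s \<zeta> "indicator {\<eta>'}"] assms(1,3) \<open>t < s\<close> that finite_S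
      by (simp add: sum_mult_indicator_singleton del: sum_mult_indicator)
    have eq: "(tprob t s \<xi> \<eta>' - tprob t (s - h) \<xi> \<eta>') / h
        = (\<Sum>\<zeta>\<in>S. tprob t (s - h) \<xi> \<zeta> * ((tprob (s - h) s \<zeta> \<eta>' - indicator {\<eta>'} \<zeta>) / h))"
      if "h \<in> {0<..<s - t}" "\<eta>' \<in> S" for h \<eta>'
    proof -
      have "tprob t s \<xi> \<eta>' = (\<Sum>\<zeta>\<in>S. tprob t (s - h) \<xi> \<zeta> * tprob (s - h) s \<zeta> \<eta>')"
        by (rule chapman_kolmogorov) (use assms that in auto)
      moreover have "(\<Sum>\<zeta>\<in>S. tprob t (s - h) \<xi> \<zeta> * indicator {\<eta>'} \<zeta>) = tprob t (s - h) \<xi> \<eta>'"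
        using that(2) finite_S by (simp only: sum_mult_indicator_singleton)
      ultimately show ?thesis
        by (simp add: sum_divide_distrib[symmetric] right_diff_distrib sum_subtractf)
    qed
    \<comment> \<open>The increment is \<open>h\<close> times a combination of convergent quotients
      with weights in [0,1]. The bound \<open>?B\<close> drops the weights, so its limit 0 uses no
      continuity of the transition probabilities.\<close>
    have cont: "((\<lambda>h. tprob t (s - h) \<xi> \<eta>') \<longlongrightarrow> tprob t s \<xi> \<eta>') (at_right 0)" if "\<eta>' \<in> S" for \<eta>'
    proof -
      let ?B = "\<lambda>h. \<Sum>\<zeta>\<in>S. \<bar>h * ((tprob (s - h) s \<zeta> \<eta>' - indicator {\<eta>'} \<zeta>) / h)\<bar>"
      have "(?B \<longlongrightarrow> (\<Sum>\<zeta>\<in>S. \<bar>0 * L (indicator {\<eta>'}) s \<zeta>\<bar>)) (at_right 0)"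
        using that by (intro tendsto_sum tendsto_rabs tendsto_mult q tendsto_ident_at)
      then have B0: "(?B \<longlongrightarrow> 0) (at_right 0)" by simp
      have "\<forall>\<^sub>F h in at_right 0. norm (tprob t s \<xi> \<eta>' - tprob t (s - h) \<xi> \<eta>') \<le> ?B h"
      proof (rule eventually_at_rightI[of 0 "s - t"])
        fix h assume h: "h \<in> {0<..<s - t}"
        have "tprob t s \<xi> \<eta>' - tprob t (s - h) \<xi> \<eta>' = h * ((tprob t s \<xi> \<eta>' - tprob t (s - h) \<xi> \<eta>') / h)"
          using h by simp
        also have "\<dots> = (\<Sum>\<zeta>\<in>S. tprob t (s - h) \<xi> \<zeta> * (h * ((tprob (s - h) s \<zeta> \<eta>' - indicator {\<eta>'} \<zeta>) / h)))"
          by (simp only: eq[OF h that] sum_distrib_left mult.left_commute)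
        finally have *: "tprob t s \<xi> \<eta>' - tprob t (s - h) \<xi> \<eta>' = \<dots>" .
        show "norm (tprob t s \<xi> \<eta>' - tprob t (s - h) \<xi> \<eta>') \<le> ?B h"
          unfolding * real_norm_def using tprob_nonneg tprob_le_1[OF assms(1,2)]
          by (intro order_trans[OF sum_abs] sum_mono) (simp only: abs_mult[of "tprob _ _ _ _"] abs_of_nonneg mult_left_le_one_le abs_ge_zero)
      qed (use \<open>t < s\<close> in auto)
      then have "((\<lambda>h. tprob t s \<xi> \<eta>' - tprob t (s - h) \<xi> \<eta>') \<longlongrightarrow> 0) (at_right 0)"
        using B0 by (rule Lim_null_comparison)
      from tendsto_diff[OF tendsto_const[of "tprob t s \<xi> \<eta>'"] this] show ?thesis by simp
    qed
    have "((\<lambda>h. \<Sum>\<zeta>\<in>S. tprob t (s - h) \<xi> \<zeta> * ((tprob (s - h) s \<zeta> \<eta> - indicator {\<eta>} \<zeta>) / h)) \<longlongrightarrow>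
        (\<Sum>\<zeta>\<in>S. tprob t s \<xi> \<zeta> * L (indicator {\<eta>}) s \<zeta>)) (at_right 0)"
      using assms(4) by (intro tendsto_sum tendsto_mult cont q)
    moreover have "\<forall>\<^sub>F h in at_right 0.
        (\<Sum>\<zeta>\<in>S. tprob t (s - h) \<xi> \<zeta> * ((tprob (s - h) s \<zeta> \<eta> - indicator {\<eta>} \<zeta>) / h))
        = (tprob t s \<xi> \<eta> - tprob t (s - h) \<xi> \<eta>) / h"
      by (rule eventually_at_rightI[of 0 "s - t"]) (use \<open>t < s\<close> assms(4) eq in auto)
    ultimately show "((\<lambda>h. (tprob t s \<xi> \<eta> - tprob t (s - h) \<xi> \<eta>) / h) \<longlongrightarrow>
        (\<Sum>\<zeta>\<in>S. tprob t s \<xi> \<zeta> * L (indicator {\<eta>}) s \<zeta>)) (at_right 0)"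
      by (rule Lim_transform_eventually)
  }
qed (use assms in auto)

lemma tprob_continuous:
  assumes "t \<in> {0..T}" "\<xi> \<in> S" "\<eta> \<in> S"
  shows "continuous_on {t..T} (\<lambda>s. tprob t s \<xi> \<eta>)"
proof (cases "t < T")
  case True
  show ?thesis by (rule DERIV_continuous_on, rule forward_kolmogorov) (use assms True in auto)
next
  case False
  then have "{t..T} \<subseteq> {t}" by auto
  then show ?thesis by (meson continuous_on_sing continuous_on_subset)
qed

text \<open>The mean of \<open>w s\<close> at time \<open>s\<close> is differentiated by the product
  rule. The forward equation puts the generator on the transition probabilities, and after
  exchanging the sums linearity moves it onto \<open>w s\<close>. For \<open>t = T\<close> the
  interval is a point and both sides vanish.\<close>

lemma dynkin:
  assumes "t \<in> {0..T}" "\<xi> \<in> S"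
    and w: "\<And>\<eta> s. \<eta> \<in> S \<Longrightarrow> s \<in> {0..T} \<Longrightarrow> ((\<lambda>s. w s \<eta>) has_field_derivative w' s \<eta>) (at s within {0..T})"
  shows "((\<lambda>s. \<Sum>\<eta>\<in>S. tprob t s \<xi> \<eta> * (w' s \<eta> + L (w s) s \<eta>)) has_integral
      (\<Sum>\<eta>\<in>S. tprob t T \<xi> \<eta> * w T \<eta>) - w t \<xi>) {t..T}"
proof (cases "t < T")
  case True
  let ?m = "\<lambda>s. \<Sum>\<eta>\<in>S. tprob t s \<xi> \<eta> * w s \<eta>"
  have "(?m has_field_derivative (\<Sum>\<eta>\<in>S. tprob t s \<xi> \<eta> * (w' s \<eta> + L (w s) s \<eta>))) (at s within {t..T})"
    if s: "s \<in> {t..T}" for s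
  proof -
    have s0: "s \<in> {0..T}" and sub: "{t..T} \<subseteq> {0..T}" using s assms(1) by auto
    have "(?m has_field_derivative
        (\<Sum>\<eta>\<in>S. tprob t s \<xi> \<eta> * w' s \<eta> + (\<Sum>\<zeta>\<in>S. tprob t s \<xi> \<zeta> * L (indicator {\<eta>}) s \<zeta>) * w s \<eta>)) (at s within {t..T})"
      using s s0 assms True
      by (intro DERIV_sum DERIV_mult' forward_kolmogorov has_field_derivative_subset[OF w sub])
    also have "(\<Sum>\<eta>\<in>S. tprob t s \<xi> \<eta> * w' s \<eta> + (\<Sum>\<zeta>\<in>S. tprob t s \<xi> \<zeta> * L (indicator {\<eta>}) s \<zeta>) * w s \<eta>)
        = (\<Sum>\<eta>\<in>S. tprob t s \<xi> \<eta> * w' s \<eta>) + (\<Sum>\<zeta>\<in>S. \<Sum>\<eta>\<in>S. tprob t s \<xi> \<zeta> * (L (indicator {\<eta>}) s \<zeta> * w s \<eta>))"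
      by (simp add: sum.distrib sum_distrib_right mult.assoc) (rule sum.swap)
    also have "\<dots> = (\<Sum>\<eta>\<in>S. tprob t s \<xi> \<eta> * (w' s \<eta> + L (w s) s \<eta>))"
      using L_linear[OF s0, of _ "w s"] by (simp add: sum_distrib_left[symmetric] sum.distrib distrib_left)
    finally show ?thesis .
  qed
  then have "((\<lambda>s. \<Sum>\<eta>\<in>S. tprob t s \<xi> \<eta> * (w' s \<eta> + L (w s) s \<eta>)) has_integral ?m T - ?m t) {t..T}"
    using True by (intro fundamental_theorem_of_calculus) (auto simp: has_real_derivative_iff_has_vector_derivative)
  then show ?thesis using sum_tprob_start[OF assms(1,2)] by simp
next
  case False
  then have "t = T" using assms by auto
  then show ?thesis using sum_tprob_start[OF assms(1,2), of "w T"] by (simp add: has_integral_refl)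
qed

end

section \<open>Measurability of the running cost and the expected total cost\<close>

lemma continuous_Icc_finite_bounded:
  fixes f :: "real \<Rightarrow> 's \<Rightarrow> 'b::real_normed_vector"
  assumes "finite S" "\<And>\<eta>. \<eta> \<in> S \<Longrightarrow> continuous_on {a..b} (\<lambda>u. f u \<eta>)"
  obtains C where "C > 0" "\<And>u \<eta>. u \<in> {a..b} \<Longrightarrow> \<eta> \<in> S \<Longrightarrow> norm (f u \<eta>) \<le> C"
proof -
  have "bounded (\<Union>\<eta>\<in>S. (\<lambda>u. f u \<eta>) ` {a..b})"
    using assms by (intro bounded_UN ballI compact_imp_bounded compact_continuous_image) auto
  then obtain C where "C > 0" "\<forall>x\<in>(\<Union>\<eta>\<in>S. (\<lambda>u. f u \<eta>) ` {a..b}). norm x \<le> C"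
    unfolding bounded_pos by auto
  then show thesis by (intro that[of C]) auto
qed

context finite_markov_chain
begin

text \<open>Joint measurability comes from sampling the right-continuous path at the grid point just after \<open>u\<close>.\<close>
lemma running_cost_measurable:
  fixes f :: "real \<Rightarrow> 's \<Rightarrow> real"
  assumes "t \<in> {0..T}" "\<xi> \<in> S"
    and f: "\<And>\<eta>. \<eta> \<in> S \<Longrightarrow> continuous_on {t..T} (\<lambda>u. f u \<eta>)"
  shows "(\<lambda>(u, \<omega>). indicator {t..T} u *\<^sub>R f u (Xi u \<omega>)) \<in> borel_measurable (lborel \<Otimes>\<^sub>M P t \<xi>)"
proof -
  \<comment> \<open>\<open>\<rho> n k\<close> is the grid point (k+1)/(n+1) clipped to [t,T]. With
    \<open>k\<close> the floor of u(n+1) the unclipped point lies strictly after \<open>u\<close>,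
    as needed to approach \<open>u\<close> along \<open>at_right u\<close>.\<close>
  define \<rho> where "\<rho> n k = max t (min T ((real_of_int k + 1) / real (Suc n)))" for n k
  define r where "r n u = \<rho> n \<lfloor>u * real (Suc n)\<rfloor>" for n u
  \<comment> \<open>Writing the value at the sampled state as a finite sum over states separates the
    time dependence of \<open>f\<close> from the path; only countably many sampling times occur for
    each \<open>n\<close>.\<close>
  define F where "F n = (\<lambda>(u, \<omega>). \<Sum>\<eta>\<in>S. (indicator {t..T} u *\<^sub>R f u \<eta>) * indicator {\<eta>} (Xi (r n u) \<omega>))" for n
  have \<rho>: "\<rho> n k \<in> {t..T}" for n k using assms(1) by (auto simp: \<rho>_def)
  show ?thesis
  proof (rule borel_measurable_LIMSEQ_real)
    fix n
    have 1: "(\<lambda>p. indicator {t..T} (fst p) *\<^sub>R f (fst p) \<eta>) \<in> borel_measurable (lborel \<Otimes>\<^sub>M P t \<xi>)" if "\<eta> \<in> S" for \<eta>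
    proof -
      have "(\<lambda>u. indicator {t..T} u *\<^sub>R f u \<eta>) \<in> borel_measurable borel"
        by (intro borel_measurable_continuous_on_indicator f that) auto
      then show ?thesis by measurable
    qed
    have 2: "(\<lambda>p. indicator {\<eta>} (Xi (r n (fst p)) (snd p)) :: real) \<in> borel_measurable (lborel \<Otimes>\<^sub>M P t \<xi>)" if "\<eta> \<in> S" for \<eta>
      unfolding r_def
    proof (rule measurable_compose_countable)
      show "(\<lambda>p. \<lfloor>fst p * real (Suc n)\<rfloor>) \<in> lborel \<Otimes>\<^sub>M P t \<xi> \<rightarrow>\<^sub>M count_space UNIV" by measurable
      fix k
      have "(\<lambda>\<omega>. indicator {\<eta>} (Xi (\<rho> n k) \<omega>) :: real) \<in> borel_measurable (P t \<xi>)"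
        by (rule measurable_compose[OF Xi_measurable[OF assms(1,2) \<rho>]]) simp
      then show "(\<lambda>p. indicator {\<eta>} (Xi (\<rho> n k) (snd p)) :: real) \<in> borel_measurable (lborel \<Otimes>\<^sub>M P t \<xi>)"
        by measurable
    qed
    show "F n \<in> borel_measurable (lborel \<Otimes>\<^sub>M P t \<xi>)"
      unfolding F_def case_prod_beta by (intro borel_measurable_sum borel_measurable_times 1 2)
  next
    fix p :: "real \<times> 'w" assume p: "p \<in> space (lborel \<Otimes>\<^sub>M P t \<xi>)"
    obtain u \<omega> where [simp]: "p = (u, \<omega>)" by (cases p)
    have w: "\<omega> \<in> space (P t \<xi>)" using p by (simp add: space_pair_measure)
    show "(\<lambda>n. F n p) \<longlonglongrightarrow> (case p of (u, \<omega>) \<Rightarrow> indicator {t..T} u *\<^sub>R f u (Xi u \<omega>))"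
    proof (cases "u \<in> {t..T}")
      case False
      then show ?thesis by (simp add: F_def)
    next
      case True
      have near: "u < (real_of_int \<lfloor>u * real (Suc n)\<rfloor> + 1) / real (Suc n)"
        "(real_of_int \<lfloor>u * real (Suc n)\<rfloor> + 1) / real (Suc n) \<le> u + inverse (real (Suc n))" for n
      proof -
        have "0 < m \<Longrightarrow> u < (real_of_int \<lfloor>u * m\<rfloor> + 1) / m \<and> (real_of_int \<lfloor>u * m\<rfloor> + 1) / m \<le> u + inverse m" for m
          using floor_correct[of "u * m"] by (simp add: field_simps)
        then show "u < (real_of_int \<lfloor>u * real (Suc n)\<rfloor> + 1) / real (Suc n)"
          "(real_of_int \<lfloor>u * real (Suc n)\<rfloor> + 1) / real (Suc n) \<le> u + inverse (real (Suc n))"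
          by (simp_all del: of_nat_Suc)
      qed
      have "\<forall>\<^sub>F n in sequentially. Xi (r n u) \<omega> = Xi u \<omega>"
      \<comment> \<open>At the terminal time there is no room to the right, but clipping makes every
        sampling time equal to \<open>T\<close>.\<close>
      proof (cases "u < T")
        case False
        then have uT: "u = T" using True by auto
        have "T < (real_of_int \<lfloor>T * real (Suc n)\<rfloor> + 1) / real (Suc n)" for n using near(1)[of n] uT by simp
        then have "r n u = T" for n
          unfolding r_def \<rho>_def uT using True uT by (simp add: min_absorb1 less_imp_le)
        then show ?thesis using uT by simp
      next
        case uT: True
        have bound: "u < r n u" "r n u \<le> u + inverse (real (Suc n))" for n
          using near[of n] True uT by (auto simp: r_def \<rho>_def)
        have "(\<lambda>n. u + inverse (real (Suc n))) \<longlonglongrightarrow> u"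
          using tendsto_add[OF tendsto_const LIMSEQ_inverse_real_of_nat] by simp
        then have "(\<lambda>n. r n u) \<longlonglongrightarrow> u"
          by (rule tendsto_sandwich[OF _ _ tendsto_const, rotated 2]) (use bound less_imp_le[OF bound(1)] in auto)
        then have "filterlim (\<lambda>n. r n u) (at_right u) sequentially"
          using bound by (intro tendsto_imp_filterlim_at_right) auto
        then show ?thesis
          using Xi_right_const[OF assms(1,2) w, of u] True uT by (auto intro: eventually_compose_filterlim)
      qed
      moreover have "Xi u \<omega> \<in> S"
        using measurable_space[OF Xi_measurable[OF assms(1,2) True] w] by simp
      then have "F n p = f u (Xi u \<omega>)" if "Xi (r n u) \<omega> = Xi u \<omega>" for n
        using True finite_S that
        by (simp add: F_def, subst sum.remove[of _ "Xi u \<omega>"]) (auto intro!: sum.neutral simp: indicator_def)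
      ultimately have "\<forall>\<^sub>F n in sequentially. F n p = f u (Xi u \<omega>)"
        by (rule eventually_mono)
      then show ?thesis using True by (simp add: tendsto_eventually)
    qed
  qed
qed

text \<open>Fubini applies because \<open>f\<close> is bounded on a compact interval times a finite
  set, and Lebesgue measure on [t,T] times a probability has finite mass.\<close>

lemma expected_running_cost:
  fixes f :: "real \<Rightarrow> 's \<Rightarrow> real" and g :: "'s \<Rightarrow> real"
  assumes "t \<in> {0..T}" "\<xi> \<in> S"
    and f: "\<And>\<eta>. \<eta> \<in> S \<Longrightarrow> continuous_on {t..T} (\<lambda>u. f u \<eta>)"
  shows "(\<integral>\<omega>. (LBINT u:{t..T}. f u (Xi u \<omega>)) + g (Xi T \<omega>) \<partial>P t \<xi>)
    = integral {t..T} (\<lambda>u. \<Sum>\<eta>\<in>S. tprob t u \<xi> \<eta> * f u \<eta>) + (\<Sum>\<eta>\<in>S. tprob t T \<xi> \<eta> * g \<eta>)"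
proof -
  interpret Pt: prob_space "P t \<xi>" using assms by (intro prob_P)
  interpret pair_sigma_finite lborel "P t \<xi>" ..
  have TT: "T \<in> {t..T}" using assms by auto
  obtain C where C: "C > 0" "\<And>u \<eta>. u \<in> {t..T} \<Longrightarrow> \<eta> \<in> S \<Longrightarrow> norm (f u \<eta>) \<le> C"
    using continuous_Icc_finite_bounded[where f=f, OF finite_S f] by blast
  let ?h = "\<lambda>u \<omega>. indicator {t..T} u *\<^sub>R f u (Xi u \<omega>)"
  have int: "integrable (lborel \<Otimes>\<^sub>M P t \<xi>) (\<lambda>(u, \<omega>). ?h u \<omega>)"
  proof (rule integrableI_bounded_set[where A="{t..T} \<times> space (P t \<xi>)" and B=C])
    show "{t..T} \<times> space (P t \<xi>) \<in> sets (lborel \<Otimes>\<^sub>M P t \<xi>)" by auto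
    show "(\<lambda>(u, \<omega>). ?h u \<omega>) \<in> borel_measurable (lborel \<Otimes>\<^sub>M P t \<xi>)"
      by (rule running_cost_measurable[OF assms])
    show "emeasure (lborel \<Otimes>\<^sub>M P t \<xi>) ({t..T} \<times> space (P t \<xi>)) < \<infinity>"
      using sigma_finite_measure.emeasure_pair_measure_Times[OF Pt.sigma_finite_measure_axioms,
          where A="{t..T}" and B="space (P t \<xi>)" and N=lborel] assms(1)
      by (simp add: Pt.emeasure_space_1)
    show "AE p in lborel \<Otimes>\<^sub>M P t \<xi>. p \<in> {t..T} \<times> space (P t \<xi>) \<longrightarrow> norm (case p of (u, \<omega>) \<Rightarrow> ?h u \<omega>) \<le> C"
      using measurable_space[OF Xi_measurable[OF assms(1,2)]] C(2)[OF _ , unfolded real_norm_def]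
      by (intro AE_I2) auto
  qed (auto intro!: AE_I2 simp: space_pair_measure indicator_def split: if_splits)
  have inner: "(\<integral>\<omega>. ?h u \<omega> \<partial>P t \<xi>) = indicator {t..T} u *\<^sub>R (\<Sum>\<eta>\<in>S. tprob t u \<xi> \<eta> * f u \<eta>)" for u
    using expectation_Xi[OF assms(1,2), of u "f u"] by (cases "u \<in> {t..T}") auto
  have cont: "continuous_on {t..T} (\<lambda>u. \<Sum>\<eta>\<in>S. tprob t u \<xi> \<eta> * f u \<eta>)"
    using assms by (intro continuous_on_sum continuous_on_mult tprob_continuous f)
  have "(\<integral>\<omega>. (LBINT u:{t..T}. f u (Xi u \<omega>)) \<partial>P t \<xi>) = (\<integral>u. (\<integral>\<omega>. ?h u \<omega> \<partial>P t \<xi>) \<partial>lborel)"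
    unfolding set_lebesgue_integral_def by (rule Fubini_integral[OF int])
  also have "\<dots> = (LBINT u:{t..T}. \<Sum>\<eta>\<in>S. tprob t u \<xi> \<eta> * f u \<eta>)"
    unfolding set_lebesgue_integral_def inner ..
  also have "\<dots> = integral {t..T} (\<lambda>u. \<Sum>\<eta>\<in>S. tprob t u \<xi> \<eta> * f u \<eta>)"
    by (rule set_borel_integral_eq_integral(2)[OF borel_integrable_atLeastAtMost'[OF cont]])
  finally have A: "(\<integral>\<omega>. (LBINT u:{t..T}. f u (Xi u \<omega>)) \<partial>P t \<xi>) = \<dots>" .
  have "integrable (P t \<xi>) (\<lambda>\<omega>. LBINT u:{t..T}. f u (Xi u \<omega>))"
    unfolding set_lebesgue_integral_def by (rule integrable_snd[OF int])
  moreover have "integrable (P t \<xi>) (\<lambda>\<omega>. g (Xi T \<omega>))"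
  proof (rule Pt.integrable_const_bound[where B="\<Sum>\<eta>\<in>S. \<bar>g \<eta>\<bar>"])
    show "AE \<omega> in P t \<xi>. norm (g (Xi T \<omega>)) \<le> (\<Sum>\<eta>\<in>S. \<bar>g \<eta>\<bar>)"
      using measurable_space[OF Xi_measurable[OF assms(1,2) TT]] finite_S
      by (intro AE_I2) (auto intro: member_le_sum[of _ _ "\<lambda>\<eta>. \<bar>g \<eta>\<bar>"])
    show "(\<lambda>\<omega>. g (Xi T \<omega>)) \<in> borel_measurable (P t \<xi>)"
      by (rule measurable_compose[OF Xi_measurable[OF assms(1,2) TT]]) simp
  qed
  ultimately show ?thesis
    using A expectation_Xi[OF assms(1,2) TT, of g] by simp
qed

lemma cost_eq_defect:
  fixes f :: "real \<Rightarrow> 's \<Rightarrow> real" and g :: "'s \<Rightarrow> real"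
  assumes "t \<in> {0..T}" "\<xi> \<in> S"
    and f: "\<And>\<eta>. \<eta> \<in> S \<Longrightarrow> continuous_on {0..T} (\<lambda>u. f u \<eta>)"
    and w: "\<And>\<eta> s. \<eta> \<in> S \<Longrightarrow> s \<in> {0..T} \<Longrightarrow> ((\<lambda>s. w s \<eta>) has_field_derivative w' s \<eta>) (at s within {0..T})"
    and wT: "\<And>\<eta>. \<eta> \<in> S \<Longrightarrow> w T \<eta> = g \<eta>"
  shows "((\<lambda>s. \<Sum>\<eta>\<in>S. tprob t s \<xi> \<eta> * (f s \<eta> + w' s \<eta> + L (w s) s \<eta>)) has_integral
    (\<integral>\<omega>. (LBINT u:{t..T}. f u (Xi u \<omega>)) + g (Xi T \<omega>) \<partial>P t \<xi>) - w t \<xi>) {t..T}"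
proof -
  have f': "continuous_on {t..T} (\<lambda>u. f u \<eta>)" if "\<eta> \<in> S" for \<eta>
    using assms(1) by (intro continuous_on_subset[OF f[OF that]]) auto
  have "continuous_on {t..T} (\<lambda>u. \<Sum>\<eta>\<in>S. tprob t u \<xi> \<eta> * f u \<eta>)"
    using assms by (intro continuous_on_sum continuous_on_mult tprob_continuous f')
  then have "((\<lambda>u. \<Sum>\<eta>\<in>S. tprob t u \<xi> \<eta> * f u \<eta>) has_integral
      integral {t..T} (\<lambda>u. \<Sum>\<eta>\<in>S. tprob t u \<xi> \<eta> * f u \<eta>)) {t..T}"
    by (intro integrable_integral integrable_continuous_real)
  from has_integral_add[OF this dynkin[where w=w, OF assms(1,2) w]]
  show ?thesis
    using expected_running_cost[where f=f and g=g, OF assms(1,2) f'] wT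
    by (simp add: sum.distrib[symmetric] distrib_left[symmetric] add.assoc add_diff_eq)
qed

text \<open>A bound on the defect that is uniform in the state survives averaging, since transition
  probabilities are nonnegative and sum to 1. Taking \<open>b = 0\<close> gives verification; taking
  \<open>b\<close> to be the gap of two generators gives stability.\<close>

lemma
  fixes f :: "real \<Rightarrow> 's \<Rightarrow> real" and g :: "'s \<Rightarrow> real"
  assumes "t \<in> {0..T}" "\<xi> \<in> S"
    and f: "\<And>\<eta>. \<eta> \<in> S \<Longrightarrow> continuous_on {0..T} (\<lambda>u. f u \<eta>)"
    and w: "\<And>\<eta> s. \<eta> \<in> S \<Longrightarrow> s \<in> {0..T} \<Longrightarrow> ((\<lambda>s. w s \<eta>) has_field_derivative w' s \<eta>) (at s within {0..T})"
    and wT: "\<And>\<eta>. \<eta> \<in> S \<Longrightarrow> w T \<eta> = g \<eta>"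
    and b: "continuous_on {t..T} b"
  defines "J \<equiv> \<integral>\<omega>. (LBINT u:{t..T}. f u (Xi u \<omega>)) + g (Xi T \<omega>) \<partial>P t \<xi>"
  shows cost_le_defect: "(\<And>s \<eta>. s \<in> {t..T} \<Longrightarrow> \<eta> \<in> S \<Longrightarrow> f s \<eta> + w' s \<eta> + L (w s) s \<eta> \<le> b s) \<Longrightarrow>
      J \<le> w t \<xi> + integral {t..T} b"
    and cost_ge_defect: "(\<And>s \<eta>. s \<in> {t..T} \<Longrightarrow> \<eta> \<in> S \<Longrightarrow> b s \<le> f s \<eta> + w' s \<eta> + L (w s) s \<eta>) \<Longrightarrow>
      w t \<xi> + integral {t..T} b \<le> J"
proof -
  note I = cost_eq_defect[where f=f and g=g and w=w, OF assms(1,2) f w wT]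
  have B: "(b has_integral integral {t..T} b) {t..T}"
    using b by (intro integrable_integral integrable_continuous_real)
  have avg: "(\<Sum>\<eta>\<in>S. tprob t s \<xi> \<eta> * b s) = b s" if "s \<in> {t..T}" for s
    using sum_tprob[OF assms(1,2) that] by (simp add: sum_distrib_right[symmetric])
  show "J \<le> w t \<xi> + integral {t..T} b"
    if "\<And>s \<eta>. s \<in> {t..T} \<Longrightarrow> \<eta> \<in> S \<Longrightarrow> f s \<eta> + w' s \<eta> + L (w s) s \<eta> \<le> b s"
  proof -
    have "(\<Sum>\<eta>\<in>S. tprob t s \<xi> \<eta> * (f s \<eta> + w' s \<eta> + L (w s) s \<eta>)) \<le> b s" if "s \<in> {t..T}" for s
      by (subst avg[OF that, symmetric], rule sum_mono, rule mult_left_mono) (use \<open>\<And>s \<eta>. s \<in> {t..T} \<Longrightarrow> \<eta> \<in> S \<Longrightarrow> f s \<eta> + w' s \<eta> + L (w s) s \<eta> \<le> b s\<close> that tprob_nonneg in auto)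
    from has_integral_le[OF I B this] show ?thesis unfolding J_def by simp
  qed
  show "w t \<xi> + integral {t..T} b \<le> J"
    if "\<And>s \<eta>. s \<in> {t..T} \<Longrightarrow> \<eta> \<in> S \<Longrightarrow> b s \<le> f s \<eta> + w' s \<eta> + L (w s) s \<eta>"
  proof -
    have "b s \<le> (\<Sum>\<eta>\<in>S. tprob t s \<xi> \<eta> * (f s \<eta> + w' s \<eta> + L (w s) s \<eta>))" if "s \<in> {t..T}" for s
      by (subst avg[OF that, symmetric], rule sum_mono, rule mult_left_mono) (use \<open>\<And>s \<eta>. s \<in> {t..T} \<Longrightarrow> \<eta> \<in> S \<Longrightarrow> b s \<le> f s \<eta> + w' s \<eta> + L (w s) s \<eta>\<close> that tprob_nonneg in auto)
    from has_integral_le[OF B I this] show ?thesis unfolding J_def by simp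
  qed
qed

end

section \<open>Minimisers of the Hamiltonian\<close>

definition argmin_on :: "'a set \<Rightarrow> ('a \<Rightarrow> real) \<Rightarrow> 'a" where
  "argmin_on C F = (THE a. a \<in> C \<and> (\<forall>b\<in>C. F a \<le> F b))"

text \<open>Only the midpoint case of strong convexity is ever used.\<close>
definition midpoint_convex_on :: "'a::real_normed_vector set \<Rightarrow> real \<Rightarrow> ('a \<Rightarrow> real) \<Rightarrow> bool" where
  "midpoint_convex_on C \<kappa> F \<longleftrightarrow>
     (\<forall>a\<in>C. \<forall>b\<in>C. midpoint a b \<in> C \<and> F (midpoint a b) \<le> (F a + F b) / 2 - \<kappa> / 2 * (norm (b - a))\<^sup>2)"

text \<open>Quadratic growth away from a minimiser: compare \<open>F a\<close> with the value at the
  midpoint of \<open>a\<close> and \<open>b\<close> and double the inequality.\<close>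

lemma minimiser_gap:
  assumes "midpoint_convex_on C \<kappa> F" "a \<in> C" "b \<in> C" "\<And>c. c \<in> C \<Longrightarrow> F a \<le> F c"
  shows "F a + \<kappa> * (norm (b - a))\<^sup>2 \<le> F b"
proof -
  have "midpoint a b \<in> C" "F (midpoint a b) \<le> (F a + F b) / 2 - \<kappa> / 2 * (norm (b - a))\<^sup>2"
    using assms(1-3) unfolding midpoint_convex_on_def by blast+
  moreover have "F a \<le> F (midpoint a b)" using calculation(1) by (rule assms(4))
  ultimately show ?thesis by (simp add: field_simps)
qed

lemma argmin_on:
  assumes "0 < \<kappa>" "midpoint_convex_on C \<kappa> F" "a \<in> C" "\<And>b. b \<in> C \<Longrightarrow> F a \<le> F b"
  shows "argmin_on C F = a"
  unfolding argmin_on_def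
proof (rule the_equality)
  fix a' assume "a' \<in> C \<and> (\<forall>b\<in>C. F a' \<le> F b)"
  then have "\<kappa> * (norm (a' - a))\<^sup>2 \<le> 0"
    using minimiser_gap[OF assms(2,3) _ assms(4), of a'] assms(3) by force
  then show "a' = a" using assms(1) by (simp add: mult_le_0_iff)
qed (use assms in auto)

lemma argmin_on_attained:
  fixes F :: "'a::euclidean_space \<Rightarrow> real"
  assumes "0 < \<kappa>" "midpoint_convex_on C \<kappa> F" "compact C" "C \<noteq> {}" "continuous_on C F"
  shows "argmin_on C F \<in> C" "\<And>b. b \<in> C \<Longrightarrow> F (argmin_on C F) \<le> F b"
proof -
  obtain a where "a \<in> C" "\<forall>b\<in>C. F a \<le> F b"
    using continuous_attains_inf[OF assms(3-5)] by blast
  moreover from this have "argmin_on C F = a"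
    by (intro argmin_on[OF assms(1,2)]) auto
  ultimately show "argmin_on C F \<in> C" "\<And>b. b \<in> C \<Longrightarrow> F (argmin_on C F) \<le> F b" by auto
qed

section \<open>The control orthant and the finite state space\<close>

lemma closed_orthant: "closed (orthant x)"
proof -
  have "orthant x = {a. a $ x = 0} \<inter> (\<Inter>y. {a. 0 \<le> a $ y})" by (auto simp: orthant_def)
  then show ?thesis
    by (auto intro!: closed_Int closed_INT closed_Collect_eq closed_Collect_le continuous_intros)
qed

lemma zero_in_orthant [simp]: "0 \<in> orthant x"
  by (simp add: orthant_def)

lemma orthant_convex_comb:
  assumes "a \<in> orthant x" "b \<in> orthant x" "0 \<le> u" "0 \<le> v"
  shows "u *\<^sub>R a + v *\<^sub>R b \<in> orthant x"
  using assms by (auto simp: orthant_def)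

lemma finite_emp_measures: "finite (emp_measures N :: (real ^ 'd::finite) set)"
proof (rule finite_subset)
  let ?A = "(\<lambda>k. real k / real N) ` {0..N}"
  show "emp_measures N \<subseteq> vec_lambda ` (UNIV \<rightarrow>\<^sub>E ?A :: ('d \<Rightarrow> real) set)"
  proof
    fix \<mu> :: "real ^ 'd" assume "\<mu> \<in> emp_measures N"
    then have "vec_nth \<mu> \<in> UNIV \<rightarrow>\<^sub>E ?A" unfolding emp_measures_def by fastforce
    then show "\<mu> \<in> vec_lambda ` (UNIV \<rightarrow>\<^sub>E ?A)" by (metis image_eqI vec_nth_inverse)
  qed
  show "finite (vec_lambda ` (UNIV \<rightarrow>\<^sub>E ?A :: ('d \<Rightarrow> real) set))"
    by (intro finite_imageI finite_PiE) auto
qed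

lemma finite_states [simp]: "finite (states N)"
  unfolding states_def by (intro finite_cartesian_product finite_emp_measures finite)

text \<open>One particle moves from \<open>z\<close> to \<open>y\<close>. There is a particle at
  \<open>z\<close>, and the counts at \<open>y\<close> and \<open>z\<close> together are at most
  \<open>N\<close>, so the count at \<open>y\<close> can rise by one.\<close>

lemma emp_measures_shift:
  assumes "0 < N" "\<mu> \<in> emp_measures N" "\<mu> $ z \<noteq> 0"
  shows "\<mu> + unit_shift N y z \<in> emp_measures N"
proof (cases "y = z")
  case True
  then show ?thesis using assms by (simp add: unit_shift_def)
next
  case False
  obtain k where k: "\<And>x. k x \<le> N" "\<And>x. \<mu> $ x = real (k x) / real N"
  proof -
    have "\<forall>x. \<exists>k. k \<le> N \<and> \<mu> $ x = real k / real N" using assms(2) unfolding emp_measures_def by fastforce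
    then show thesis using that by metis
  qed
  have "real (k y) + real (k z) \<le> real N"
  proof -
    have "\<mu> $ y + \<mu> $ z = (\<Sum>x\<in>{y, z}. \<mu> $ x)" using False by simp
    also have "\<dots> \<le> (\<Sum>x\<in>UNIV. \<mu> $ x)" by (rule sum_mono2) (auto simp: k)
    also have "\<dots> = 1" using assms(2) by (simp add: emp_measures_def)
    finally have "(real (k y) + real (k z)) / real N \<le> 1" by (simp add: k add_divide_distrib)
    then show ?thesis using assms(1) by (simp add: divide_le_eq)
  qed
  moreover have kz: "0 < k z" using assms(3) k(2)[of z] by (cases "k z") auto
  ultimately have ky: "k y + 1 \<le> N" by linarith
  \<comment> \<open>The particle counts after the move; \<open>k z\<close> is positive, so the
    subtraction of naturals is genuine.\<close>
  let ?k = "k(y := k y + 1, z := k z - 1)"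
  have "(\<mu> + unit_shift N y z) $ x = real (?k x) / real N" for x
    using assms(1) kz False by (auto simp: unit_shift_def axis_def k of_nat_diff field_simps)
  moreover have "?k x \<in> {0..N}" for x using ky k(1)[of x] k(1)[of z] by auto
  moreover have "(\<Sum>x\<in>UNIV. (\<mu> + unit_shift N y z) $ x) = 1"
  proof -
    have "(\<Sum>x\<in>UNIV. (axis w 1 :: real ^ 'a) $ x) = 1" for w by (simp add: axis_def)
    moreover have "(\<Sum>x\<in>UNIV. (\<mu> + unit_shift N y z) $ x) = (\<Sum>x\<in>UNIV. \<mu> $ x)
        + (1 / real N) * ((\<Sum>x\<in>UNIV. (axis y 1 :: real ^ 'a) $ x) - (\<Sum>x\<in>UNIV. (axis z 1 :: real ^ 'a) $ x))"
      by (simp only: unit_shift_def vector_add_component vector_scaleR_component vector_minus_component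
          real_scaleR_def sum.distrib sum_distrib_left sum_subtractf right_diff_distrib)
    ultimately show ?thesis using assms(2) by (simp add: emp_measures_def)
  qed
  ultimately show ?thesis unfolding emp_measures_def by blast
qed

lemma norm_le_snorm: "\<xi> \<in> states N \<Longrightarrow> norm (\<psi> \<xi>) \<le> snorm N \<psi>"
  unfolding snorm_def
  using member_le_sum[of \<xi> "states N" "\<lambda>\<xi>. (norm (\<psi> \<xi>))\<^sup>2"] by (intro real_le_rsqrt) simp

lemma snorm_nonneg [simp]: "0 \<le> snorm N \<psi>"
  by (simp add: snorm_def sum_nonneg)

lemma snorm_sq: "(snorm N \<psi>)\<^sup>2 = (\<Sum>\<xi>\<in>states N. (norm (\<psi> \<xi>))\<^sup>2)"
  by (simp add: snorm_def sum_nonneg)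

lemma norm_Delta_diff_le:
  fixes x :: "'d::finite"
  assumes "(x, \<mu>) \<in> states N"
  shows "norm (Delta x (\<lambda>y. \<phi> (y, \<mu>)) - Delta x (\<lambda>y. \<psi> (y, \<mu>))) \<le> 2 * real CARD('d) * (\<Sum>\<eta>\<in>states N. \<bar>\<phi> \<eta> - \<psi> \<eta>\<bar>)"
proof -
  let ?s = "\<Sum>\<eta>\<in>states N. \<bar>\<phi> \<eta> - \<psi> \<eta>\<bar>"
  have m: "\<bar>\<phi> (y, \<mu>) - \<psi> (y, \<mu>)\<bar> \<le> ?s" for y
    using assms by (intro member_le_sum[of "(y, \<mu>)" _ "\<lambda>\<eta>. \<bar>\<phi> \<eta> - \<psi> \<eta>\<bar>", simplified] finite_states) (auto simp: states_def)
  have "norm (Delta x (\<lambda>y. \<phi> (y, \<mu>)) - Delta x (\<lambda>y. \<psi> (y, \<mu>)))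
      \<le> (\<Sum>y\<in>UNIV. \<bar>(Delta x (\<lambda>y. \<phi> (y, \<mu>)) - Delta x (\<lambda>y. \<psi> (y, \<mu>))) $ y\<bar>)"
    by (rule norm_le_l1_cart)
  also have "\<dots> \<le> (\<Sum>y\<in>(UNIV::'d set). 2 * ?s)"
  proof (rule sum_mono)
    fix y show "\<bar>(Delta x (\<lambda>y. \<phi> (y, \<mu>)) - Delta x (\<lambda>y. \<psi> (y, \<mu>))) $ y\<bar> \<le> 2 * ?s"
      using m[of x] m[of y] by (auto simp: Delta_def)
  qed
  finally show ?thesis by simp
qed

section \<open>Truncated and unconstrained minimisation of the Hamiltonian\<close>

locale mfg_data =
  fixes N :: nat and T :: real
    and lam0 lam1 :: "'d::finite state \<Rightarrow> real ^ 'd"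
    and l :: "'d state \<Rightarrow> real ^ 'd \<Rightarrow> real"
    and g :: "'d state \<Rightarrow> real" and \<gamma> :: real
  assumes N_pos: "0 < N" and T_pos: "0 < T" and \<gamma>_pos: "0 < \<gamma>"
    and lam0_orthant: "\<And>\<xi>. \<xi> \<in> states N \<Longrightarrow> lam0 \<xi> \<in> orthant (fst \<xi>)"
    and lam1_orthant: "\<And>\<xi>. \<xi> \<in> states N \<Longrightarrow> lam1 \<xi> \<in> orthant (fst \<xi>)"
    and g_nonneg: "\<And>\<xi>. \<xi> \<in> states N \<Longrightarrow> 0 \<le> g \<xi>"
    and l_nonneg: "\<And>\<xi> a. \<xi> \<in> states N \<Longrightarrow> a \<in> orthant (fst \<xi>) \<Longrightarrow> 0 \<le> l \<xi> a"
    and l_cont: "\<And>\<xi>. \<xi> \<in> states N \<Longrightarrow> continuous_on (orthant (fst \<xi>)) (l \<xi>)"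
    and l_convex: "\<And>\<xi> a a' \<tau>. \<xi> \<in> states N \<Longrightarrow> a \<in> orthant (fst \<xi>) \<Longrightarrow> a' \<in> orthant (fst \<xi>) \<Longrightarrow> \<tau> \<in> {0..1} \<Longrightarrow>
      \<tau> * l \<xi> a' + (1 - \<tau>) * l \<xi> a - l \<xi> (\<tau> *\<^sub>R a' + (1 - \<tau>) *\<^sub>R a) \<ge> \<gamma> * \<tau> * (1 - \<tau>) * (norm (a' - a))\<^sup>2"
begin

abbreviation (input) "ham \<equiv> pre_hamiltonian lam0 lam1 l"

text \<open>The ball makes the control set compact, so minimisers exist, and makes the minimised
  Hamiltonian globally Lipschitz in \<open>p\<close>, as Picard iteration requires.\<close>

definition ctrl :: "real \<Rightarrow> 'd \<Rightarrow> (real ^ 'd) set" where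
  "ctrl M x = orthant x \<inter> cball 0 M"

lemma ham_continuous: "\<xi> \<in> states N \<Longrightarrow> continuous_on (orthant (fst \<xi>)) (ham \<xi> p)"
  unfolding pre_hamiltonian_def
  by (intro continuous_on_add l_cont continuous_on_sum continuous_intros)

text \<open>The rate term is affine in the control, so the convexity of \<open>l\<close> is
  inherited. At \<tau> = 1/2 the modulus \<gamma> \<tau> (1 - \<tau>) is \<gamma>/4, that is half of
  \<kappa> = \<gamma>/2.\<close>

lemma ham_midpoint_convex:
  assumes "\<xi> \<in> states N"
  shows "midpoint_convex_on (orthant (fst \<xi>)) (\<gamma> / 2) (ham \<xi> p)"
    and "midpoint_convex_on (ctrl M (fst \<xi>)) (\<gamma> / 2) (ham \<xi> p)"
proof -
  have mid: "midpoint a b = (1/2) *\<^sub>R b + (1/2) *\<^sub>R a" for a b :: "real ^ 'd"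
    by (simp add: midpoint_def scaleR_add_right add.commute)
  have conv: "ham \<xi> p (midpoint a b) \<le> (ham \<xi> p a + ham \<xi> p b) / 2 - \<gamma> / 2 / 2 * (norm (b - a))\<^sup>2"
    if "a \<in> orthant (fst \<xi>)" "b \<in> orthant (fst \<xi>)" for a b
  proof -
    have "(\<Sum>y\<in>UNIV - {fst \<xi>}. (lam0 \<xi> $ y + lam1 \<xi> $ y * midpoint a b $ y) * p $ y)
      = ((\<Sum>y\<in>UNIV - {fst \<xi>}. (lam0 \<xi> $ y + lam1 \<xi> $ y * a $ y) * p $ y)
       + (\<Sum>y\<in>UNIV - {fst \<xi>}. (lam0 \<xi> $ y + lam1 \<xi> $ y * b $ y) * p $ y)) / 2"
      by (simp add: mid sum.distrib[symmetric] sum_divide_distrib) (rule sum.cong, auto simp: field_simps)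
    moreover have "l \<xi> (midpoint a b) \<le> (l \<xi> a + l \<xi> b) / 2 - \<gamma> / 4 * (norm (b - a))\<^sup>2"
      using l_convex[OF assms that, of "1/2"] by (simp add: mid field_simps)
    ultimately show ?thesis unfolding pre_hamiltonian_def by (simp add: field_simps)
  qed
  have o: "midpoint a b \<in> orthant (fst \<xi>)" if "a \<in> orthant (fst \<xi>)" "b \<in> orthant (fst \<xi>)" for a b
    unfolding mid using that by (intro orthant_convex_comb) auto
  have c: "midpoint a b \<in> cball 0 M" if "a \<in> cball 0 M" "b \<in> cball 0 M" for a b :: "real ^ 'd"
    unfolding mid using that by (intro convexD convex_cball) auto
  show "midpoint_convex_on (orthant (fst \<xi>)) (\<gamma> / 2) (ham \<xi> p)"
    "midpoint_convex_on (ctrl M (fst \<xi>)) (\<gamma> / 2) (ham \<xi> p)"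
    unfolding midpoint_convex_on_def ctrl_def using conv o c by auto
qed

definition opt :: "real \<Rightarrow> 'd state \<Rightarrow> real ^ 'd \<Rightarrow> real ^ 'd" where
  "opt M \<xi> p = argmin_on (ctrl M (fst \<xi>)) (ham \<xi> p)"

lemma
  assumes "\<xi> \<in> states N" "0 \<le> M"
  shows opt_in_ctrl: "opt M \<xi> p \<in> ctrl M (fst \<xi>)"
    and opt_le: "\<And>b. b \<in> ctrl M (fst \<xi>) \<Longrightarrow> ham \<xi> p (opt M \<xi> p) \<le> ham \<xi> p b"
proof -
  have "0 \<in> ctrl M (fst \<xi>)" using assms by (simp add: ctrl_def)
  then have ne: "ctrl M (fst \<xi>) \<noteq> {}" by blast
  have *: "compact (ctrl M (fst \<xi>))" "continuous_on (ctrl M (fst \<xi>)) (ham \<xi> p)"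
    using assms continuous_on_subset[OF ham_continuous[OF assms(1)]]
    by (auto simp: ctrl_def intro!: closed_Int_compact closed_orthant)
  have "0 < \<gamma> / 2" using \<gamma>_pos by simp
  note argmin_on_attained[OF this ham_midpoint_convex(2)[OF assms(1)] *(1) ne *(2)]
  then show "opt M \<xi> p \<in> ctrl M (fst \<xi>)" "\<And>b. b \<in> ctrl M (fst \<xi>) \<Longrightarrow> ham \<xi> p (opt M \<xi> p) \<le> ham \<xi> p b"
    unfolding opt_def by auto
qed

text \<open>Crude but convenient: summing over all states and directions bounds each rate and each
  partial sum of rates at once.\<close>

definition lam1_sum :: real where "lam1_sum = (\<Sum>\<xi>\<in>states N. \<Sum>y\<in>UNIV. lam1 \<xi> $ y)"
definition lam0_sum :: real where "lam0_sum = (\<Sum>\<xi>\<in>states N. \<Sum>y\<in>UNIV. lam0 \<xi> $ y)"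

lemma lam_nonneg: "\<xi> \<in> states N \<Longrightarrow> 0 \<le> lam0 \<xi> $ y" "\<xi> \<in> states N \<Longrightarrow> 0 \<le> lam1 \<xi> $ y"
  using lam0_orthant lam1_orthant by (auto simp: orthant_def)

lemma lam_sum_nonneg: "0 \<le> lam0_sum" "0 \<le> lam1_sum"
  unfolding lam0_sum_def lam1_sum_def by (auto intro!: sum_nonneg lam_nonneg)

lemma lam_sum_le:
  assumes "\<xi> \<in> states N"
  shows "(\<Sum>y\<in>UNIV - {fst \<xi>}. lam0 \<xi> $ y) \<le> lam0_sum" "(\<Sum>y\<in>UNIV - {fst \<xi>}. lam1 \<xi> $ y) \<le> lam1_sum"
proof -
  have "(\<Sum>y\<in>UNIV - {fst \<xi>}. f \<xi> $ y) \<le> (\<Sum>\<xi>\<in>states N. \<Sum>y\<in>UNIV. f \<xi> $ y)"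
    if nn: "\<And>\<xi> y. \<xi> \<in> states N \<Longrightarrow> 0 \<le> f \<xi> $ y" for f :: "'d state \<Rightarrow> real ^ 'd"
  proof -
    have "(\<Sum>y\<in>UNIV - {fst \<xi>}. f \<xi> $ y) \<le> (\<Sum>y\<in>UNIV. f \<xi> $ y)"
      using nn assms by (intro sum_mono2) auto
    also have "\<dots> \<le> (\<Sum>\<xi>\<in>states N. \<Sum>y\<in>UNIV. f \<xi> $ y)"
      using nn assms by (intro member_le_sum[of _ _ "\<lambda>\<xi>. \<Sum>y\<in>UNIV. f \<xi> $ y"]) (auto intro!: sum_nonneg)
    finally show ?thesis .
  qed
  from this[OF lam_nonneg(1)] this[OF lam_nonneg(2)]
  show "(\<Sum>y\<in>UNIV - {fst \<xi>}. lam0 \<xi> $ y) \<le> lam0_sum" "(\<Sum>y\<in>UNIV - {fst \<xi>}. lam1 \<xi> $ y) \<le> lam1_sum"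
    unfolding lam0_sum_def lam1_sum_def by auto
qed

lemma weighted_sum_bound:
  fixes w :: "'d \<Rightarrow> real" and a p :: "real ^ 'd"
  assumes "\<And>y. 0 \<le> w y"
  shows "\<bar>\<Sum>y\<in>A. w y * a $ y * p $ y\<bar> \<le> (\<Sum>y\<in>A. w y) * norm a * norm p"
proof -
  have "\<bar>w y * a $ y * p $ y\<bar> \<le> w y * norm a * norm p" for y
    using assms component_le_norm_cart[of a y] component_le_norm_cart[of p y]
    by (auto simp: abs_mult intro!: mult_mono)
  then have "\<bar>\<Sum>y\<in>A. w y * a $ y * p $ y\<bar> \<le> (\<Sum>y\<in>A. w y * norm a * norm p)"
    by (intro order_trans[OF sum_abs] sum_mono)
  then show ?thesis by (simp add: sum_distrib_right)
qed

text \<open>In the mixed second difference both \<open>l\<close> and the rates \<open>lam0\<close>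
  cancel, leaving a form bilinear in the increments of control and momentum. In the second bound
  only \<open>l\<close> cancels.\<close>

lemma ham_diff_bound:
  assumes "\<xi> \<in> states N"
  shows "\<bar>ham \<xi> p b - ham \<xi> p a - (ham \<xi> p' b - ham \<xi> p' a)\<bar> \<le> lam1_sum * norm (b - a) * norm (p - p')"
    and "\<bar>ham \<xi> p a - ham \<xi> p' a\<bar> \<le> (lam0_sum + lam1_sum * norm a) * norm (p - p')"
proof -
  let ?A = "UNIV - {fst \<xi>}"
  have "ham \<xi> p b - ham \<xi> p a - (ham \<xi> p' b - ham \<xi> p' a)
      = (\<Sum>y\<in>?A. (lam0 \<xi> $ y + lam1 \<xi> $ y * b $ y) * p $ y) - (\<Sum>y\<in>?A. (lam0 \<xi> $ y + lam1 \<xi> $ y * a $ y) * p $ y)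
       - ((\<Sum>y\<in>?A. (lam0 \<xi> $ y + lam1 \<xi> $ y * b $ y) * p' $ y) - (\<Sum>y\<in>?A. (lam0 \<xi> $ y + lam1 \<xi> $ y * a $ y) * p' $ y))"
    unfolding pre_hamiltonian_def by simp
  also have "\<dots> = (\<Sum>y\<in>?A. lam1 \<xi> $ y * (b - a) $ y * (p - p') $ y)"
    unfolding sum_subtractf[symmetric] by (rule sum.cong) (auto simp: algebra_simps)
  finally have "\<bar>ham \<xi> p b - ham \<xi> p a - (ham \<xi> p' b - ham \<xi> p' a)\<bar>
      \<le> (\<Sum>y\<in>?A. lam1 \<xi> $ y) * norm (b - a) * norm (p - p')"
    using weighted_sum_bound[where w="\<lambda>y. lam1 \<xi> $ y" and a="b - a" and p="p - p'" and A="?A"] lam_nonneg[OF assms] by simp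
  also have "\<dots> \<le> lam1_sum * norm (b - a) * norm (p - p')"
    using lam_sum_le[OF assms] by (intro mult_right_mono) auto
  finally show "\<bar>ham \<xi> p b - ham \<xi> p a - (ham \<xi> p' b - ham \<xi> p' a)\<bar> \<le> lam1_sum * norm (b - a) * norm (p - p')" .
  have "ham \<xi> p a - ham \<xi> p' a = (\<Sum>y\<in>?A. (lam0 \<xi> $ y + lam1 \<xi> $ y * a $ y) * (p - p') $ y)"
    unfolding pre_hamiltonian_def
    by (simp add: sum_subtractf[symmetric] algebra_simps)
  also have "\<bar>\<dots>\<bar> \<le> (\<Sum>y\<in>?A. (lam0 \<xi> $ y + lam1 \<xi> $ y * norm a) * norm (p - p'))"
  proof (intro order_trans[OF sum_abs] sum_mono)
    fix y
    have "\<bar>lam0 \<xi> $ y + lam1 \<xi> $ y * a $ y\<bar> \<le> lam0 \<xi> $ y + lam1 \<xi> $ y * norm a"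
      using lam_nonneg[OF assms] component_le_norm_cart[of a y]
      by (intro order_trans[OF abs_triangle_ineq] add_mono) (auto simp: abs_mult intro!: mult_left_mono)
    then show "\<bar>(lam0 \<xi> $ y + lam1 \<xi> $ y * a $ y) * (p - p') $ y\<bar> \<le> (lam0 \<xi> $ y + lam1 \<xi> $ y * norm a) * norm (p - p')"
      unfolding abs_mult by (intro mult_mono component_le_norm_cart) auto
  qed
  also have "\<dots> = ((\<Sum>y\<in>?A. lam0 \<xi> $ y) + (\<Sum>y\<in>?A. lam1 \<xi> $ y) * norm a) * norm (p - p')"
    by (simp add: sum_distrib_right[symmetric] sum.distrib)
  also have "\<dots> \<le> (lam0_sum + lam1_sum * norm a) * norm (p - p')"
    using lam_sum_le[OF assms] by (intro mult_right_mono add_mono) auto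
  finally show "\<bar>ham \<xi> p a - ham \<xi> p' a\<bar> \<le> (lam0_sum + lam1_sum * norm a) * norm (p - p')" .
qed

text \<open>Adding the quadratic growth at \<open>p\<close> and at \<open>p'\<close> turns the
  difference of values into the mixed second difference; dividing by the distance of the minimisers
  gives the claim. The two halves of \<gamma> add up, hence the constant. The set \<open>C\<close>
  is left open to serve both the truncated and the full orthant.\<close>

lemma minimiser_lipschitz:
  assumes "\<xi> \<in> states N" "midpoint_convex_on C (\<gamma> / 2) (ham \<xi> p)" "midpoint_convex_on C (\<gamma> / 2) (ham \<xi> p')"
    and "a \<in> C" "b \<in> C" "\<And>c. c \<in> C \<Longrightarrow> ham \<xi> p a \<le> ham \<xi> p c" "\<And>c. c \<in> C \<Longrightarrow> ham \<xi> p' b \<le> ham \<xi> p' c"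
  shows "norm (a - b) \<le> lam1_sum / \<gamma> * norm (p - p')"
proof (cases "a = b")
  case True
  then show ?thesis using lam_sum_nonneg \<gamma>_pos by simp
next
  case False
  have "ham \<xi> p a + \<gamma> / 2 * (norm (b - a))\<^sup>2 \<le> ham \<xi> p b"
    by (rule minimiser_gap[OF assms(2,4,5,6)])
  moreover have "ham \<xi> p' b + \<gamma> / 2 * (norm (a - b))\<^sup>2 \<le> ham \<xi> p' a"
    by (rule minimiser_gap[OF assms(3,5,4,7)])
  moreover have "ham \<xi> p b - ham \<xi> p a - (ham \<xi> p' b - ham \<xi> p' a) \<le> lam1_sum * norm (b - a) * norm (p - p')"
    using ham_diff_bound(1)[OF assms(1), of p b a p'] by linarith
  ultimately have "\<gamma> * (norm (a - b))\<^sup>2 \<le> lam1_sum * norm (a - b) * norm (p - p')"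
    by (simp add: norm_minus_commute)
  then have "norm (a - b) * (\<gamma> * norm (a - b)) \<le> norm (a - b) * (lam1_sum * norm (p - p'))"
    by (simp add: power2_eq_square algebra_simps)
  then have "\<gamma> * norm (a - b) \<le> lam1_sum * norm (p - p')"
    using False by (simp only: mult_le_cancel_left_pos zero_less_norm_iff right_minus_eq not_False_eq_True)
  then show ?thesis using \<gamma>_pos by (simp add: field_simps)
qed

lemma opt_lipschitz:
  assumes "\<xi> \<in> states N" "0 \<le> M"
  shows "norm (opt M \<xi> p - opt M \<xi> p') \<le> lam1_sum / \<gamma> * norm (p - p')"
proof (rule minimiser_lipschitz[where C="ctrl M (fst \<xi>)"])
  show "midpoint_convex_on (ctrl M (fst \<xi>)) (\<gamma> / 2) (ham \<xi> p)" "midpoint_convex_on (ctrl M (fst \<xi>)) (\<gamma> / 2) (ham \<xi> p')"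
    by (rule ham_midpoint_convex(2)[OF assms(1)])+
  show "ham \<xi> p (opt M \<xi> p) \<le> ham \<xi> p c" if "c \<in> ctrl M (fst \<xi>)" for c
    by (rule opt_le[OF assms that])
  show "ham \<xi> p' (opt M \<xi> p') \<le> ham \<xi> p' c" if "c \<in> ctrl M (fst \<xi>)" for c
    by (rule opt_le[OF assms that])
qed (use assms opt_in_ctrl in auto)

definition l0_sum :: real where "l0_sum = (\<Sum>\<xi>\<in>states N. l \<xi> 0)"

lemma l0_le: "\<xi> \<in> states N \<Longrightarrow> l \<xi> 0 \<le> l0_sum"
  unfolding l0_sum_def by (rule member_le_sum) (auto intro: l_nonneg)

lemma l0_sum_nonneg: "0 \<le> l0_sum"
  unfolding l0_sum_def by (intro sum_nonneg l_nonneg) auto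

definition opt_bound :: "real \<Rightarrow> real" where
  "opt_bound p = 1 + 2 * (l0_sum + lam1_sum * p) / \<gamma>"

text \<open>Comparison with the zero control gives a quadratic inequality for the norm of the
  minimiser, because \<open>l\<close> is nonnegative. The bound does not involve \<open>M\<close>,
  which is what allows a level to be chosen beyond it. The summand 1 in \<open>opt_bound\<close>
  covers norms up to 1; above 1 the constant term may be multiplied by the norm and the norm divided
  out.\<close>

lemma opt_bounded:
  assumes "\<xi> \<in> states N" "0 \<le> M"
  shows "norm (opt M \<xi> p) \<le> opt_bound (norm p)"
proof (cases "norm (opt M \<xi> p) \<le> 1")
  case True
  then show ?thesis using \<gamma>_pos l0_sum_nonneg lam_sum_nonneg unfolding opt_bound_def
    by (intro order_trans[OF True]) auto
next
  case False
  let ?a = "opt M \<xi> p"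
  have "0 \<in> ctrl M (fst \<xi>)" using assms by (simp add: ctrl_def)
  then have "ham \<xi> p ?a + \<gamma> / 2 * (norm (0 - ?a))\<^sup>2 \<le> ham \<xi> p 0"
    using opt_in_ctrl[OF assms] opt_le[OF assms] by (intro minimiser_gap[OF ham_midpoint_convex(2)[OF assms(1)]]) auto
  moreover have "\<bar>ham \<xi> p ?a - ham \<xi> p 0 - (ham \<xi> 0 ?a - ham \<xi> 0 0)\<bar> \<le> lam1_sum * norm ?a * norm p"
    using ham_diff_bound(1)[OF assms(1), of p ?a 0 0] by simp
  moreover have "ham \<xi> 0 ?a = l \<xi> ?a" "ham \<xi> 0 0 = l \<xi> 0" by (simp_all add: pre_hamiltonian_def)
  moreover have "0 \<le> l \<xi> ?a" "l \<xi> 0 \<le> l0_sum"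
    using opt_in_ctrl[OF assms] l_nonneg[OF assms(1)] l0_le[OF assms(1)] by (auto simp: ctrl_def)
  ultimately have "\<gamma> / 2 * (norm ?a)\<^sup>2 \<le> l0_sum + lam1_sum * norm p * norm ?a"
    by (simp add: abs_le_iff algebra_simps)
  also have "\<dots> \<le> (l0_sum + lam1_sum * norm p) * norm ?a"
    using False l0_sum_nonneg mult_left_mono[of 1 "norm ?a" l0_sum] by (simp add: algebra_simps)
  finally have "norm ?a * (\<gamma> / 2 * norm ?a) \<le> norm ?a * (l0_sum + lam1_sum * norm p)"
    by (simp add: power2_eq_square algebra_simps)
  then have "\<gamma> / 2 * norm ?a \<le> l0_sum + lam1_sum * norm p"
    by (rule mult_left_le_imp_le) (use False in linarith)
  then show ?thesis using \<gamma>_pos unfolding opt_bound_def by (simp add: field_simps)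
qed

text \<open>A constrained minimiser in the interior of the ball is a global one, by convexity along segments.\<close>
lemma opt_global:
  assumes "\<xi> \<in> states N" "opt_bound (norm p) < M" "0 \<le> M" "b \<in> orthant (fst \<xi>)"
  shows "ham \<xi> p (opt M \<xi> p) \<le> ham \<xi> p b"
proof -
  let ?a = "opt M \<xi> p"
  have a: "?a \<in> orthant (fst \<xi>)" "norm ?a < M"
    using opt_in_ctrl[OF assms(1,3)] opt_bounded[OF assms(1,3), of p] assms(2) by (auto simp: ctrl_def)
  \<comment> \<open>Small enough for the point at fraction \<open>s\<close> of the segment towards
    \<open>b\<close> to stay in the ball; the 1 in the denominator allows
    \<open>b = ?a\<close>.\<close>
  define s where "s = min 1 ((M - norm ?a) / (1 + norm (b - ?a)))"
  have s: "0 < s" "s \<le> 1" "s * norm (b - ?a) \<le> M - norm ?a"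
  proof -
    show "0 < s" "s \<le> 1" using a by (auto simp: s_def add_pos_nonneg)
    have "s * norm (b - ?a) \<le> (M - norm ?a) / (1 + norm (b - ?a)) * norm (b - ?a)"
      unfolding s_def by (intro mult_right_mono) auto
    also have "\<dots> = (M - norm ?a) * (norm (b - ?a) / (1 + norm (b - ?a)))" by simp
    also have "\<dots> \<le> (M - norm ?a) * 1"
      using a by (intro mult_left_mono) (auto simp: divide_le_eq add_pos_nonneg)
    finally show "s * norm (b - ?a) \<le> M - norm ?a" by simp
  qed
  let ?c = "s *\<^sub>R b + (1 - s) *\<^sub>R ?a"
  have "?c = ?a + s *\<^sub>R (b - ?a)" by (simp add: algebra_simps)
  then have "norm ?c \<le> norm ?a + s * norm (b - ?a)"
    using norm_triangle_ineq[of ?a "s *\<^sub>R (b - ?a)"] s(1) by simp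
  then have "?c \<in> ctrl M (fst \<xi>)"
    using s a assms(4) by (auto simp: ctrl_def intro!: orthant_convex_comb)
  then have "ham \<xi> p ?a \<le> ham \<xi> p ?c" by (rule opt_le[OF assms(1,3)])
  also have "\<dots> \<le> s * ham \<xi> p b + (1 - s) * ham \<xi> p ?a"
  proof -
    have "(\<Sum>y\<in>UNIV - {fst \<xi>}. (lam0 \<xi> $ y + lam1 \<xi> $ y * ?c $ y) * p $ y)
      = s * (\<Sum>y\<in>UNIV - {fst \<xi>}. (lam0 \<xi> $ y + lam1 \<xi> $ y * b $ y) * p $ y)
       + (1 - s) * (\<Sum>y\<in>UNIV - {fst \<xi>}. (lam0 \<xi> $ y + lam1 \<xi> $ y * ?a $ y) * p $ y)"
      unfolding sum_distrib_left sum.distrib[symmetric] by (rule sum.cong) (auto simp: algebra_simps)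
    moreover have "l \<xi> ?c \<le> s * l \<xi> b + (1 - s) * l \<xi> ?a"
    proof -
      have "0 \<le> \<gamma> * s * (1 - s) * (norm (b - ?a))\<^sup>2" using s \<gamma>_pos by simp
      then show ?thesis using l_convex[OF assms(1) a(1) assms(4), of s] s by simp
    qed
    ultimately show ?thesis unfolding pre_hamiltonian_def by (simp add: algebra_simps)
  qed
  finally have "s * ham \<xi> p ?a \<le> s * ham \<xi> p b" by (simp add: algebra_simps)
  then show ?thesis using s(1) by simp
qed

text \<open>The description operator in \<open>hat_alpha\<close> denotes something only if a unique
  minimiser exists on the unbounded orthant. Any truncation level beyond \<open>opt_bound\<close>
  supplies one, and strong convexity shows that all these levels give the same point.\<close>

lemma
  assumes "\<xi> \<in> states N"
  shows hat_alpha_orthant: "hat_alpha lam0 lam1 l \<xi> p \<in> orthant (fst \<xi>)"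
    and hat_alpha_le: "\<And>b. b \<in> orthant (fst \<xi>) \<Longrightarrow> ham \<xi> p (hat_alpha lam0 lam1 l \<xi> p) \<le> ham \<xi> p b"
    and hat_alpha_eq_opt: "\<And>M. opt_bound (norm p) < M \<Longrightarrow> 0 \<le> M \<Longrightarrow> hat_alpha lam0 lam1 l \<xi> p = opt M \<xi> p"
proof -
  let ?O = "orthant (fst \<xi>)"
  have *: "hat_alpha lam0 lam1 l \<xi> p = opt M \<xi> p \<and> opt M \<xi> p \<in> ?O \<and> (\<forall>b\<in>?O. ham \<xi> p (opt M \<xi> p) \<le> ham \<xi> p b)"
    if M: "opt_bound (norm p) < M" "0 \<le> M" for M
  proof -
    have a: "opt M \<xi> p \<in> ?O" using opt_in_ctrl[OF assms M(2)] by (simp add: ctrl_def)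
    have ham_opt: "hamiltonian lam0 lam1 l \<xi> p = ham \<xi> p (opt M \<xi> p)"
      unfolding hamiltonian_def
      by (rule cInf_eq_minimum) (use a opt_global[OF assms M] in auto)
    have g2: "0 < \<gamma> / 2" using \<gamma>_pos by simp
    have "c = opt M \<xi> p" if "c \<in> ?O" "ham \<xi> p c = ham \<xi> p (opt M \<xi> p)" for c
    proof -
      have "argmin_on ?O (ham \<xi> p) = c"
        by (rule argmin_on[OF g2 ham_midpoint_convex(1)[OF assms] that(1)]) (simp add: that(2) opt_global[OF assms M])
      moreover have "argmin_on ?O (ham \<xi> p) = opt M \<xi> p"
        by (rule argmin_on[OF g2 ham_midpoint_convex(1)[OF assms] a opt_global[OF assms M]])
      ultimately show ?thesis by simp
    qed
    then have "hat_alpha lam0 lam1 l \<xi> p = opt M \<xi> p"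
      unfolding hat_alpha_def ham_opt using a by (intro the_equality) auto
    then show ?thesis using a opt_global[OF assms M] by auto
  qed
  show "\<And>M. opt_bound (norm p) < M \<Longrightarrow> 0 \<le> M \<Longrightarrow> hat_alpha lam0 lam1 l \<xi> p = opt M \<xi> p" using * by blast
  show "hat_alpha lam0 lam1 l \<xi> p \<in> ?O" "\<And>b. b \<in> ?O \<Longrightarrow> ham \<xi> p (hat_alpha lam0 lam1 l \<xi> p) \<le> ham \<xi> p b"
    using *[of "max 0 (opt_bound (norm p)) + 1"] by auto
qed

lemma hat_alpha_lipschitz:
  assumes "\<xi> \<in> states N"
  shows "norm (hat_alpha lam0 lam1 l \<xi> p - hat_alpha lam0 lam1 l \<xi> p') \<le> lam1_sum / \<gamma> * norm (p - p')"
proof (rule minimiser_lipschitz[where C="orthant (fst \<xi>)"])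
  show "midpoint_convex_on (orthant (fst \<xi>)) (\<gamma> / 2) (ham \<xi> p)" "midpoint_convex_on (orthant (fst \<xi>)) (\<gamma> / 2) (ham \<xi> p')"
    by (rule ham_midpoint_convex(1)[OF assms(1)])+
  show "ham \<xi> p (hat_alpha lam0 lam1 l \<xi> p) \<le> ham \<xi> p c" if "c \<in> orthant (fst \<xi>)" for c
    by (rule hat_alpha_le[OF assms that])
  show "ham \<xi> p' (hat_alpha lam0 lam1 l \<xi> p') \<le> ham \<xi> p' c" if "c \<in> orthant (fst \<xi>)" for c
    by (rule hat_alpha_le[OF assms that])
qed (use assms hat_alpha_orthant in auto)

text \<open>\<open>lam1_sum / \<gamma>\<close> is the Lipschitz constant of the minimiser in
  \<open>p\<close>. The factor 2 d card comes from bounding \<open>Delta\<close> by the sum over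
  states and that sum by the Euclidean norm, the root of the cardinality from summing squares over
  the states. The added 1 only makes the constant positive.\<close>

definition best_response_const :: real where
  "best_response_const = sqrt (card (states N :: 'd state set)) * (lam1_sum / \<gamma> * (2 * real CARD('d) * card (states N :: 'd state set))) + 1"

lemma best_response_lipschitz:
  fixes v v' :: "'d state \<Rightarrow> real"
  shows "snorm N (\<lambda>(x,\<mu>). hat_alpha lam0 lam1 l (x,\<mu>) (Delta x (\<lambda>y. v (y,\<mu>)))
      - hat_alpha lam0 lam1 l (x,\<mu>) (Delta x (\<lambda>y. v' (y,\<mu>)))) \<le> best_response_const * snorm N (\<lambda>\<xi>. v \<xi> - v' \<xi>)"
    (is "snorm N ?\<psi> \<le> _ * ?n")
proof -
  let ?c = "lam1_sum / \<gamma> * (2 * real CARD('d) * card (states N :: 'd state set))"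
  have c0: "0 \<le> ?c" using lam_sum_nonneg \<gamma>_pos by simp
  have "(\<Sum>\<eta>\<in>states N. \<bar>v \<eta> - v' \<eta>\<bar>) \<le> (\<Sum>\<eta>\<in>(states N::'d state set). ?n)"
    using norm_le_snorm[of _ N "\<lambda>\<xi>. v \<xi> - v' \<xi>"] by (intro sum_mono) auto
  then have s: "(\<Sum>\<eta>\<in>states N. \<bar>v \<eta> - v' \<eta>\<bar>) \<le> card (states N :: 'd state set) * ?n" by simp
  have "norm (?\<psi> \<xi>) \<le> ?c * ?n" if "\<xi> \<in> states N" for \<xi>
  proof -
    obtain x \<mu> where [simp]: "\<xi> = (x, \<mu>)" by (cases \<xi>)
    have "norm (?\<psi> \<xi>) \<le> lam1_sum / \<gamma> * norm (Delta x (\<lambda>y. v (y, \<mu>)) - Delta x (\<lambda>y. v' (y, \<mu>)))"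
      using hat_alpha_lipschitz that by simp
    also have "\<dots> \<le> lam1_sum / \<gamma> * (2 * real CARD('d) * (card (states N :: 'd state set) * ?n))"
      using that lam_sum_nonneg \<gamma>_pos
      by (intro mult_left_mono order_trans[OF norm_Delta_diff_le[of x \<mu> N]] s) auto
    finally show ?thesis by (simp add: algebra_simps)
  qed
  then have "(\<Sum>\<xi>\<in>states N. (norm (?\<psi> \<xi>))\<^sup>2) \<le> (\<Sum>\<xi>\<in>(states N::'d state set). (?c * ?n)\<^sup>2)"
    by (intro sum_mono power_mono) auto
  then have "snorm N ?\<psi> \<le> sqrt (card (states N :: 'd state set) * (?c * ?n)\<^sup>2)"
    unfolding snorm_def by (intro real_sqrt_le_mono) simp
  also have "\<dots> = sqrt (card (states N :: 'd state set)) * ?c * ?n"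
    using c0 lam_sum_nonneg \<gamma>_pos by (simp add: real_sqrt_mult abs_mult)
  also have "\<dots> \<le> best_response_const * ?n"
    unfolding best_response_const_def by (intro mult_right_mono) auto
  finally show ?thesis .
qed

lemma best_response_const_pos: "0 < best_response_const"
  unfolding best_response_const_def using lam_sum_nonneg \<gamma>_pos by (intro add_nonneg_pos) auto

end

section \<open>Picard iteration\<close>

text \<open>Picard iteration: the increments contract by 1/2 in the norm weighted by \<open>exp (2 m K s)\<close>, \<open>m = card S + 1\<close>.\<close>
lemma picard_forward:
  fixes F :: "real \<Rightarrow> ('s \<Rightarrow> real) \<Rightarrow> 's \<Rightarrow> real"
  assumes "finite S" "0 \<le> T" "0 < K"
    and lip: "\<And>s \<phi> \<psi> \<xi>. s \<in> {0..T} \<Longrightarrow> \<xi> \<in> S \<Longrightarrow> \<bar>F s \<phi> \<xi> - F s \<psi> \<xi>\<bar> \<le> K * (\<Sum>\<eta>\<in>S. \<bar>\<phi> \<eta> - \<psi> \<eta>\<bar>)"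
    and cont: "\<And>u \<xi>. (\<And>\<eta>. \<eta> \<in> S \<Longrightarrow> continuous_on {0..T} (\<lambda>s. u s \<eta>)) \<Longrightarrow> \<xi> \<in> S \<Longrightarrow>
        continuous_on {0..T} (\<lambda>s. F s (u s) \<xi>)"
  obtains u where "\<And>\<xi>. \<xi> \<in> S \<Longrightarrow> u 0 \<xi> = g \<xi>"
    and "\<And>\<xi> s. \<xi> \<in> S \<Longrightarrow> s \<in> {0..T} \<Longrightarrow> ((\<lambda>s. u s \<xi>) has_field_derivative F s (u s) \<xi>) (at s within {0..T})"
proof -
  define V where "V = rec_nat (\<lambda>s \<xi>. g \<xi>) (\<lambda>_ w s \<xi>. g \<xi> + integral {0..s} (\<lambda>r. F r (w r) \<xi>))"
  have V0: "V 0 = (\<lambda>s \<xi>. g \<xi>)" and VS: "V (Suc k) = (\<lambda>s \<xi>. g \<xi> + integral {0..s} (\<lambda>r. F r (V k r) \<xi>))" for k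
    by (simp_all add: V_def)
  have Vc: "continuous_on {0..T} (\<lambda>s. V k s \<xi>)" if "\<xi> \<in> S" for k \<xi>
    using that
  proof (induction k arbitrary: \<xi>)
    case (Suc k)
    then have "(\<lambda>r. F r (V k r) \<xi>) integrable_on {0..T}"
      by (intro integrable_continuous_real cont)
    then show ?case
      unfolding VS by (intro continuous_on_add continuous_on_const indefinite_integral_continuous_1)
  qed (simp add: V0)
  have Fc: "continuous_on {0..T} (\<lambda>r. F r (V k r) \<xi>)" if "\<xi> \<in> S" for k \<xi>
    by (intro cont Vc that)
  \<comment> \<open>The extra 1 keeps \<open>m\<close> positive for empty \<open>S\<close> and makes
    \<open>card S / m\<close> strictly less than 1, which the passage to the limit below relies
    on.\<close>
  define m where "m = real (card S) + 1"
  define \<Lambda> where "\<Lambda> = 2 * m * K"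
  have m: "0 < m" and \<Lambda>: "0 < \<Lambda>" using assms(3) by (auto simp: m_def \<Lambda>_def add_nonneg_pos)
  have "bounded (\<Union>\<xi>\<in>S. (\<lambda>s. V 1 s \<xi> - V 0 s \<xi>) ` {0..T})"
    using assms(1) by (intro bounded_UN ballI compact_imp_bounded compact_continuous_image continuous_on_diff Vc) auto
  then obtain C where C: "0 < C" "\<And>\<xi> s. \<xi> \<in> S \<Longrightarrow> s \<in> {0..T} \<Longrightarrow> \<bar>V 1 s \<xi> - V 0 s \<xi>\<bar> \<le> C"
    unfolding bounded_pos by force
  have incr: "\<bar>V (Suc k) s \<xi> - V k s \<xi>\<bar> \<le> C * (1/2) ^ k * exp (\<Lambda> * s)" if "\<xi> \<in> S" "s \<in> {0..T}" for k \<xi> s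
    using that
  proof (induction k arbitrary: s \<xi>)
    case 0
    have "1 \<le> exp (\<Lambda> * s)" using 0 \<Lambda> by simp
    then have "C * 1 \<le> C * exp (\<Lambda> * s)" using C(1) by (intro mult_left_mono) auto
    then show ?case using C(2)[OF 0] by simp
  next
    case (Suc k)
    have sub: "{0..s} \<subseteq> {0..T}" using Suc.prems by auto
    have ci: "(\<lambda>r. F r (V k r) \<xi>) integrable_on {0..s}" for k
      by (intro integrable_continuous_real continuous_on_subset[OF Fc[OF Suc.prems(1)] sub])
    have E: "((\<lambda>r. exp (\<Lambda> * r)) has_integral exp (\<Lambda> * s) / \<Lambda> - exp (\<Lambda> * 0) / \<Lambda>) {0..s}"
      using Suc.prems \<Lambda>
      by (intro fundamental_theorem_of_calculus)
        (auto intro!: derivative_eq_intros simp: has_real_derivative_iff_has_vector_derivative[symmetric])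
    have bd: "\<bar>F r (V (Suc k) r) \<xi> - F r (V k r) \<xi>\<bar> \<le> m * K * C * (1/2) ^ k * exp (\<Lambda> * r)" if r: "r \<in> {0..s}" for r
    proof -
      have "\<bar>F r (V (Suc k) r) \<xi> - F r (V k r) \<xi>\<bar> \<le> K * (\<Sum>\<eta>\<in>S. \<bar>V (Suc k) r \<eta> - V k r \<eta>\<bar>)"
        using r sub Suc.prems by (intro lip) auto
      also have "\<dots> \<le> K * (\<Sum>\<eta>\<in>S. C * (1/2) ^ k * exp (\<Lambda> * r))"
        using r sub assms(3) by (intro mult_left_mono sum_mono Suc.IH) auto
      also have "\<dots> \<le> K * (m * (C * (1/2) ^ k * exp (\<Lambda> * r)))"
        using assms(3) C(1) by (intro mult_left_mono) (auto simp: m_def)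
      finally show ?thesis by (simp add: algebra_simps)
    qed
    have int2: "(\<lambda>r. m * K * C * (1/2) ^ k * exp (\<Lambda> * r)) integrable_on {0..s}"
      by (intro integrable_continuous_real continuous_intros)
    have "\<bar>integral {0..s} (\<lambda>r. F r (V (Suc k) r) \<xi> - F r (V k r) \<xi>)\<bar>
        \<le> integral {0..s} (\<lambda>r. m * K * C * (1/2) ^ k * exp (\<Lambda> * r))"
      by (rule integral_norm_bound_integral[OF integrable_diff[OF ci ci] int2, unfolded real_norm_def]) (rule bd)
    also have "\<dots> = m * K * C * (1/2) ^ k * (exp (\<Lambda> * s) / \<Lambda> - exp (\<Lambda> * 0) / \<Lambda>)"
      using integral_unique[OF E] by simp
    also have "\<dots> \<le> m * K * C * (1/2) ^ k * (exp (\<Lambda> * s) / \<Lambda>)"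
      using m assms(3) C(1) \<Lambda> by (intro mult_left_mono) auto
    \<comment> \<open>Integrating the weight divides by \<Lambda>, and
      \<open>m * K / \<Lambda> = 1/2\<close> by the choice of \<Lambda>.\<close>
    also have "\<dots> = C * (1/2) ^ Suc k * exp (\<Lambda> * s)"
      using m assms(3) by (simp add: \<Lambda>_def field_simps)
    finally have "\<bar>integral {0..s} (\<lambda>r. F r (V (Suc k) r) \<xi>) - integral {0..s} (\<lambda>r. F r (V k r) \<xi>)\<bar> \<le> \<dots>"
      by (simp only: integral_diff[OF ci ci])
    moreover have "V (Suc j) s \<xi> = g \<xi> + integral {0..s} (\<lambda>r. F r (V j r) \<xi>)" for j by (subst VS) (rule refl)
    ultimately show ?case by simp
  qed
  have "\<exists>f. uniform_limit {0..T} (\<lambda>n s. V n s \<xi>) f sequentially" if "\<xi> \<in> S" for \<xi>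
  proof -
    have "uniformly_convergent_on {0..T} (\<lambda>n s. \<Sum>k<n. V (Suc k) s \<xi> - V k s \<xi>)"
    proof (rule Weierstrass_m_test')
      show "norm (V (Suc k) s \<xi> - V k s \<xi>) \<le> C * exp (\<Lambda> * T) * (1/2) ^ k" if "s \<in> {0..T}" for k s
      proof -
        have "exp (\<Lambda> * s) \<le> exp (\<Lambda> * T)" using that \<Lambda> by simp
        then have "C * (1/2) ^ k * exp (\<Lambda> * s) \<le> C * (1/2) ^ k * exp (\<Lambda> * T)"
          using C(1) by (intro mult_left_mono) auto
        then show ?thesis using incr[OF \<open>\<xi> \<in> S\<close> that, of k] by (simp add: algebra_simps)
      qed
      show "summable (\<lambda>k. C * exp (\<Lambda> * T) * (1/2) ^ k)"
        by (intro summable_mult summable_geometric) simp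
    qed
    then obtain f where "uniform_limit {0..T} (\<lambda>n s. \<Sum>k<n. V (Suc k) s \<xi> - V k s \<xi>) f sequentially"
      by (auto simp: uniformly_convergent_on_def)
    moreover have "uniform_limit {0..T} (\<lambda>n s. V 0 s \<xi>) (\<lambda>s. V 0 s \<xi>) sequentially"
      by (rule uniform_limit_const)
    ultimately have "uniform_limit {0..T} (\<lambda>n s. (\<Sum>k<n. V (Suc k) s \<xi> - V k s \<xi>) + V 0 s \<xi>) (\<lambda>s. f s + V 0 s \<xi>) sequentially"
      by (rule uniform_limit_add)
    then have "uniform_limit {0..T} (\<lambda>n s. V n s \<xi>) (\<lambda>s. f s + V 0 s \<xi>) sequentially"
      by (simp add: sum_lessThan_telescope[of "\<lambda>k. V k _ \<xi>"])
    then show ?thesis by blast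
  qed
  then obtain u' where u': "\<And>\<xi>. \<xi> \<in> S \<Longrightarrow> uniform_limit {0..T} (\<lambda>n s. V n s \<xi>) (u' \<xi>) sequentially"
    by metis
  define u where "u s \<xi> = u' \<xi> s" for s \<xi>
  have ul: "uniform_limit {0..T} (\<lambda>n s. V n s \<xi>) (\<lambda>s. u s \<xi>) sequentially" if "\<xi> \<in> S" for \<xi>
    using u'[OF that] by (simp add: u_def)
  have uc: "continuous_on {0..T} (\<lambda>s. u s \<xi>)" if "\<xi> \<in> S" for \<xi>
    by (rule uniform_limit_theorem[OF _ ul[OF that]]) (use Vc[OF that] in auto)
  have Fuc: "continuous_on {0..T} (\<lambda>s. F s (u s) \<xi>)" if "\<xi> \<in> S" for \<xi>
    by (rule cont[OF uc that])
  \<comment> \<open>Uniform convergence in each of the finitely many coordinates passes through the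
    Lipschitz map \<open>F\<close> and then through the integral, so the limit solves the integral
    equation.\<close>
  have fix_eq: "u s \<xi> = g \<xi> + integral {0..s} (\<lambda>r. F r (u r) \<xi>)" if "\<xi> \<in> S" "s \<in> {0..T}" for \<xi> s
  proof -
    have sub: "{0..s} \<subseteq> {0..T}" using that by auto
    have "uniform_limit {0..s} (\<lambda>n r. F r (V n r) \<xi>) (\<lambda>r. F r (u r) \<xi>) sequentially"
    proof (rule uniform_limitI)
      fix e :: real assume "0 < e"
      then have e: "0 < e / (K * m)" using assms(3) m by simp
      have "\<forall>\<^sub>F n in sequentially. \<forall>\<eta>\<in>S. \<forall>r\<in>{0..T}. dist (V n r \<eta>) (u r \<eta>) < e / (K * m)"
        using assms(1) uniform_limitD[OF ul e] by (intro eventually_ball_finite) auto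
      then show "\<forall>\<^sub>F n in sequentially. \<forall>r\<in>{0..s}. dist (F r (V n r) \<xi>) (F r (u r) \<xi>) < e"
      proof eventually_elim
        case (elim n)
        show ?case
        proof
          fix r assume r: "r \<in> {0..s}"
          have "dist (F r (V n r) \<xi>) (F r (u r) \<xi>) \<le> K * (\<Sum>\<eta>\<in>S. \<bar>V n r \<eta> - u r \<eta>\<bar>)"
            unfolding dist_real_def using r sub that by (intro lip) auto
          also have "\<dots> \<le> K * (\<Sum>\<eta>\<in>S. e / (K * m))"
            using elim r sub assms(3) by (intro mult_left_mono sum_mono) (auto simp: dist_real_def intro!: less_imp_le)
          also have "\<dots> = e * (real (card S) / m)" using assms(3) by simp
          also have "\<dots> < e * 1" using \<open>0 < e\<close> m by (intro mult_strict_left_mono) (auto simp: m_def)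
          finally show "dist (F r (V n r) \<xi>) (F r (u r) \<xi>) < e" by simp
        qed
      qed
    qed
    then have "(\<lambda>n. integral {0..s} (\<lambda>r. F r (V n r) \<xi>)) \<longlonglongrightarrow> integral {0..s} (\<lambda>r. F r (u r) \<xi>)"
    proof (rule uniform_limit_integral)
      show "continuous_on {0..s} (\<lambda>r. F r (V n r) \<xi>)" for n
        by (rule continuous_on_subset[OF Fc[OF that(1)] sub])
      fix I J assume I: "\<And>n. ((\<lambda>r. F r (V n r) \<xi>) has_integral I n) {0..s}" and J: "((\<lambda>r. F r (u r) \<xi>) has_integral J) {0..s}"
        and lim: "I \<longlonglongrightarrow> J"
      have "I = (\<lambda>n. integral {0..s} (\<lambda>r. F r (V n r) \<xi>))" using integral_unique[OF I] by simp
      then show "(\<lambda>n. integral {0..s} (\<lambda>r. F r (V n r) \<xi>)) \<longlonglongrightarrow> integral {0..s} (\<lambda>r. F r (u r) \<xi>)"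
        using lim integral_unique[OF J] by simp
    qed simp
    then have "(\<lambda>n. V (Suc n) s \<xi>) \<longlonglongrightarrow> g \<xi> + integral {0..s} (\<lambda>r. F r (u r) \<xi>)"
      unfolding VS by (intro tendsto_add tendsto_const)
    moreover have "(\<lambda>n. V (Suc n) s \<xi>) \<longlonglongrightarrow> u s \<xi>"
      using tendsto_uniform_limitI[OF ul[OF that(1)] that(2)] by (rule LIMSEQ_Suc)
    ultimately show ?thesis by (metis LIMSEQ_unique)
  qed
  show thesis
  proof
    show "u 0 \<xi> = g \<xi>" if "\<xi> \<in> S" for \<xi> using fix_eq[OF that, of 0] assms(2) by simp
    show "((\<lambda>s. u s \<xi>) has_field_derivative F s (u s) \<xi>) (at s within {0..T})" if "\<xi> \<in> S" "s \<in> {0..T}" for \<xi> s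
    proof -
      have "((\<lambda>s. g \<xi> + integral {0..s} (\<lambda>r. F r (u r) \<xi>)) has_field_derivative F s (u s) \<xi>) (at s within {0..T})"
        using DERIV_add[OF DERIV_const integral_has_real_derivative[OF Fuc[OF that(1)] that(2)]] by simp
      then show ?thesis
        by (rule has_field_derivative_transform_within[OF _ zero_less_one that(2)]) (simp add: fix_eq that)
    qed
  qed
qed

text \<open>The forward result under the reversal \<open>s \<mapsto> T - s\<close>, which turns the
  initial value into a terminal one and changes the sign of the derivative.\<close>

lemma picard_backward:
  fixes F :: "real \<Rightarrow> ('s \<Rightarrow> real) \<Rightarrow> 's \<Rightarrow> real"
  assumes "finite S" "0 \<le> T" "0 < K"
    and lip: "\<And>s \<phi> \<psi> \<xi>. s \<in> {0..T} \<Longrightarrow> \<xi> \<in> S \<Longrightarrow> \<bar>F s \<phi> \<xi> - F s \<psi> \<xi>\<bar> \<le> K * (\<Sum>\<eta>\<in>S. \<bar>\<phi> \<eta> - \<psi> \<eta>\<bar>)"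
    and cont: "\<And>u \<xi>. (\<And>\<eta>. \<eta> \<in> S \<Longrightarrow> continuous_on {0..T} (\<lambda>s. u s \<eta>)) \<Longrightarrow> \<xi> \<in> S \<Longrightarrow>
        continuous_on {0..T} (\<lambda>s. F s (u s) \<xi>)"
  obtains u where "\<And>\<xi>. \<xi> \<in> S \<Longrightarrow> u T \<xi> = g \<xi>"
    and "\<And>\<xi> s. \<xi> \<in> S \<Longrightarrow> s \<in> {0..T} \<Longrightarrow> ((\<lambda>s. u s \<xi>) has_field_derivative - F s (u s) \<xi>) (at s within {0..T})"
proof -
  have img: "(\<lambda>s. T - s) ` {0..T} = {0..T}" by (auto intro!: image_eqI[where x="T - _"])
  obtain w where w0: "\<And>\<xi>. \<xi> \<in> S \<Longrightarrow> w 0 \<xi> = g \<xi>"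
    and w: "\<And>\<xi> s. \<xi> \<in> S \<Longrightarrow> s \<in> {0..T} \<Longrightarrow> ((\<lambda>s. w s \<xi>) has_field_derivative F (T - s) (w s) \<xi>) (at s within {0..T})"
  proof (rule picard_forward[where F="\<lambda>s. F (T - s)" and T=T and K=K and S=S and g=g])
    \<comment> \<open>The continuity hypothesis concerns \<open>F s\<close> along curves run
      forwards, so the reversed curve is inserted and the result is reversed once more.\<close>
    fix u :: "real \<Rightarrow> 's \<Rightarrow> real" and \<xi> assume u: "\<And>\<eta>. \<eta> \<in> S \<Longrightarrow> continuous_on {0..T} (\<lambda>s. u s \<eta>)" and "\<xi> \<in> S"
    have "continuous_on {0..T} (\<lambda>s. u (T - s) \<eta>)" if "\<eta> \<in> S" for \<eta>
      by (rule continuous_on_compose2[OF u[OF that]]) (auto intro!: continuous_intros)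
    from cont[of "\<lambda>s. u (T - s)", OF this \<open>\<xi> \<in> S\<close>]
    have c: "continuous_on {0..T} (\<lambda>s. F s (u (T - s)) \<xi>)" .
    have "continuous_on {0..T} (\<lambda>s. (\<lambda>s. F s (u (T - s)) \<xi>) (T - s))"
      by (rule continuous_on_compose2[OF c]) (auto intro!: continuous_intros)
    then show "continuous_on {0..T} (\<lambda>s. F (T - s) (u s) \<xi>)" by simp
  qed (use assms lip in auto)
  show thesis
  proof (rule that[of "\<lambda>s. w (T - s)"])
    show "((\<lambda>s. w (T - s) \<xi>) has_field_derivative - F s (w (T - s)) \<xi>) (at s within {0..T})"
      if "\<xi> \<in> S" "s \<in> {0..T}" for \<xi> s
    proof -
      have "((\<lambda>s. w s \<xi>) has_field_derivative F s (w (T - s)) \<xi>) (at (T - s) within (\<lambda>s. T - s) ` {0..T})"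
        using w[of \<xi> "T - s"] that unfolding img by simp
      moreover have "((\<lambda>s. T - s) has_field_derivative - 1) (at s within {0..T})"
        by (auto intro!: derivative_eq_intros)
      ultimately show ?thesis using DERIV_image_chain[of "\<lambda>s. w s \<xi>"] by (fastforce simp: o_def)
    qed
  qed (simp add: w0)
qed

section \<open>The Hamilton-Jacobi-Bellman system\<close>

text \<open>Targets are required to lie in \<open>S\<close> only where the rate is nonzero: a jump
  of the empirical measure away from an empty site would leave the state space, but it carries the
  factor 0.\<close>

lemma indicator_jump_sum:
  fixes \<phi> :: "'s \<Rightarrow> real"
  assumes "finite S" "\<xi> \<in> S" "\<And>i. i \<in> I \<Longrightarrow> c i \<noteq> 0 \<Longrightarrow> \<tau> i \<in> S"
  shows "(\<Sum>i\<in>I. c i * (\<phi> (\<tau> i) - \<phi> \<xi>))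
    = (\<Sum>\<eta>\<in>S. (\<Sum>i\<in>I. c i * (indicator {\<eta>} (\<tau> i) - indicator {\<eta>} \<xi>)) * \<phi> \<eta>)"
proof -
  have pick: "(\<Sum>\<eta>\<in>S. indicator {\<eta>} \<zeta> * \<phi> \<eta>) = \<phi> \<zeta>" if "\<zeta> \<in> S" for \<zeta>
    using that assms(1) by (subst sum.remove[of _ \<zeta>]) (auto intro!: sum.neutral simp: indicator_def)
  have "c i * (\<phi> (\<tau> i) - \<phi> \<xi>) = (\<Sum>\<eta>\<in>S. c i * (indicator {\<eta>} (\<tau> i) - indicator {\<eta>} \<xi>) * \<phi> \<eta>)"
    if "i \<in> I" for i
  proof (cases "c i = 0")
    case False
    then have "\<phi> (\<tau> i) - \<phi> \<xi> = (\<Sum>\<eta>\<in>S. (indicator {\<eta>} (\<tau> i) - indicator {\<eta>} \<xi>) * \<phi> \<eta>)"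
      using pick[OF assms(2)] pick[OF assms(3)[OF that]] by (simp add: left_diff_distrib sum_subtractf)
    then show ?thesis by (simp add: sum_distrib_left mult.assoc)
  qed simp
  then have "(\<Sum>i\<in>I. c i * (\<phi> (\<tau> i) - \<phi> \<xi>))
      = (\<Sum>i\<in>I. \<Sum>\<eta>\<in>S. c i * (indicator {\<eta>} (\<tau> i) - indicator {\<eta>} \<xi>) * \<phi> \<eta>)"
    by (intro sum.cong) auto
  also have "\<dots> = (\<Sum>\<eta>\<in>S. \<Sum>i\<in>I. c i * (indicator {\<eta>} (\<tau> i) - indicator {\<eta>} \<xi>) * \<phi> \<eta>)"
    by (rule sum.swap)
  finally show ?thesis by (simp add: sum_distrib_right)
qed

lemma gen_x_linear:
  assumes "\<xi> \<in> states N"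
  shows "gen_x lam0 lam1 \<alpha> \<phi> t \<xi> = (\<Sum>\<eta>\<in>states N. gen_x lam0 lam1 \<alpha> (indicator {\<eta>}) t \<xi> * \<phi> \<eta>)"
proof -
  obtain x \<mu> where xi: "\<xi> = (x, \<mu>)" by (cases \<xi>)
  show ?thesis
    unfolding xi gen_x_def prod.case
    by (rule indicator_jump_sum[OF finite_states]) (use assms in \<open>auto simp: xi states_def\<close>)
qed

lemma gen_mu_linear:
  assumes "0 < N" "\<xi> \<in> states N"
  shows "gen_mu N lam0 lam1 \<beta> \<phi> t \<xi> = (\<Sum>\<eta>\<in>states N. gen_mu N lam0 lam1 \<beta> (indicator {\<eta>}) t \<xi> * \<phi> \<eta>)"
proof -
  obtain x \<mu> where xi: "\<xi> = (x, \<mu>)" by (cases \<xi>)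
  have \<mu>: "\<mu> \<in> emp_measures N" using assms by (simp add: xi states_def)
  show ?thesis
    unfolding xi gen_mu_def prod.case case_prod_beta
    by (rule indicator_jump_sum[OF finite_states])
      (use assms(2) emp_measures_shift[OF assms(1) \<mu>] in \<open>auto simp: xi states_def\<close>)
qed

lemma adm_continuous:
  assumes "\<alpha> \<in> adm N T" "\<xi> \<in> states N"
  shows "continuous_on {0..T} (\<lambda>t. \<alpha> t \<xi>)"
proof -
  obtain K where "\<forall>\<xi>\<in>states N. K-lipschitz_on {0..T} (\<lambda>t. \<alpha> t \<xi>)"
    using assms(1) unfolding adm_def by blast
  then show ?thesis using assms(2) lipschitz_on_continuous_on by blast
qed

lemma adm_orthant:
  assumes "\<alpha> \<in> adm N T" "\<xi> \<in> states N" "t \<in> {0..T}"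
  shows "\<alpha> t \<xi> \<in> orthant (fst \<xi>)"
proof -
  have "\<forall>t\<in>{0..T}. \<forall>(x,\<mu>)\<in>states N. \<alpha> t (x,\<mu>) \<in> orthant x"
    using assms(1) unfolding adm_def by blast
  then show ?thesis using assms(2,3) by (cases \<xi>) auto
qed

lemma admI:
  assumes "\<And>t \<xi>. t \<in> {0..T} \<Longrightarrow> \<xi> \<in> states N \<Longrightarrow> \<alpha> t \<xi> \<in> orthant (fst \<xi>)"
    and "\<And>\<xi>. \<xi> \<in> states N \<Longrightarrow> K-lipschitz_on {0..T} (\<lambda>t. \<alpha> t \<xi>)"
  shows "\<alpha> \<in> adm N T"
  unfolding adm_def using assms by fastforce

lemma zero_adm: "(\<lambda>_ _. 0) \<in> adm N T"
  by (rule admI[where K=0]) (auto intro!: lipschitz_onI)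

lemma snorm_continuous:
  fixes \<psi> :: "real \<Rightarrow> 'd::finite state \<Rightarrow> 'b::real_normed_vector"
  assumes "\<And>\<xi>. \<xi> \<in> states N \<Longrightarrow> continuous_on A (\<lambda>t. \<psi> t \<xi>)"
  shows "continuous_on A (\<lambda>t. snorm N (\<psi> t))"
  unfolding snorm_def using assms by (intro continuous_on_real_sqrt continuous_on_sum continuous_on_power continuous_on_norm)

lemma gen_mu_continuous:
  fixes \<xi> :: "'d::finite state"
  assumes "0 < N" "\<xi> \<in> states N" "\<beta> \<in> adm N T"
  shows "continuous_on {0..T} (\<lambda>t. gen_mu N lam0 lam1 \<beta> \<phi> t \<xi>)"
proof -
  obtain x \<mu> where xi: "\<xi> = (x, \<mu>)" by (cases \<xi>)
  have \<mu>: "\<mu> \<in> emp_measures N" using assms by (simp add: xi states_def)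
  show ?thesis
    unfolding xi gen_mu_def prod.case case_prod_beta fst_conv snd_conv
  proof (rule continuous_on_sum)
    fix p :: "'d \<times> 'd"
    show "continuous_on {0..T} (\<lambda>t. real N * \<mu> $ snd p * (lam0 (snd p, \<mu> + unit_shift N x (snd p)) $ fst p +
          lam1 (snd p, \<mu> + unit_shift N x (snd p)) $ fst p * \<beta> t (snd p, \<mu> + unit_shift N x (snd p)) $ fst p) *
          (\<phi> (x, \<mu> + unit_shift N (fst p) (snd p)) - \<phi> (x, \<mu>)))"
    \<comment> \<open>For an empty site \<beta> may be evaluated outside the state space, where
      nothing is known about its continuity; there the summand is constantly 0.\<close>
    proof (cases "\<mu> $ snd p = 0")
      case False
      then have "(snd p, \<mu> + unit_shift N x (snd p)) \<in> states N"
        using emp_measures_shift[OF assms(1) \<mu>] by (simp add: states_def)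
      from adm_continuous[OF assms(3) this] show ?thesis by (intro continuous_intros)
    qed simp
  qed
qed

lemma emp_measures_component:
  assumes "\<mu> \<in> emp_measures N"
  shows "0 \<le> \<mu> $ z" "\<mu> $ z \<le> 1"
proof -
  obtain k where "k \<le> N" "\<mu> $ z = real k / real N" using assms unfolding emp_measures_def by fastforce
  then show "0 \<le> \<mu> $ z" "\<mu> $ z \<le> 1" by (auto simp: divide_le_eq_1)
qed

definition state_Delta :: "('d::finite state \<Rightarrow> real) \<Rightarrow> 'd state \<Rightarrow> real ^ 'd" where
  "state_Delta \<phi> \<xi> = Delta (fst \<xi>) (\<lambda>y. \<phi> (y, snd \<xi>))"

lemma state_Delta_diff_le:
  fixes \<xi> :: "'d::finite state"
  assumes "\<xi> \<in> states N"
  shows "norm (state_Delta \<phi> \<xi> - state_Delta \<psi> \<xi>) \<le> 2 * real CARD('d) * (\<Sum>\<eta>\<in>states N. \<bar>\<phi> \<eta> - \<psi> \<eta>\<bar>)"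
  unfolding state_Delta_def using norm_Delta_diff_le[of "fst \<xi>" "snd \<xi>" N \<phi> \<psi>] assms by simp

lemma state_Delta_continuous:
  fixes \<xi> :: "'d::finite state"
  assumes "\<xi> \<in> states N" "\<And>\<eta>. \<eta> \<in> states N \<Longrightarrow> continuous_on A (\<lambda>s. u s \<eta>)"
  shows "continuous_on A (\<lambda>s. state_Delta (u s) \<xi>)"
  unfolding state_Delta_def Delta_def
  using assms by (intro continuous_on_vec_lambda continuous_on_diff assms(2)) (auto simp: states_def)

lemma state_Delta_cong:
  assumes "\<xi> \<in> states N" "\<And>\<eta>. \<eta> \<in> states N \<Longrightarrow> \<phi> \<eta> = \<psi> \<eta>"
  shows "state_Delta \<phi> \<xi> = state_Delta \<psi> \<xi>"
proof -
  have "(y, snd \<xi>) \<in> states N" for y using assms(1) by (auto simp: states_def)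
  then show ?thesis using assms by (simp add: state_Delta_def Delta_def)
qed

lemma norm_state_Delta_le:
  fixes \<xi> :: "'d::finite state"
  assumes "\<xi> \<in> states N" "\<And>\<eta>. \<eta> \<in> states N \<Longrightarrow> 0 \<le> \<phi> \<eta> \<and> \<phi> \<eta> \<le> R"
  shows "norm (state_Delta \<phi> \<xi>) \<le> real CARD('d) * R"
proof -
  have S: "(y, snd \<xi>) \<in> states N" for y using assms(1) by (auto simp: states_def)
  have "\<bar>state_Delta \<phi> \<xi> $ y\<bar> \<le> R" for y
    using assms(2)[OF S[of y]] assms(2)[OF S[of "fst \<xi>"]] by (auto simp: state_Delta_def Delta_def)
  then have "(\<Sum>y\<in>UNIV. \<bar>state_Delta \<phi> \<xi> $ y\<bar>) \<le> (\<Sum>y\<in>(UNIV::'d set). R)" by (intro sum_mono)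
  then show ?thesis using norm_le_l1_cart[of "state_Delta \<phi> \<xi>"] by simp
qed

text \<open>A function with continuous derivative on a compact interval is Lipschitz in time, and so
  is its composition with a feedback map that is Lipschitz in \<open>p\<close>. Used for the
  truncated feedback \<open>opt M\<close> and for \<open>hat\<close>.\<close>

lemma feedback_adm:
  fixes w w' :: "real \<Rightarrow> 'd::finite state \<Rightarrow> real"
  assumes w: "\<And>\<eta> s. \<eta> \<in> states N \<Longrightarrow> s \<in> {0..T} \<Longrightarrow> ((\<lambda>s. w s \<eta>) has_field_derivative w' s \<eta>) (at s within {0..T})"
    and w': "\<And>\<eta>. \<eta> \<in> states N \<Longrightarrow> continuous_on {0..T} (\<lambda>s. w' s \<eta>)"
    and A: "\<And>\<xi> p. \<xi> \<in> states N \<Longrightarrow> A \<xi> p \<in> orthant (fst \<xi>)"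
    and c: "0 \<le> c" "\<And>\<xi> p p'. \<xi> \<in> states N \<Longrightarrow> norm (A \<xi> p - A \<xi> p') \<le> c * norm (p - p')"
  shows "(\<lambda>t \<xi>. A \<xi> (state_Delta (w t) \<xi>)) \<in> adm N T"
proof -
  obtain B where B: "B > 0" "\<And>s \<eta>. s \<in> {0..T} \<Longrightarrow> \<eta> \<in> states N \<Longrightarrow> norm (w' s \<eta>) \<le> B"
    using continuous_Icc_finite_bounded[where f=w' and S="states N :: 'd state set" and a=0 and b=T, OF finite_states w'] by blast
  let ?K = "c * (2 * real CARD('d) * (card (states N :: 'd state set) * B))"
  have wl: "\<bar>w s \<eta> - w r \<eta>\<bar> \<le> B * \<bar>s - r\<bar>" if "\<eta> \<in> states N" "s \<in> {0..T}" "r \<in> {0..T}" for s r \<eta>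
    using field_differentiable_bound[of "{0..T}" "\<lambda>s. w s \<eta>" "\<lambda>s. w' s \<eta>" B s r] w[OF that(1)] B(2)[OF _ that(1)] that(2,3)
    by (simp add: norm_minus_commute)
  show ?thesis
  proof (rule admI[where K="?K"])
    fix \<xi> :: "'d state" assume \<xi>: "\<xi> \<in> states N"
    show "?K-lipschitz_on {0..T} (\<lambda>t. A \<xi> (state_Delta (w t) \<xi>))"
    proof (rule lipschitz_onI)
      fix s r assume sr: "s \<in> {0..T}" "r \<in> {0..T}"
      have "norm (A \<xi> (state_Delta (w s) \<xi>) - A \<xi> (state_Delta (w r) \<xi>))
          \<le> c * norm (state_Delta (w s) \<xi> - state_Delta (w r) \<xi>)" by (rule c(2)[OF \<xi>])
      also have "\<dots> \<le> c * (2 * real CARD('d) * (\<Sum>\<eta>\<in>states N. \<bar>w s \<eta> - w r \<eta>\<bar>))"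
        by (intro mult_left_mono state_Delta_diff_le \<xi> c(1))
      also have "\<dots> \<le> c * (2 * real CARD('d) * (\<Sum>\<eta>\<in>(states N::'d state set). B * \<bar>s - r\<bar>))"
        using wl sr by (intro mult_left_mono sum_mono c(1)) auto
      finally show "dist (A \<xi> (state_Delta (w s) \<xi>)) (A \<xi> (state_Delta (w r) \<xi>)) \<le> ?K * dist s r"
        by (simp add: dist_norm mult_ac)
    qed (use B c in simp)
  qed (rule A)
qed

context finite_markov_chain
begin

lemma cost_bounds:
  fixes f :: "real \<Rightarrow> 's \<Rightarrow> real" and g :: "'s \<Rightarrow> real"
  assumes "t \<in> {0..T}" "\<xi> \<in> S"
    and f: "\<And>\<eta>. \<eta> \<in> S \<Longrightarrow> continuous_on {0..T} (\<lambda>u. f u \<eta>)"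
    and f0: "\<And>\<eta> u. \<eta> \<in> S \<Longrightarrow> u \<in> {0..T} \<Longrightarrow> 0 \<le> f u \<eta>" and g0: "\<And>\<eta>. \<eta> \<in> S \<Longrightarrow> 0 \<le> g \<eta>"
  shows "0 \<le> (\<integral>\<omega>. (LBINT u:{t..T}. f u (Xi u \<omega>)) + g (Xi T \<omega>) \<partial>P t \<xi>)"
    and "(\<And>\<eta> u. \<eta> \<in> S \<Longrightarrow> u \<in> {0..T} \<Longrightarrow> f u \<eta> \<le> A) \<Longrightarrow> (\<And>\<eta>. \<eta> \<in> S \<Longrightarrow> g \<eta> \<le> B) \<Longrightarrow>
      (\<integral>\<omega>. (LBINT u:{t..T}. f u (Xi u \<omega>)) + g (Xi T \<omega>) \<partial>P t \<xi>) \<le> (T - t) * A + B"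
proof -
  have f': "continuous_on {t..T} (\<lambda>u. f u \<eta>)" if "\<eta> \<in> S" for \<eta>
    using assms(1) by (intro continuous_on_subset[OF f[OF that]]) auto
  have TT: "T \<in> {t..T}" using assms(1) by auto
  have eq: "(\<integral>\<omega>. (LBINT u:{t..T}. f u (Xi u \<omega>)) + g (Xi T \<omega>) \<partial>P t \<xi>)
    = integral {t..T} (\<lambda>u. \<Sum>\<eta>\<in>S. tprob t u \<xi> \<eta> * f u \<eta>) + (\<Sum>\<eta>\<in>S. tprob t T \<xi> \<eta> * g \<eta>)"
    by (rule expected_running_cost[OF assms(1,2) f'])
  have c: "continuous_on {t..T} (\<lambda>u. \<Sum>\<eta>\<in>S. tprob t u \<xi> \<eta> * f u \<eta>)"
    using assms by (intro continuous_on_sum continuous_on_mult tprob_continuous f')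
  have "0 \<le> integral {t..T} (\<lambda>u. \<Sum>\<eta>\<in>S. tprob t u \<xi> \<eta> * f u \<eta>)"
    using f0 assms(1) by (intro integral_nonneg integrable_continuous_real c sum_nonneg mult_nonneg_nonneg tprob_nonneg) auto
  moreover have "0 \<le> (\<Sum>\<eta>\<in>S. tprob t T \<xi> \<eta> * g \<eta>)"
    by (intro sum_nonneg mult_nonneg_nonneg tprob_nonneg g0)
  ultimately show "0 \<le> (\<integral>\<omega>. (LBINT u:{t..T}. f u (Xi u \<omega>)) + g (Xi T \<omega>) \<partial>P t \<xi>)"
    unfolding eq by simp
  show "(\<integral>\<omega>. (LBINT u:{t..T}. f u (Xi u \<omega>)) + g (Xi T \<omega>) \<partial>P t \<xi>) \<le> (T - t) * A + B"
    if A: "\<And>\<eta> u. \<eta> \<in> S \<Longrightarrow> u \<in> {0..T} \<Longrightarrow> f u \<eta> \<le> A" and B: "\<And>\<eta>. \<eta> \<in> S \<Longrightarrow> g \<eta> \<le> B"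
  proof -
    have avg: "(\<Sum>\<eta>\<in>S. tprob t u \<xi> \<eta> * h \<eta>) \<le> C" if "u \<in> {t..T}" "\<And>\<eta>. \<eta> \<in> S \<Longrightarrow> h \<eta> \<le> C" for u h C
    proof -
      have "(\<Sum>\<eta>\<in>S. tprob t u \<xi> \<eta> * h \<eta>) \<le> (\<Sum>\<eta>\<in>S. tprob t u \<xi> \<eta> * C)"
        using that(2) by (intro sum_mono mult_left_mono tprob_nonneg)
      then show ?thesis using sum_tprob[OF assms(1,2) that(1)] by (simp add: sum_distrib_right[symmetric])
    qed
    have "integral {t..T} (\<lambda>u. \<Sum>\<eta>\<in>S. tprob t u \<xi> \<eta> * f u \<eta>) \<le> integral {t..T} (\<lambda>u. A)"
      using A assms(1) by (intro integral_le integrable_continuous_real c avg) auto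
    moreover have "(\<Sum>\<eta>\<in>S. tprob t T \<xi> \<eta> * g \<eta>) \<le> B" by (rule avg[OF TT B])
    ultimately show ?thesis unfolding eq using assms(1) by simp
  qed
qed

end

section \<open>The Hamilton-Jacobi-Bellman equation with truncated controls\<close>

context mfg_data
begin

abbreviation (input) "hat \<equiv> hat_alpha lam0 lam1 l"
abbreviation (input) "L_mu \<equiv> gen_mu N lam0 lam1"

text \<open>Identifies the defect in Dynkin's formula with the residual of the
  Hamilton-Jacobi-Bellman equation in which the control \<alpha> is inserted.\<close>

lemma ham_state_Delta:
  "ham \<xi> (state_Delta \<phi> \<xi>) (\<alpha> t \<xi>) = l \<xi> (\<alpha> t \<xi>) + gen_x lam0 lam1 \<alpha> \<phi> t \<xi>"
  by (cases \<xi>) (simp add: pre_hamiltonian_def gen_x_def state_Delta_def Delta_def)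

text \<open>A minimum of functions of \<open>p\<close> with a common Lipschitz constant: each
  minimiser is tested in the other problem. The constant is common because truncated controls have
  norm at most \<open>M\<close>.\<close>

lemma opt_ham_lipschitz:
  assumes "\<xi> \<in> states N" "0 \<le> M"
  shows "\<bar>ham \<xi> p (opt M \<xi> p) - ham \<xi> p' (opt M \<xi> p')\<bar> \<le> (lam0_sum + lam1_sum * M) * norm (p - p')"
proof -
  have *: "ham \<xi> p (opt M \<xi> p) - ham \<xi> p' (opt M \<xi> p') \<le> (lam0_sum + lam1_sum * M) * norm (p - p')" for p p'
  proof -
    have n: "norm (opt M \<xi> p') \<le> M" using opt_in_ctrl[OF assms, of p'] by (simp add: ctrl_def)
    have "ham \<xi> p (opt M \<xi> p) \<le> ham \<xi> p (opt M \<xi> p')" by (rule opt_le[OF assms opt_in_ctrl[OF assms]])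
    moreover have "ham \<xi> p (opt M \<xi> p') - ham \<xi> p' (opt M \<xi> p') \<le> (lam0_sum + lam1_sum * norm (opt M \<xi> p')) * norm (p - p')"
      using ham_diff_bound(2)[OF assms(1), of p "opt M \<xi> p'" p'] by linarith
    moreover have "\<dots> \<le> (lam0_sum + lam1_sum * M) * norm (p - p')"
      using n lam_sum_nonneg by (intro mult_right_mono add_left_mono mult_left_mono) auto
    ultimately show ?thesis by linarith
  qed
  from *[of p p'] *[of p' p] show ?thesis by (simp add: norm_minus_commute abs_le_iff)
qed

lemma opt_ham_continuous:
  assumes "\<xi> \<in> states N" "0 \<le> M" "continuous_on A p"
  shows "continuous_on A (\<lambda>s. ham \<xi> (p s) (opt M \<xi> (p s)))"
proof -
  have "(lam0_sum + lam1_sum * M)-lipschitz_on UNIV (\<lambda>p. ham \<xi> p (opt M \<xi> p))"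
    using opt_ham_lipschitz[OF assms(1,2)] assms(2) lam_sum_nonneg
    by (intro lipschitz_onI) (auto simp: dist_norm)
  then have "continuous_on UNIV (\<lambda>p. ham \<xi> p (opt M \<xi> p))" by (rule lipschitz_on_continuous_on)
  from continuous_on_compose2[OF this assms(3)] show ?thesis by simp
qed

lemma running_cost_continuous:
  assumes "\<alpha> \<in> adm N T" "\<xi> \<in> states N"
  shows "continuous_on {0..T} (\<lambda>t. l \<xi> (\<alpha> t \<xi>))"
  by (rule continuous_on_compose2[OF l_cont[OF assms(2)] adm_continuous[OF assms]])
    (use adm_orthant[OF assms] in auto)

lemma L_mu_continuous:
  assumes "\<xi> \<in> states N" "\<beta> \<in> adm N T" "\<And>\<eta>. \<eta> \<in> states N \<Longrightarrow> continuous_on {0..T} (\<lambda>s. u s \<eta>)"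
  shows "continuous_on {0..T} (\<lambda>s. L_mu \<beta> (u s) s \<xi>)"
  unfolding gen_mu_linear[OF N_pos assms(1), of lam0 lam1 \<beta> "u _"]
  by (intro continuous_on_sum continuous_on_mult assms(3) gen_mu_continuous[OF N_pos assms(1,2)])

text \<open>The local Hamiltonian is Lipschitz thanks to the truncation, and the mean field part is
  a matrix whose entries are continuous in time, hence bounded by some \<open>C\<close>. This
  \<open>C\<close> depends on \<beta>, which is harmless: it serves existence and enters no final
  constant.\<close>

lemma truncated_hjb_solution:
  assumes "\<beta> \<in> adm N T" "0 \<le> M"
  obtains u where "\<And>\<xi>. \<xi> \<in> states N \<Longrightarrow> u T \<xi> = g \<xi>"
    and "\<And>\<xi> s. \<xi> \<in> states N \<Longrightarrow> s \<in> {0..T} \<Longrightarrow> ((\<lambda>s. u s \<xi>) has_field_derivative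
      - (ham \<xi> (state_Delta (u s) \<xi>) (opt M \<xi> (state_Delta (u s) \<xi>)) + L_mu \<beta> (u s) s \<xi>)) (at s within {0..T})"
proof -
  let ?S = "states N :: 'd state set"
  obtain C where C: "C > 0" "\<And>s p. s \<in> {0..T} \<Longrightarrow> p \<in> ?S \<times> ?S \<Longrightarrow> norm (L_mu \<beta> (indicator {fst p}) s (snd p)) \<le> C"
  proof (rule continuous_Icc_finite_bounded[where f="\<lambda>s p. L_mu \<beta> (indicator {fst p}) s (snd p)" and S="?S \<times> ?S" and a=0 and b=T])
    show "continuous_on {0..T} (\<lambda>s. L_mu \<beta> (indicator {fst p}) s (snd p))" if "p \<in> ?S \<times> ?S" for p
      using that by (intro gen_mu_continuous[OF N_pos _ assms(1)]) auto
  qed (use that in auto)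
  let ?c = "lam0_sum + lam1_sum * M"
  have c0: "0 \<le> ?c" using lam_sum_nonneg assms(2) by simp
  show thesis
  proof (rule picard_backward[where S="?S" and T=T and K="?c * (2 * real CARD('d)) + C" and g=g
      and F="\<lambda>s \<phi> \<xi>. ham \<xi> (state_Delta \<phi> \<xi>) (opt M \<xi> (state_Delta \<phi> \<xi>)) + L_mu \<beta> \<phi> s \<xi>"])
    fix s \<xi> and \<phi> \<psi> :: "'d state \<Rightarrow> real" assume s: "s \<in> {0..T}" and \<xi>: "\<xi> \<in> ?S"
    let ?d = "\<Sum>\<eta>\<in>?S. \<bar>\<phi> \<eta> - \<psi> \<eta>\<bar>"
    have "\<bar>ham \<xi> (state_Delta \<phi> \<xi>) (opt M \<xi> (state_Delta \<phi> \<xi>)) - ham \<xi> (state_Delta \<psi> \<xi>) (opt M \<xi> (state_Delta \<psi> \<xi>))\<bar>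
        \<le> ?c * norm (state_Delta \<phi> \<xi> - state_Delta \<psi> \<xi>)" by (rule opt_ham_lipschitz[OF \<xi> assms(2)])
    also have "\<dots> \<le> ?c * (2 * real CARD('d) * ?d)"
      by (intro mult_left_mono state_Delta_diff_le \<xi> c0)
    finally have 1: "\<bar>ham \<xi> (state_Delta \<phi> \<xi>) (opt M \<xi> (state_Delta \<phi> \<xi>)) - ham \<xi> (state_Delta \<psi> \<xi>) (opt M \<xi> (state_Delta \<psi> \<xi>))\<bar> \<le> \<dots>" .
    have "L_mu \<beta> \<phi> s \<xi> - L_mu \<beta> \<psi> s \<xi> = (\<Sum>\<eta>\<in>?S. L_mu \<beta> (indicator {\<eta>}) s \<xi> * (\<phi> \<eta> - \<psi> \<eta>))"
      using gen_mu_linear[OF N_pos \<xi>, of lam0 lam1 \<beta> \<phi>] gen_mu_linear[OF N_pos \<xi>, of lam0 lam1 \<beta> \<psi>]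
      by (simp add: sum_subtractf right_diff_distrib)
    also have "\<bar>\<dots>\<bar> \<le> (\<Sum>\<eta>\<in>?S. C * \<bar>\<phi> \<eta> - \<psi> \<eta>\<bar>)"
    proof (intro order_trans[OF sum_abs] sum_mono)
      fix \<eta> assume "\<eta> \<in> ?S"
      then have "\<bar>L_mu \<beta> (indicator {\<eta>}) s \<xi>\<bar> \<le> C" using C(2)[OF s, of "(\<eta>, \<xi>)"] \<xi> by simp
      then show "\<bar>L_mu \<beta> (indicator {\<eta>}) s \<xi> * (\<phi> \<eta> - \<psi> \<eta>)\<bar> \<le> C * \<bar>\<phi> \<eta> - \<psi> \<eta>\<bar>"
        by (auto simp: abs_mult intro!: mult_right_mono)
    qed
    finally have 2: "\<bar>L_mu \<beta> \<phi> s \<xi> - L_mu \<beta> \<psi> s \<xi>\<bar> \<le> C * ?d" by (simp add: sum_distrib_left)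
    have "(?c * (2 * real CARD('d)) + C) * ?d = ?c * (2 * real CARD('d) * ?d) + C * ?d" by (simp add: algebra_simps)
    then show "\<bar>ham \<xi> (state_Delta \<phi> \<xi>) (opt M \<xi> (state_Delta \<phi> \<xi>)) + L_mu \<beta> \<phi> s \<xi>
        - (ham \<xi> (state_Delta \<psi> \<xi>) (opt M \<xi> (state_Delta \<psi> \<xi>)) + L_mu \<beta> \<psi> s \<xi>)\<bar> \<le> (?c * (2 * real CARD('d)) + C) * ?d"
      using 1 2 by linarith
  next
    fix u :: "real \<Rightarrow> 'd state \<Rightarrow> real" and \<xi> assume u: "\<And>\<eta>. \<eta> \<in> ?S \<Longrightarrow> continuous_on {0..T} (\<lambda>s. u s \<eta>)" and \<xi>: "\<xi> \<in> ?S"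
    show "continuous_on {0..T} (\<lambda>s. ham \<xi> (state_Delta (u s) \<xi>) (opt M \<xi> (state_Delta (u s) \<xi>)) + L_mu \<beta> (u s) s \<xi>)"
      by (intro continuous_on_add opt_ham_continuous \<xi> assms L_mu_continuous u state_Delta_continuous[OF \<xi>])
  next
    show "0 < ?c * (2 * real CARD('d)) + C" using c0 C(1) by (intro add_nonneg_pos) auto
  qed (rule finite_states, use T_pos in simp, rule that)
qed

text \<open>Dominates the cost of the zero control against any mean field control, whatever the
  chain, and therefore every value function.\<close>

definition value_bound :: real where
  "value_bound = T * l0_sum + (\<Sum>\<xi>\<in>states N. g \<xi>)"

end

section \<open>Verification and identification of the value function\<close>

locale mfg_chain = mfg_data N T lam0 lam1 l g \<gamma>
  for N :: nat and T :: real and lam0 lam1 :: "'d::finite state \<Rightarrow> real ^ 'd"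
    and l :: "'d state \<Rightarrow> real ^ 'd \<Rightarrow> real" and g :: "'d state \<Rightarrow> real" and \<gamma> :: real +
  fixes Xi :: "real \<Rightarrow> 'w \<Rightarrow> 'd state" and P :: "'d field \<Rightarrow> 'd field \<Rightarrow> real \<Rightarrow> 'd state \<Rightarrow> 'w measure"
  assumes controlled: "is_controlled_chain N T lam0 lam1 Xi P"
begin

lemma finite_markov_chain_P:
  assumes "\<alpha> \<in> adm N T" "\<beta> \<in> adm N T"
  shows "finite_markov_chain T (states N) (\<lambda>\<phi> t \<xi>. gen_x lam0 lam1 \<alpha> \<phi> t \<xi> + L_mu \<beta> \<phi> t \<xi>) Xi (P \<alpha> \<beta>)"
proof
  show "markov_chain T (states N) (\<lambda>\<phi> t \<xi>. gen_x lam0 lam1 \<alpha> \<phi> t \<xi> + L_mu \<beta> \<phi> t \<xi>) Xi (P \<alpha> \<beta>)"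
    using controlled assms unfolding is_controlled_chain_def by blast
  show "gen_x lam0 lam1 \<alpha> \<phi> t \<xi> + L_mu \<beta> \<phi> t \<xi> = (\<Sum>\<eta>\<in>states N.
      (gen_x lam0 lam1 \<alpha> (indicator {\<eta>}) t \<xi> + L_mu \<beta> (indicator {\<eta>}) t \<xi>) * \<phi> \<eta>)"
    if "\<xi> \<in> states N" for t \<xi> \<phi>
    by (subst gen_x_linear[OF that], subst gen_mu_linear[OF N_pos that]) (simp add: sum.distrib distrib_right)
qed simp

abbreviation (input) "J t \<xi> \<alpha> \<beta> \<equiv> cost T l g Xi P t \<xi> \<alpha> \<beta>"
abbreviation (input) "v \<equiv> value_fn N T l g Xi P"

text \<open>Any smooth \<open>w\<close> with the right terminal value may be compared with the cost
  of any pair of controls; the sign and size of the residual decide the comparison.\<close>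

lemma verification:
  fixes w w' :: "real \<Rightarrow> 'd state \<Rightarrow> real"
  assumes "\<alpha> \<in> adm N T" "\<beta> \<in> adm N T" "t \<in> {0..T}" "\<xi> \<in> states N"
    and w: "\<And>\<eta> s. \<eta> \<in> states N \<Longrightarrow> s \<in> {0..T} \<Longrightarrow> ((\<lambda>s. w s \<eta>) has_field_derivative w' s \<eta>) (at s within {0..T})"
    and wT: "\<And>\<eta>. \<eta> \<in> states N \<Longrightarrow> w T \<eta> = g \<eta>"
    and b: "continuous_on {t..T} b"
  shows "(\<And>s \<eta>. s \<in> {t..T} \<Longrightarrow> \<eta> \<in> states N \<Longrightarrow>
        ham \<eta> (state_Delta (w s) \<eta>) (\<alpha> s \<eta>) + L_mu \<beta> (w s) s \<eta> + w' s \<eta> \<le> b s) \<Longrightarrow>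
      J t \<xi> \<alpha> \<beta> \<le> w t \<xi> + integral {t..T} b"
    and "(\<And>s \<eta>. s \<in> {t..T} \<Longrightarrow> \<eta> \<in> states N \<Longrightarrow>
        b s \<le> ham \<eta> (state_Delta (w s) \<eta>) (\<alpha> s \<eta>) + L_mu \<beta> (w s) s \<eta> + w' s \<eta>) \<Longrightarrow>
      w t \<xi> + integral {t..T} b \<le> J t \<xi> \<alpha> \<beta>"
proof -
  interpret finite_markov_chain T "states N" "\<lambda>\<phi> t \<xi>. gen_x lam0 lam1 \<alpha> \<phi> t \<xi> + L_mu \<beta> \<phi> t \<xi>" Xi "P \<alpha> \<beta>"
    by (rule finite_markov_chain_P[OF assms(1,2)])
  have L: "l \<eta> (\<alpha> s \<eta>) + w' s \<eta> + (gen_x lam0 lam1 \<alpha> (w s) s \<eta> + L_mu \<beta> (w s) s \<eta>)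
      = ham \<eta> (state_Delta (w s) \<eta>) (\<alpha> s \<eta>) + L_mu \<beta> (w s) s \<eta> + w' s \<eta>" for s \<eta>
    by (simp add: ham_state_Delta)
  show "J t \<xi> \<alpha> \<beta> \<le> w t \<xi> + integral {t..T} b"
    if "\<And>s \<eta>. s \<in> {t..T} \<Longrightarrow> \<eta> \<in> states N \<Longrightarrow>
        ham \<eta> (state_Delta (w s) \<eta>) (\<alpha> s \<eta>) + L_mu \<beta> (w s) s \<eta> + w' s \<eta> \<le> b s"
    unfolding cost_def
    by (rule cost_le_defect[where f="\<lambda>u \<eta>. l \<eta> (\<alpha> u \<eta>)" and w=w and w'=w', OF assms(3,4) _ w wT b])
      (simp_all only: L that running_cost_continuous[OF assms(1)])
  show "w t \<xi> + integral {t..T} b \<le> J t \<xi> \<alpha> \<beta>"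
    if "\<And>s \<eta>. s \<in> {t..T} \<Longrightarrow> \<eta> \<in> states N \<Longrightarrow>
        b s \<le> ham \<eta> (state_Delta (w s) \<eta>) (\<alpha> s \<eta>) + L_mu \<beta> (w s) s \<eta> + w' s \<eta>"
    unfolding cost_def
    by (rule cost_ge_defect[where f="\<lambda>u \<eta>. l \<eta> (\<alpha> u \<eta>)" and w=w and w'=w', OF assms(3,4) _ w wT b])
      (simp_all only: L that running_cost_continuous[OF assms(1)])
qed

lemma J_bounds:
  assumes "\<alpha> \<in> adm N T" "\<beta> \<in> adm N T" "t \<in> {0..T}" "\<xi> \<in> states N"
  shows "0 \<le> J t \<xi> \<alpha> \<beta>" "J t \<xi> (\<lambda>_ _. 0) \<beta> \<le> value_bound"
proof -
  interpret finite_markov_chain T "states N" "\<lambda>\<phi> t \<xi>. gen_x lam0 lam1 \<alpha> \<phi> t \<xi> + L_mu \<beta> \<phi> t \<xi>" Xi "P \<alpha> \<beta>"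
    by (rule finite_markov_chain_P[OF assms(1,2)])
  show "0 \<le> J t \<xi> \<alpha> \<beta>"
    unfolding cost_def
    by (rule cost_bounds(1)[where f="\<lambda>u \<eta>. l \<eta> (\<alpha> u \<eta>)" and g=g, OF assms(3,4) running_cost_continuous[OF assms(1)]])
      (use l_nonneg adm_orthant[OF assms(1)] g_nonneg in auto)
  interpret Z: finite_markov_chain T "states N" "\<lambda>\<phi> t \<xi>. gen_x lam0 lam1 (\<lambda>_ _. 0) \<phi> t \<xi> + L_mu \<beta> \<phi> t \<xi>" Xi "P (\<lambda>_ _. 0) \<beta>"
    by (rule finite_markov_chain_P[OF zero_adm assms(2)])
  have "J t \<xi> (\<lambda>_ _. 0) \<beta> \<le> (T - t) * l0_sum + (\<Sum>\<xi>\<in>states N. g \<xi>)"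
    unfolding cost_def
    by (rule Z.cost_bounds(2)[where f="\<lambda>u \<eta>. l \<eta> 0" and g=g, OF assms(3,4)])
      (use l_nonneg l0_le g_nonneg in \<open>auto intro: member_le_sum[of _ _ g]\<close>)
  also have "\<dots> \<le> value_bound"
    unfolding value_bound_def using assms(3) l0_sum_nonneg by (intro add_right_mono mult_right_mono) auto
  finally show "J t \<xi> (\<lambda>_ _. 0) \<beta> \<le> value_bound" .
qed

text \<open>The truncation level \<open>M\<close> is chosen beyond any control that is optimal for a function with values
  in \<open>[0, value_bound]\<close>, so the constraint never binds.\<close>
lemma hjb:
  assumes "\<beta> \<in> adm N T"
  obtains u where "\<And>\<xi>. \<xi> \<in> states N \<Longrightarrow> u T \<xi> = g \<xi>"
    and "\<And>\<xi> s. \<xi> \<in> states N \<Longrightarrow> s \<in> {0..T} \<Longrightarrow> ((\<lambda>s. u s \<xi>) has_field_derivative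
      - (ham \<xi> (state_Delta (u s) \<xi>) (hat \<xi> (state_Delta (u s) \<xi>)) + L_mu \<beta> (u s) s \<xi>)) (at s within {0..T})"
    and "\<And>\<xi> s. \<xi> \<in> states N \<Longrightarrow> s \<in> {0..T} \<Longrightarrow> 0 \<le> u s \<xi> \<and> u s \<xi> \<le> value_bound"
    and "(\<lambda>t \<xi>. hat \<xi> (state_Delta (u t) \<xi>)) \<in> adm N T"
    and "\<And>\<xi> s \<alpha>. \<xi> \<in> states N \<Longrightarrow> s \<in> {0..T} \<Longrightarrow> \<alpha> \<in> adm N T \<Longrightarrow> u s \<xi> \<le> J s \<xi> \<alpha> \<beta>"
    and "\<And>\<xi> s. \<xi> \<in> states N \<Longrightarrow> s \<in> {0..T} \<Longrightarrow> v \<beta> s \<xi> = u s \<xi>"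
proof -
  define M where "M = max 0 (opt_bound (real CARD('d) * value_bound)) + 1"
  have M: "0 \<le> M" "opt_bound (real CARD('d) * value_bound) < M" by (auto simp: M_def)
  obtain u where uT: "\<And>\<xi>. \<xi> \<in> states N \<Longrightarrow> u T \<xi> = g \<xi>"
    and u: "\<And>\<xi> s. \<xi> \<in> states N \<Longrightarrow> s \<in> {0..T} \<Longrightarrow> ((\<lambda>s. u s \<xi>) has_field_derivative
      - (ham \<xi> (state_Delta (u s) \<xi>) (opt M \<xi> (state_Delta (u s) \<xi>)) + L_mu \<beta> (u s) s \<xi>)) (at s within {0..T})"
    using truncated_hjb_solution[OF assms M(1)] by blast
  have uc: "continuous_on {0..T} (\<lambda>s. u s \<xi>)" if "\<xi> \<in> states N" for \<xi>
    by (rule DERIV_continuous_on, rule u[OF that])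
  have u'c: "continuous_on {0..T} (\<lambda>s. - (ham \<xi> (state_Delta (u s) \<xi>) (opt M \<xi> (state_Delta (u s) \<xi>)) + L_mu \<beta> (u s) s \<xi>))"
    if "\<xi> \<in> states N" for \<xi>
    by (intro continuous_on_minus continuous_on_add opt_ham_continuous that assms M L_mu_continuous uc state_Delta_continuous[OF that])
  have fb: "(\<lambda>t \<xi>. opt M \<xi> (state_Delta (u t) \<xi>)) \<in> adm N T"
  proof (rule feedback_adm[where A="opt M" and c="lam1_sum / \<gamma>", OF u u'c])
    show "opt M \<xi> p \<in> orthant (fst \<xi>)" if "\<xi> \<in> states N" for \<xi> p
      using opt_in_ctrl[OF that M(1), of p] by (simp add: ctrl_def)
  qed (use lam_sum_nonneg \<gamma>_pos opt_lipschitz M in auto)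
  \<comment> \<open>The comparison of Hamiltonians is kept as a premise. At this point it is
    available only for controls in the ball; for all admissible ones it follows after the bounds on
    \<open>u\<close>.\<close>
  have lower: "u s \<xi> \<le> J s \<xi> \<alpha> \<beta>"
    if "\<xi> \<in> states N" "s \<in> {0..T}" "\<alpha> \<in> adm N T"
      and "\<And>r \<eta>. r \<in> {s..T} \<Longrightarrow> \<eta> \<in> states N \<Longrightarrow>
        ham \<eta> (state_Delta (u r) \<eta>) (opt M \<eta> (state_Delta (u r) \<eta>)) \<le> ham \<eta> (state_Delta (u r) \<eta>) (\<alpha> r \<eta>)" for \<xi> s \<alpha>
    using verification(2)[OF that(3) assms that(2,1) u uT, of "\<lambda>_. 0"] that(4) by simp
  have upper: "J s \<xi> (\<lambda>t \<xi>. opt M \<xi> (state_Delta (u t) \<xi>)) \<beta> \<le> u s \<xi>" if "\<xi> \<in> states N" "s \<in> {0..T}" for \<xi> s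
    using verification(1)[OF fb assms that(2,1) u uT, of "\<lambda>_. 0"] by simp
  \<comment> \<open>No circularity: the lower bound uses the truncated feedback, which is
    admissible, and the upper bound the zero control, which lies in every ball.\<close>
  have bnd: "0 \<le> u s \<xi> \<and> u s \<xi> \<le> value_bound" if \<xi>: "\<xi> \<in> states N" and s: "s \<in> {0..T}" for \<xi> s
  proof
    show "0 \<le> u s \<xi>" using upper[OF that] J_bounds(1)[OF fb assms s \<xi>] by linarith
    have "u s \<xi> \<le> J s \<xi> (\<lambda>_ _. 0) \<beta>"
      using M by (intro lower[OF \<xi> s zero_adm] opt_le) (auto simp: ctrl_def)
    then show "u s \<xi> \<le> value_bound" using J_bounds(2)[OF fb assms s \<xi>] by linarith
  qed
  \<comment> \<open>The bounds on \<open>u\<close> control its differences and hence the size of the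
    minimiser, so from here on truncated and unconstrained minimisers agree along
    \<open>u\<close>.\<close>
  have free: "opt_bound (norm (state_Delta (u s) \<xi>)) < M" if "\<xi> \<in> states N" "s \<in> {0..T}" for \<xi> s
  proof -
    have "norm (state_Delta (u s) \<xi>) \<le> real CARD('d) * value_bound"
      by (rule norm_state_Delta_le[OF that(1) bnd[OF _ that(2)]])
    then have "opt_bound (norm (state_Delta (u s) \<xi>)) \<le> opt_bound (real CARD('d) * value_bound)"
      unfolding opt_bound_def using lam_sum_nonneg \<gamma>_pos
      by (intro add_left_mono divide_right_mono mult_left_mono) auto
    then show ?thesis using M by linarith
  qed
  have hat: "hat \<xi> (state_Delta (u s) \<xi>) = opt M \<xi> (state_Delta (u s) \<xi>)" if "\<xi> \<in> states N" "s \<in> {0..T}" for \<xi> s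
    by (rule hat_alpha_eq_opt[OF that(1) free[OF that] M(1)])
  have low: "u s \<xi> \<le> J s \<xi> \<alpha> \<beta>" if \<xi>: "\<xi> \<in> states N" and s: "s \<in> {0..T}" and \<alpha>: "\<alpha> \<in> adm N T" for \<xi> s \<alpha>
  proof (rule lower[OF \<xi> s \<alpha>])
    fix r and \<eta> :: "'d state" assume "r \<in> {s..T}" "\<eta> \<in> states N"
    then show "ham \<eta> (state_Delta (u r) \<eta>) (opt M \<eta> (state_Delta (u r) \<eta>)) \<le> ham \<eta> (state_Delta (u r) \<eta>) (\<alpha> r \<eta>)"
      using s by (intro opt_global free M(1) adm_orthant[OF \<alpha>]) auto
  qed
  \<comment> \<open>The infimum over controls is attained by the feedback: its cost is at most
    \<open>u\<close>, while every cost is at least \<open>u\<close>.\<close>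
  have val: "v \<beta> s \<xi> = u s \<xi>" if "\<xi> \<in> states N" "s \<in> {0..T}" for \<xi> s
    unfolding value_fn_def
  proof (rule cInf_eq_minimum)
    show "u s \<xi> \<in> (\<lambda>\<alpha>. J s \<xi> \<alpha> \<beta>) ` adm N T"
      using fb upper[OF that] low[OF that fb] by (intro image_eqI[OF _ fb]) simp
  qed (use low[OF that] in auto)
  show thesis
  proof (rule that[OF uT _ bnd _ low val])
    show "((\<lambda>s. u s \<xi>) has_field_derivative
      - (ham \<xi> (state_Delta (u s) \<xi>) (hat \<xi> (state_Delta (u s) \<xi>)) + L_mu \<beta> (u s) s \<xi>)) (at s within {0..T})"
      if "\<xi> \<in> states N" "s \<in> {0..T}" for \<xi> s
      using u[OF that] hat[OF that] by simp
    show "(\<lambda>t \<xi>. hat \<xi> (state_Delta (u t) \<xi>)) \<in> adm N T"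
      by (rule feedback_adm[where A="hat" and c="lam1_sum / \<gamma>", OF u u'c hat_alpha_orthant])
        (use lam_sum_nonneg \<gamma>_pos hat_alpha_lipschitz in auto)
  qed
qed

lemma best_response_eq:
  "best_response N T lam0 lam1 l g Xi P \<beta> t \<xi> = hat \<xi> (state_Delta (v \<beta> t) \<xi>)"
  by (cases \<xi>) (simp add: best_response_def state_Delta_def)

end

section \<open>The error recursion\<close>

text \<open>With \<open>I\<close> denoting integration from 0, this is (\<rho> + I) to the power
  \<open>k\<close> applied to the constant 1, and \<open>binom_exp_int\<close> is \<open>I\<close>
  of it. For \<rho> \<noteq> 0 it is \<rho>^k times the Laguerre polynomial of degree
  \<open>k\<close> at -x/\<rho>.\<close>

definition binom_exp :: "real \<Rightarrow> nat \<Rightarrow> real \<Rightarrow> real" where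
  "binom_exp \<rho> k x = (\<Sum>i\<le>k. real (k choose i) * \<rho> ^ (k - i) * (x ^ i / fact i))"

definition binom_exp_int :: "real \<Rightarrow> nat \<Rightarrow> real \<Rightarrow> real" where
  "binom_exp_int \<rho> k x = (\<Sum>i\<le>k. real (k choose i) * \<rho> ^ (k - i) * (x ^ Suc i / fact (Suc i)))"

lemma binom_exp_0 [simp]: "binom_exp \<rho> 0 x = 1"
  by (simp add: binom_exp_def)

lemma binom_exp_Suc: "binom_exp \<rho> (Suc k) x = \<rho> * binom_exp \<rho> k x + binom_exp_int \<rho> k x"
proof -
  let ?y = "\<lambda>i. x ^ i / fact i"
  let ?f = "\<lambda>i. real (k choose i) * \<rho> ^ (Suc k - i) * ?y i"
  have "\<rho> * binom_exp \<rho> k x = (\<Sum>i\<le>k. ?f i)"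
    unfolding binom_exp_def sum_distrib_left by (rule sum.cong) (auto simp: Suc_diff_le)
  \<comment> \<open>The added term is 0 because \<open>k choose Suc k\<close> is 0; splitting off
    \<open>i = 0\<close> then aligns the two sums for Pascal's rule.\<close>
  also have "\<dots> = (\<Sum>i\<le>Suc k. ?f i)" by simp
  also have "\<dots> = \<rho> ^ Suc k + (\<Sum>i\<le>k. ?f (Suc i))" by (subst sum.atMost_Suc_shift) simp
  finally have "\<rho> * binom_exp \<rho> k x + binom_exp_int \<rho> k x
      = \<rho> ^ Suc k + (\<Sum>i\<le>k. real (Suc k choose Suc i) * \<rho> ^ (k - i) * ?y (Suc i))"
    unfolding binom_exp_int_def by (simp add: sum.distrib[symmetric] distrib_right add_divide_distrib add.commute del: fact_Suc power_Suc)
  also have "\<dots> = binom_exp \<rho> (Suc k) x"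
    unfolding binom_exp_def by (subst sum.atMost_Suc_shift) simp
  finally show ?thesis by simp
qed

lemma binom_exp_int_deriv:
  "((\<lambda>x. binom_exp_int \<rho> k x) has_field_derivative binom_exp \<rho> k x) (at x within A)"
proof -
  have "((\<lambda>x. x ^ Suc i / fact (Suc i)) has_field_derivative x ^ i / fact i) (at x within A)" for i
    by (rule DERIV_cong[OF DERIV_cdivide[OF DERIV_pow]]) (simp del: of_nat_Suc)
  then show ?thesis
    unfolding binom_exp_int_def binom_exp_def by (intro DERIV_sum DERIV_cmult)
qed

text \<open>The substitution \<open>x = c * (T - s)\<close> supplies the factor \<open>c\<close>,
  and the antiderivative vanishes at \<open>s = T\<close>.\<close>

lemma binom_exp_has_integral:
  assumes "t \<le> T"
  shows "((\<lambda>s. c * binom_exp \<rho> k (c * (T - s))) has_integral binom_exp_int \<rho> k (c * (T - t))) {t..T}"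
proof -
  have "((\<lambda>s. - binom_exp_int \<rho> k (c * (T - s))) has_field_derivative c * binom_exp \<rho> k (c * (T - s))) (at s within {t..T})" for s
    by (rule DERIV_cong, rule DERIV_minus, rule DERIV_chain2[OF binom_exp_int_deriv])
      (auto intro!: derivative_eq_intros)
  then have "((\<lambda>s. c * binom_exp \<rho> k (c * (T - s))) has_integral
      - binom_exp_int \<rho> k (c * (T - T)) - (- binom_exp_int \<rho> k (c * (T - t)))) {t..T}"
    using assms by (intro fundamental_theorem_of_calculus) (auto simp: has_real_derivative_iff_has_vector_derivative)
  then show ?thesis by (simp add: binom_exp_int_def)
qed

lemma sum_1_eq_atMost: "(\<Sum>j=1..Suc k. f j) = (\<Sum>i\<le>k. f (Suc i))"
  for f :: "nat \<Rightarrow> 'a::comm_monoid_add"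
  by (rule sum.reindex_bij_witness[of _ Suc "\<lambda>j. j - 1"]) auto

text \<open>Both summation indices are lowered by one. With \<open>n = Suc m\<close> the error index
  \<open>n - k\<close> becomes \<open>m - k\<close>, and the argument \<open>Suc m\<close> stands
  for the bound on the control error of index \<open>m\<close>.\<close>

lemma Gamma_bound_eq:
  "Gamma_bound T c0 cs \<rho> e (Suc m) t
    = c_hat c0 \<rho> * (\<Sum>k<m. (e (m - k))\<^sup>2 * binom_exp \<rho> k (c_star_rho c0 cs \<rho> * (T - t)))"
proof -
  have "(\<Sum>k=1..m. (e (Suc m - k))\<^sup>2 * (\<Sum>j=1..k. real ((k - 1) choose (j - 1)) * \<rho> ^ (k - j) *
          (c_star_rho c0 cs \<rho> ^ (j - 1) * (T - t) ^ (j - 1) / fact (j - 1))))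
    = (\<Sum>k<m. (e (m - k))\<^sup>2 * (\<Sum>j=1..Suc k. real (k choose (j - 1)) * \<rho> ^ (Suc k - j) *
          (c_star_rho c0 cs \<rho> ^ (j - 1) * (T - t) ^ (j - 1) / fact (j - 1))))"
    by (rule sum.reindex_bij_witness[of _ Suc "\<lambda>k. k - 1"]) (auto simp: Suc_diff_le)
  then show ?thesis
    unfolding Gamma_bound_def sum_1_eq_atMost by (simp add: binom_exp_def power_mult_distrib)
qed

lemma Q_bound_eq:
  "Q_bound T c0 cs \<rho> e (Suc m) t
    = (\<Sum>k<m. (e (m - k))\<^sup>2 * binom_exp_int \<rho> k (c_star_rho c0 cs \<rho> * (T - t)))"
proof -
  have "(\<Sum>k=1..m. (e (Suc m - k))\<^sup>2 * (\<Sum>j=1..k. real ((k - 1) choose (j - 1)) * \<rho> ^ (k - j) *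
          (c_star_rho c0 cs \<rho> ^ j * (T - t) ^ j / fact j)))
    = (\<Sum>k<m. (e (m - k))\<^sup>2 * (\<Sum>j=1..Suc k. real (k choose (j - 1)) * \<rho> ^ (Suc k - j) *
          (c_star_rho c0 cs \<rho> ^ j * (T - t) ^ j / fact j)))"
    by (rule sum.reindex_bij_witness[of _ Suc "\<lambda>k. k - 1"]) (auto simp: Suc_diff_le)
  then show ?thesis
    unfolding Q_bound_def sum_1_eq_atMost by (simp add: binom_exp_int_def power_mult_distrib mult_ac)
qed

text \<open>Together with the integral formula that follows, this says that the two bounds solve the
  error recursion with equality. The newest error is the term \<open>k = 0\<close>, whose polynomial
  is 1; the other terms each gain a factor \<rho> + I.\<close>

lemma Gamma_bound_Suc:
  "Gamma_bound T c0 cs \<rho> e (Suc (Suc m)) t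
    = \<rho> * Gamma_bound T c0 cs \<rho> e (Suc m) t + c_hat c0 \<rho> * (Q_bound T c0 cs \<rho> e (Suc m) t + (e (Suc m))\<^sup>2)"
  unfolding Gamma_bound_eq Q_bound_eq
  by (subst sum.lessThan_Suc_shift) (simp add: binom_exp_Suc sum.distrib distrib_left sum_distrib_left algebra_simps)

lemma Gamma_bound_has_integral:
  assumes "t \<le> T"
  shows "((\<lambda>s. cs * Gamma_bound T c0 cs \<rho> e (Suc m) s) has_integral Q_bound T c0 cs \<rho> e (Suc m) t) {t..T}"
proof -
  have "((\<lambda>s. \<Sum>k<m. (e (m - k))\<^sup>2 * (c_star_rho c0 cs \<rho> * binom_exp \<rho> k (c_star_rho c0 cs \<rho> * (T - s))))
      has_integral Q_bound T c0 cs \<rho> e (Suc m) t) {t..T}"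
    unfolding Q_bound_eq by (intro has_integral_sum has_integral_mult_right binom_exp_has_integral assms) auto
  then show ?thesis
    unfolding Gamma_bound_eq by (simp add: sum_distrib_left c_star_rho_def mult_ac)
qed

section \<open>Explicit and uniform bounds for the error recursion\<close>

lemma c_hat_pos: "\<rho> < 1 \<Longrightarrow> 0 < c_hat c0 \<rho>"
  by (simp add: c_hat_def)

text \<open>Chosen for a supersolution with control part \<open>amplitude\<close> times the weight
  and value part the weight. The amplitude A satisfies \<rho> A + 2 \<open>c_hat\<close> = A, and
  the rate is \<open>cs\<close> times the amplitude, so that integrating the control part reproduces
  the weight.\<close>

definition growth_rate :: "real \<Rightarrow> real \<Rightarrow> real \<Rightarrow> real" where
  "growth_rate c0 cs \<rho> = 2 * c_star_rho c0 cs \<rho> / (1 - \<rho>)"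

definition amplitude :: "real \<Rightarrow> real \<Rightarrow> real" where
  "amplitude c0 \<rho> = 2 * c_hat c0 \<rho> / (1 - \<rho>)"

lemma growth_rate_pos: "\<rho> < 1 \<Longrightarrow> 0 < cs \<Longrightarrow> 0 < growth_rate c0 cs \<rho>"
  and amplitude_pos: "\<rho> < 1 \<Longrightarrow> 0 < amplitude c0 \<rho>"
  using c_hat_pos by (simp_all add: growth_rate_def amplitude_def c_star_rho_def)

text \<open>\<open>G n\<close> is the squared error of the n-th control and \<open>q n\<close> that
  of the n-th value function. The index shift in \<open>q_Suc\<close> reflects that the value with
  index n+1 answers the control with index n; \<open>G 0\<close> vanishes because both iterations
  start at the same control.\<close>

locale error_recursion =
  fixes T c0 cs \<rho> :: real and e :: "nat \<Rightarrow> real" and G q :: "nat \<Rightarrow> real \<Rightarrow> real"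
  assumes T_nonneg: "0 \<le> T" and cs_pos: "0 < cs" and \<rho>: "0 < \<rho>" "\<rho> < 1"
    and G_cont: "\<And>n. continuous_on {0..T} (G n)"
    and G_0: "\<And>t. t \<in> {0..T} \<Longrightarrow> G 0 t = 0"
    and G_Suc: "\<And>n t. t \<in> {0..T} \<Longrightarrow> G (Suc n) t \<le> \<rho> * G n t + c_hat c0 \<rho> * (q (Suc n) t + (e (Suc n))\<^sup>2)"
    and q_Suc: "\<And>n t. t \<in> {0..T} \<Longrightarrow> q (Suc n) t \<le> cs * integral {t..T} (G n)"
begin

lemma q_le:
  assumes "t \<in> {0..T}" "(f has_integral I) {t..T}" "\<And>s. s \<in> {t..T} \<Longrightarrow> cs * G n s \<le> f s"
  shows "q (Suc n) t \<le> I"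
proof -
  have "continuous_on {t..T} (G n)" by (rule continuous_on_subset[OF G_cont]) (use assms(1) in auto)
  then have "((\<lambda>s. cs * G n s) has_integral cs * integral {t..T} (G n)) {t..T}"
    by (intro has_integral_mult_right integrable_integral integrable_continuous_real)
  from has_integral_le[OF this assms(2,3)] q_Suc[OF assms(1), of n] show ?thesis by simp
qed

text \<open>The recursion is monotone, all its coefficients being nonnegative, so its solution with
  equality dominates every solution with inequality.\<close>

lemma explicit_bounds:
  assumes "t \<in> {0..T}"
  shows "G n t \<le> Gamma_bound T c0 cs \<rho> e (Suc n) t \<and> q (Suc n) t \<le> Q_bound T c0 cs \<rho> e (Suc n) t"
  using assms
proof (induction n arbitrary: t)
  case 0
  have "G 0 t \<le> Gamma_bound T c0 cs \<rho> e (Suc 0) t" if "t \<in> {0..T}" for t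
    using that by (simp add: G_0 Gamma_bound_eq)
  moreover from this have "q (Suc 0) t \<le> Q_bound T c0 cs \<rho> e (Suc 0) t"
    using 0 cs_pos by (intro q_le[OF 0 Gamma_bound_has_integral[of t T cs c0 \<rho> e 0]]) auto
  ultimately show ?case using 0 by blast
next
  case (Suc n)
  have step: "G (Suc n) t \<le> Gamma_bound T c0 cs \<rho> e (Suc (Suc n)) t" if t: "t \<in> {0..T}" for t
  proof -
    have "G (Suc n) t \<le> \<rho> * G n t + c_hat c0 \<rho> * (q (Suc n) t + (e (Suc n))\<^sup>2)" by (rule G_Suc[OF t])
    also have "\<dots> \<le> \<rho> * Gamma_bound T c0 cs \<rho> e (Suc n) t + c_hat c0 \<rho> * (Q_bound T c0 cs \<rho> e (Suc n) t + (e (Suc n))\<^sup>2)"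
      using Suc.IH[OF t] \<rho> less_imp_le[OF c_hat_pos[OF \<rho>(2)]] by (intro add_mono mult_left_mono) auto
    finally show ?thesis unfolding Gamma_bound_Suc .
  qed
  moreover from this have "q (Suc (Suc n)) t \<le> Q_bound T c0 cs \<rho> e (Suc (Suc n)) t"
    using Suc.prems cs_pos by (intro q_le[OF Suc.prems Gamma_bound_has_integral[of t T cs c0 \<rho> e "Suc n"]]) auto
  ultimately show ?case using Suc.prems by blast
qed

abbreviation "rate \<equiv> growth_rate c0 cs \<rho>"
abbreviation "amp \<equiv> amplitude c0 \<rho>"

lemma rate_pos: "0 < rate" and amp_pos: "0 < amp"
  using growth_rate_pos amplitude_pos \<rho> cs_pos by auto

text \<open>The weight \<open>exp (rate * (T - t))\<close> makes the integral term contribute at most \<open>(1 - \<rho>) / 2\<close>.\<close>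
lemma uniform_bounds:
  assumes e: "\<And>n. n \<ge> 1 \<Longrightarrow> (e n)\<^sup>2 \<le> E" and "t \<in> {0..T}"
  shows "G n t \<le> amp * exp (rate * (T - t)) * E \<and> q (Suc n) t \<le> exp (rate * (T - t)) * E"
  using assms(2)
proof (induction n arbitrary: t)
  have E: "0 \<le> E" using e[of 1] zero_le_power2[of "e 1"] by linarith
  have cs_amp: "cs * amp = rate" by (simp add: amplitude_def growth_rate_def c_star_rho_def)
  have int: "((\<lambda>s. rate * exp (rate * (T - s)) * E) has_integral (exp (rate * (T - t)) - 1) * E) {t..T}"
    if "t \<in> {0..T}" for t
  proof -
    have "((\<lambda>s. rate * exp (rate * (T - s)) * E) has_integral
        - exp (rate * (T - T)) * E - - exp (rate * (T - t)) * E) {t..T}"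
      using that by (intro fundamental_theorem_of_calculus)
        (auto intro!: derivative_eq_intros simp: has_real_derivative_iff_has_vector_derivative[symmetric])
    then show ?thesis by (simp add: algebra_simps)
  qed
  have q: "q (Suc n) t \<le> exp (rate * (T - t)) * E"
    if t: "t \<in> {0..T}" and G: "\<And>s. s \<in> {0..T} \<Longrightarrow> G n s \<le> amp * exp (rate * (T - s)) * E" for n t
  proof -
    have "q (Suc n) t \<le> (exp (rate * (T - t)) - 1) * E"
    proof (rule q_le[OF t int[OF t]])
      fix s assume "s \<in> {t..T}"
      then have "cs * G n s \<le> cs * (amp * exp (rate * (T - s)) * E)"
        using t cs_pos by (intro mult_left_mono G) auto
      then show "cs * G n s \<le> rate * exp (rate * (T - s)) * E"
        by (simp add: cs_amp[symmetric] mult.assoc)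
    qed
    also have "\<dots> \<le> exp (rate * (T - t)) * E" using E by (intro mult_right_mono) auto
    finally show ?thesis .
  qed
  have split: "G n t \<le> amp * exp (rate * (T - t)) * E \<and> q (Suc n) t \<le> exp (rate * (T - t)) * E"
    if "t \<in> {0..T}" "\<And>s. s \<in> {0..T} \<Longrightarrow> G n s \<le> amp * exp (rate * (T - s)) * E" for n t
    using that q by blast
  {
    case 0
    have "G 0 s \<le> amp * exp (rate * (T - s)) * E" if "s \<in> {0..T}" for s
      using that E amp_pos by (simp add: G_0)
    then show ?case by (rule split[OF 0])
  next
    case (Suc n)
    have "G (Suc n) s \<le> amp * exp (rate * (T - s)) * E" if s: "s \<in> {0..T}" for s
    proof -
      have x: "1 \<le> exp (rate * (T - s))" using s rate_pos by simp
      have half: "c_hat c0 \<rho> = amp * ((1 - \<rho>) / 2)" using \<rho> by (simp add: amplitude_def)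
      have eE: "(e (Suc n))\<^sup>2 \<le> E" using e by simp
      have qs: "q (Suc n) s + (e (Suc n))\<^sup>2 \<le> exp (rate * (T - s)) * E + E"
        using Suc.IH[OF s] eE by simp
      \<comment> \<open>The weight is at least 1, so the value error and the fresh error are both at
        most the weight times \<open>E\<close>; this is the factor 2 that \<open>amplitude\<close>
        absorbs.\<close>
      have E1: "E \<le> exp (rate * (T - s)) * E" using mult_right_mono[OF x E] by simp
      have "G (Suc n) s \<le> \<rho> * G n s + c_hat c0 \<rho> * (q (Suc n) s + (e (Suc n))\<^sup>2)" by (rule G_Suc[OF s])
      also have "\<dots> \<le> \<rho> * (amp * exp (rate * (T - s)) * E) + c_hat c0 \<rho> * (2 * (exp (rate * (T - s)) * E))"
        using Suc.IH[OF s] \<rho> less_imp_le[OF c_hat_pos[OF \<rho>(2)]] qs E1 by (intro add_mono mult_left_mono) auto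
      also have "\<dots> = amp * exp (rate * (T - s)) * E" unfolding half by (simp add: field_simps)
      finally show ?thesis .
    qed
    then show ?case by (rule split[OF Suc.prems])
  }
qed

end

section \<open>Stability and the perturbed iteration\<close>

lemma adm_convex_comb:
  fixes \<alpha> \<beta> :: "'d::finite field"
  assumes "\<alpha> \<in> adm N T" "\<beta> \<in> adm N T" "0 \<le> a" "0 \<le> b"
  shows "(\<lambda>t \<xi>. a *\<^sub>R \<alpha> t \<xi> + b *\<^sub>R \<beta> t \<xi>) \<in> adm N T"
proof -
  obtain A where A: "\<forall>\<xi>\<in>states N. A-lipschitz_on {0..T} (\<lambda>t. \<alpha> t \<xi>)" using assms(1) unfolding adm_def by blast
  obtain B where B: "\<forall>\<xi>\<in>states N. B-lipschitz_on {0..T} (\<lambda>t. \<beta> t \<xi>)" using assms(2) unfolding adm_def by blast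
  show ?thesis
  proof (rule admI[where K="\<bar>a\<bar> * A + \<bar>b\<bar> * B"])
    show "a *\<^sub>R \<alpha> t \<xi> + b *\<^sub>R \<beta> t \<xi> \<in> orthant (fst \<xi>)" if "t \<in> {0..T}" "\<xi> \<in> states N" for t and \<xi> :: "'d state"
      using assms that by (intro orthant_convex_comb adm_orthant)
    show "(\<bar>a\<bar> * A + \<bar>b\<bar> * B)-lipschitz_on {0..T} (\<lambda>t. a *\<^sub>R \<alpha> t \<xi> + b *\<^sub>R \<beta> t \<xi>)" if "\<xi> \<in> states N" for \<xi> :: "'d state"
      using A B that by (intro lipschitz_on_add lipschitz_on_cmult) auto
  qed
qed

lemma adm_cong:
  fixes \<alpha> \<beta> :: "'d::finite field"
  assumes "\<alpha> \<in> adm N T" "\<And>t \<xi>. t \<in> {0..T} \<Longrightarrow> \<xi> \<in> states N \<Longrightarrow> \<beta> t \<xi> = \<alpha> t \<xi>"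
  shows "\<beta> \<in> adm N T"
proof -
  obtain A where A: "\<forall>\<xi>\<in>states N. A-lipschitz_on {0..T} (\<lambda>t. \<alpha> t \<xi>)" using assms(1) unfolding adm_def by blast
  show ?thesis
  proof (rule admI[where K=A])
    show "\<beta> t \<xi> \<in> orthant (fst \<xi>)" if "t \<in> {0..T}" "\<xi> \<in> states N" for t and \<xi> :: "'d state"
      using adm_orthant[OF assms(1) that(2,1)] assms(2)[OF that] by simp
    show "A-lipschitz_on {0..T} (\<lambda>t. \<beta> t \<xi>)" if "\<xi> \<in> states N" for \<xi> :: "'d state"
      by (rule lipschitz_on_transform[OF bspec[OF A that]]) (use assms(2) that in auto)
  qed
qed

lemma snorm_le_norm_S:
  fixes \<alpha> :: "'d::finite field"
  assumes "\<alpha> \<in> adm N T" "t \<in> {0..T}"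
  shows "snorm N (\<alpha> t) \<le> norm_S N T \<alpha>"
proof -
  have "continuous_on {0..T} (\<lambda>t. snorm N (\<alpha> t))"
    by (rule snorm_continuous[OF adm_continuous[OF assms(1)]])
  then have "bdd_above ((\<lambda>t. snorm N (\<alpha> t)) ` {0..T})"
    by (intro bounded_imp_bdd_above compact_imp_bounded compact_continuous_image compact_Icc)
  then show ?thesis unfolding norm_S_def using assms(2) by (rule cSUP_upper2) simp
qed

text \<open>Nonnegativity of the variance: the square of \<open>f\<close> minus its mean
  \<open>c\<close> has nonnegative integral.\<close>

lemma integral_cauchy_schwarz:
  fixes f :: "real \<Rightarrow> real"
  assumes "t \<le> T" "continuous_on {t..T} f"
  shows "(integral {t..T} f)\<^sup>2 \<le> (T - t) * integral {t..T} (\<lambda>s. (f s)\<^sup>2)"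
proof (cases "t = T")
  case False
  define I where "I = integral {t..T} f"
  define c where "c = I / (T - t)"
  have "(f has_integral I) {t..T}" unfolding I_def
    by (intro integrable_integral integrable_continuous_real assms)
  moreover have "((\<lambda>s. (f s)\<^sup>2) has_integral integral {t..T} (\<lambda>s. (f s)\<^sup>2)) {t..T}"
    by (intro integrable_integral integrable_continuous_real continuous_on_power assms)
  moreover have "((\<lambda>s. c\<^sup>2) has_integral (T - t) * c\<^sup>2) {t..T}"
    using has_integral_const_real[of "c\<^sup>2" t T] assms(1) by simp
  ultimately have "((\<lambda>s. (f s)\<^sup>2 - 2 * c * f s + c\<^sup>2) has_integral
      integral {t..T} (\<lambda>s. (f s)\<^sup>2) - 2 * c * I + (T - t) * c\<^sup>2) {t..T}"
    by (intro has_integral_add has_integral_diff has_integral_mult_right)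
  moreover have "0 \<le> (f s)\<^sup>2 - 2 * c * f s + c\<^sup>2" for s
    using zero_le_power2[of "f s - c"] by (simp add: power2_diff algebra_simps)
  ultimately have "0 \<le> integral {t..T} (\<lambda>s. (f s)\<^sup>2) - 2 * c * I + (T - t) * c\<^sup>2"
    by (rule has_integral_nonneg)
  moreover have "2 * c * I - (T - t) * c\<^sup>2 = I\<^sup>2 / (T - t)"
    using False by (simp add: c_def power2_eq_square)
  ultimately have "I\<^sup>2 / (T - t) \<le> integral {t..T} (\<lambda>s. (f s)\<^sup>2)" by linarith
  then show ?thesis using False assms(1) by (simp add: I_def field_simps)
qed simp

text \<open>The gap between the two sides is exactly \<rho> (1 - \<rho>) times the squared distance
  of \<open>a\<close> and \<open>b\<close>.\<close>

lemma sq_norm_convex_comb: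
  fixes a b :: "'a::real_inner"
  assumes "0 \<le> \<rho>" "\<rho> \<le> 1"
  shows "(norm (\<rho> *\<^sub>R a + (1 - \<rho>) *\<^sub>R b))\<^sup>2 \<le> \<rho> * (norm a)\<^sup>2 + (1 - \<rho>) * (norm b)\<^sup>2"
proof -
  have "\<rho> * (norm a)\<^sup>2 + (1 - \<rho>) * (norm b)\<^sup>2 - (norm (\<rho> *\<^sub>R a + (1 - \<rho>) *\<^sub>R b))\<^sup>2 = \<rho> * (1 - \<rho>) * (norm (a - b))\<^sup>2"
    unfolding power2_norm_eq_inner by (simp add: inner_add inner_diff inner_commute algebra_simps power2_eq_square)
  moreover have "0 \<le> \<rho> * (1 - \<rho>) * (norm (a - b))\<^sup>2" using assms by simp
  ultimately show ?thesis by linarith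
qed

lemma sq_norm_add_le: "(norm (a + b))\<^sup>2 \<le> 2 * (norm a)\<^sup>2 + 2 * (norm b)\<^sup>2"
  for a b :: "'a::real_normed_vector"
proof -
  have "(norm (a + b))\<^sup>2 \<le> (norm a + norm b)\<^sup>2" by (intro power_mono norm_triangle_ineq) simp
  also have "\<dots> \<le> 2 * (norm a)\<^sup>2 + 2 * (norm b)\<^sup>2"
    using zero_le_power2[of "norm a - norm b"] by (simp add: power2_sum power2_diff)
  finally show ?thesis .
qed

text \<open>Convexity of the squared norm leaves the coefficient \<rho> < 1 on the old error; the
  factor 2 lost in splitting a sum falls on the new terms only. This is the origin of 2(1-\<rho>) in
  \<open>c_hat\<close>.\<close>

lemma snorm_sq_step:
  fixes x y z :: "'d::finite state \<Rightarrow> 'b::real_inner"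
  assumes "0 \<le> \<rho>" "\<rho> \<le> 1"
  shows "(snorm N (\<lambda>\<xi>. \<rho> *\<^sub>R x \<xi> + (1 - \<rho>) *\<^sub>R (y \<xi> + z \<xi>)))\<^sup>2
    \<le> \<rho> * (snorm N x)\<^sup>2 + 2 * (1 - \<rho>) * ((snorm N y)\<^sup>2 + (snorm N z)\<^sup>2)"
proof -
  have "(norm (\<rho> *\<^sub>R x \<xi> + (1 - \<rho>) *\<^sub>R (y \<xi> + z \<xi>)))\<^sup>2
      \<le> \<rho> * (norm (x \<xi>))\<^sup>2 + 2 * (1 - \<rho>) * ((norm (y \<xi>))\<^sup>2 + (norm (z \<xi>))\<^sup>2)" for \<xi>
  proof -
    have "(1 - \<rho>) * (norm (y \<xi> + z \<xi>))\<^sup>2 \<le> (1 - \<rho>) * (2 * (norm (y \<xi>))\<^sup>2 + 2 * (norm (z \<xi>))\<^sup>2)"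
      using assms by (intro mult_left_mono sq_norm_add_le) auto
    then show ?thesis using sq_norm_convex_comb[OF assms, of "x \<xi>" "y \<xi> + z \<xi>"] by (simp add: algebra_simps)
  qed
  then have "(snorm N (\<lambda>\<xi>. \<rho> *\<^sub>R x \<xi> + (1 - \<rho>) *\<^sub>R (y \<xi> + z \<xi>)))\<^sup>2
    \<le> (\<Sum>\<xi>\<in>states N. \<rho> * (norm (x \<xi>))\<^sup>2 + 2 * (1 - \<rho>) * ((norm (y \<xi>))\<^sup>2 + (norm (z \<xi>))\<^sup>2))"
    unfolding snorm_sq by (intro sum_mono)
  also have "\<dots> = \<rho> * (snorm N x)\<^sup>2 + 2 * (1 - \<rho>) * ((snorm N y)\<^sup>2 + (snorm N z)\<^sup>2)"
    unfolding snorm_sq by (simp add: sum.distrib sum_distrib_left[symmetric])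
  finally show ?thesis .
qed

section \<open>Stability of the value function in the mean field control\<close>

context mfg_data
begin

definition gen_gap_const :: real where
  "gen_gap_const = real (card {(y, z :: 'd). y \<noteq> z}) * (real N * lam1_sum * value_bound)"

lemma value_bound_nonneg: "0 \<le> value_bound"
  unfolding value_bound_def using T_pos l0_sum_nonneg g_nonneg by (intro add_nonneg_nonneg sum_nonneg) auto

lemma lam1_le: "\<xi> \<in> states N \<Longrightarrow> lam1 \<xi> $ y \<le> lam1_sum"
proof -
  assume \<xi>: "\<xi> \<in> states N"
  have "lam1 \<xi> $ y \<le> (\<Sum>y\<in>UNIV. lam1 \<xi> $ y)"
    using lam_nonneg[OF \<xi>] by (intro member_le_sum) auto
  also have "\<dots> \<le> lam1_sum" unfolding lam1_sum_def
    using \<xi> lam_nonneg by (intro member_le_sum[of _ _ "\<lambda>\<xi>. \<Sum>y\<in>UNIV. lam1 \<xi> $ y"]) (auto intro!: sum_nonneg)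
  finally show ?thesis .
qed

text \<open>The rates \<open>lam0\<close> cancel, so each ordered pair contributes at most
  \<open>N\<close> particles, a rate \<open>lam1\<close>, a component of the control difference and
  a jump of \<phi> of size at most \<open>value_bound\<close>. \<open>gen_gap_const\<close> counts
  the pairs.\<close>

lemma L_mu_diff_le:
  assumes \<xi>: "\<xi> \<in> states N" and \<phi>: "\<And>\<eta>. \<eta> \<in> states N \<Longrightarrow> 0 \<le> \<phi> \<eta> \<and> \<phi> \<eta> \<le> value_bound"
  shows "\<bar>L_mu \<beta> \<phi> s \<xi> - L_mu \<beta>' \<phi> s \<xi>\<bar> \<le> gen_gap_const * snorm N (\<lambda>\<eta>. \<beta> s \<eta> - \<beta>' s \<eta>)"
proof -
  obtain x \<mu> where xi: "\<xi> = (x, \<mu>)" by (cases \<xi>)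
  have \<mu>: "\<mu> \<in> emp_measures N" using \<xi> by (simp add: xi states_def)
  let ?I = "{(y, z :: 'd). y \<noteq> z}" and ?n = "snorm N (\<lambda>\<eta>. \<beta> s \<eta> - \<beta>' s \<eta>)"
  let ?\<eta> = "\<lambda>z. (z, \<mu> + unit_shift N x z)"
  let ?d = "\<lambda>(y, z). real N * \<mu> $ z * (lam1 (?\<eta> z) $ y * (\<beta> s (?\<eta> z) - \<beta>' s (?\<eta> z)) $ y)
      * (\<phi> (x, \<mu> + unit_shift N y z) - \<phi> (x, \<mu>))"
  have "L_mu \<beta> \<phi> s \<xi> - L_mu \<beta>' \<phi> s \<xi> = (\<Sum>p\<in>?I. ?d p)"
    unfolding xi gen_mu_def prod.case sum_subtractf[symmetric]
    by (rule sum.cong) (auto simp: algebra_simps)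
  moreover have "\<bar>?d p\<bar> \<le> real N * lam1_sum * value_bound * ?n" for p
  proof (cases p)
    case (Pair y z)
    show ?thesis
    proof (cases "\<mu> $ z = 0")
      case True
      then show ?thesis using Pair lam_sum_nonneg value_bound_nonneg by simp
    next
      case False
      have sh: "?\<eta> z \<in> states N" "(x, \<mu> + unit_shift N y z) \<in> states N"
        using emp_measures_shift[OF N_pos \<mu> False] by (auto simp: states_def)
      have "\<bar>(\<beta> s (?\<eta> z) - \<beta>' s (?\<eta> z)) $ y\<bar> \<le> ?n"
        using component_le_norm_cart norm_le_snorm[OF sh(1)] by (rule order_trans)
      then have 1: "\<bar>lam1 (?\<eta> z) $ y * (\<beta> s (?\<eta> z) - \<beta>' s (?\<eta> z)) $ y\<bar> \<le> lam1_sum * ?n"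
        using lam1_le[OF sh(1)] lam_nonneg[OF sh(1)] lam_sum_nonneg unfolding abs_mult by (intro mult_mono) auto
      have 2: "\<bar>\<phi> (x, \<mu> + unit_shift N y z) - \<phi> (x, \<mu>)\<bar> \<le> value_bound"
        using \<phi>[OF sh(2)] \<phi>[OF \<xi>] by (auto simp: xi)
      have 3: "\<bar>real N * \<mu> $ z\<bar> \<le> real N" using emp_measures_component[OF \<mu>, of z] by (simp add: abs_mult mult_left_le)
      have "\<bar>?d p\<bar> = \<bar>real N * \<mu> $ z\<bar> * \<bar>lam1 (?\<eta> z) $ y * (\<beta> s (?\<eta> z) - \<beta>' s (?\<eta> z)) $ y\<bar>
          * \<bar>\<phi> (x, \<mu> + unit_shift N y z) - \<phi> (x, \<mu>)\<bar>" by (simp add: Pair abs_mult)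
      also have "\<dots> \<le> real N * (lam1_sum * ?n) * value_bound"
        using lam_sum_nonneg by (intro mult_mono 1 2 3) auto
      finally show ?thesis by (simp add: mult_ac)
    qed
  qed
  then have "\<bar>\<Sum>p\<in>?I. ?d p\<bar> \<le> (\<Sum>p\<in>?I. real N * lam1_sum * value_bound * ?n)"
    by (intro order_trans[OF sum_abs] sum_mono)
  ultimately show ?thesis by (simp add: gen_gap_const_def mult.assoc)
qed

text \<open>The cardinality comes from summing over the states, the square from squaring the
  generator gap, and \<open>T\<close> bounds the factor \<open>T - t\<close> of the Cauchy-Schwarz
  inequality. The added 1 ensures positivity.\<close>

definition stability_const :: real where
  "stability_const = real (card (states N :: 'd state set)) * gen_gap_const\<^sup>2 * T + 1"

lemma stability_const_pos: "0 < stability_const"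
  unfolding stability_const_def using T_pos by (intro add_nonneg_pos mult_nonneg_nonneg) auto

end

context mfg_chain
begin

abbreviation (input) "br \<equiv> best_response N T lam0 lam1 l g Xi P"

lemma best_response_adm:
  assumes "\<beta> \<in> adm N T"
  shows "br \<beta> \<in> adm N T"
proof (rule hjb[OF assms])
  fix u assume u: "(\<lambda>t \<xi>. hat \<xi> (state_Delta (u t) \<xi>)) \<in> adm N T"
    and val: "\<And>\<xi> s. \<xi> \<in> states N \<Longrightarrow> s \<in> {0..T} \<Longrightarrow> v \<beta> s \<xi> = u s \<xi>"
  show ?thesis
  proof (rule adm_cong[OF u])
    fix t and \<xi> :: "'d state" assume "t \<in> {0..T}" "\<xi> \<in> states N"
    then show "br \<beta> t \<xi> = hat \<xi> (state_Delta (u t) \<xi>)"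
      unfolding best_response_eq using val by (subst state_Delta_cong[of \<xi> N "v \<beta> t" "u t"]) auto
  qed
qed

text \<open>Playing the best response to \<open>\<beta>'\<close> against \<open>\<beta>\<close> costs at most \<open>v \<beta>'\<close> plus the accumulated
  difference of the two mean field generators applied to \<open>v \<beta>'\<close>.\<close>
lemma value_gap:
  assumes "\<beta> \<in> adm N T" "\<beta>' \<in> adm N T" "t \<in> {0..T}" "\<xi> \<in> states N"
  shows "v \<beta> t \<xi> - v \<beta>' t \<xi> \<le> gen_gap_const * integral {t..T} (\<lambda>s. snorm N (\<lambda>\<eta>. \<beta> s \<eta> - \<beta>' s \<eta>))"
proof -
  obtain u where low: "\<And>\<xi> s \<alpha>. \<xi> \<in> states N \<Longrightarrow> s \<in> {0..T} \<Longrightarrow> \<alpha> \<in> adm N T \<Longrightarrow> u s \<xi> \<le> J s \<xi> \<alpha> \<beta>"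
    and u: "\<And>\<xi> s. \<xi> \<in> states N \<Longrightarrow> s \<in> {0..T} \<Longrightarrow> v \<beta> s \<xi> = u s \<xi>"
    by (rule hjb[OF assms(1)]) (rule that, assumption+)
  obtain w where wT: "\<And>\<xi>. \<xi> \<in> states N \<Longrightarrow> w T \<xi> = g \<xi>"
    and w': "\<And>\<xi> s. \<xi> \<in> states N \<Longrightarrow> s \<in> {0..T} \<Longrightarrow> ((\<lambda>s. w s \<xi>) has_field_derivative
      - (ham \<xi> (state_Delta (w s) \<xi>) (hat \<xi> (state_Delta (w s) \<xi>)) + L_mu \<beta>' (w s) s \<xi>)) (at s within {0..T})"
    and wb: "\<And>\<xi> s. \<xi> \<in> states N \<Longrightarrow> s \<in> {0..T} \<Longrightarrow> 0 \<le> w s \<xi> \<and> w s \<xi> \<le> value_bound"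
    and \<alpha>: "(\<lambda>t \<xi>. hat \<xi> (state_Delta (w t) \<xi>)) \<in> adm N T"
    and w: "\<And>\<xi> s. \<xi> \<in> states N \<Longrightarrow> s \<in> {0..T} \<Longrightarrow> v \<beta>' s \<xi> = w s \<xi>"
    by (rule hjb[OF assms(2)]) (rule that, assumption+)
  let ?b = "\<lambda>s. gen_gap_const * snorm N (\<lambda>\<eta>. \<beta> s \<eta> - \<beta>' s \<eta>)"
  have "continuous_on {0..T} ?b"
    by (intro continuous_on_mult continuous_on_const snorm_continuous continuous_on_diff adm_continuous[OF assms(1)] adm_continuous[OF assms(2)])
  then have b: "continuous_on {t..T} ?b" using assms(3) by (elim continuous_on_subset) auto
  have "J t \<xi> (\<lambda>t \<xi>. hat \<xi> (state_Delta (w t) \<xi>)) \<beta> \<le> w t \<xi> + integral {t..T} ?b"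
  proof (rule verification(1)[OF \<alpha> assms(1,3,4) w' wT b])
    fix s and \<eta> :: "'d state" assume s: "s \<in> {t..T}" and \<eta>: "\<eta> \<in> states N"
    have "s \<in> {0..T}" using s assms(3) by auto
    then have "\<bar>L_mu \<beta> (w s) s \<eta> - L_mu \<beta>' (w s) s \<eta>\<bar> \<le> ?b s"
      by (intro L_mu_diff_le \<eta> wb)
    \<comment> \<open>The Hamiltonian terms cancel because the control played is the very minimiser
      in the equation of \<open>w\<close>; only the mean field part sees that \<beta> has replaced
      \<beta>'.\<close>
    then show "ham \<eta> (state_Delta (w s) \<eta>) (hat \<eta> (state_Delta (w s) \<eta>)) + L_mu \<beta> (w s) s \<eta>
        + - (ham \<eta> (state_Delta (w s) \<eta>) (hat \<eta> (state_Delta (w s) \<eta>)) + L_mu \<beta>' (w s) s \<eta>) \<le> ?b s"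
      by linarith
  qed
  with low[OF assms(4,3) \<alpha>] show ?thesis
    using u[OF assms(4,3)] w[OF assms(4,3)] by simp
qed

text \<open>The one-sided gap, used for both orders of the two controls, bounds the absolute value;
  Cauchy-Schwarz in time then turns it into an estimate of squares.\<close>

lemma value_stability:
  assumes "\<beta> \<in> adm N T" "\<beta>' \<in> adm N T" "t \<in> {0..T}"
  shows "(snorm N (\<lambda>\<xi>. v \<beta> t \<xi> - v \<beta>' t \<xi>))\<^sup>2 \<le> stability_const * integral {t..T} (\<lambda>s. (snorm N (\<lambda>\<xi>. \<beta>' s \<xi> - \<beta> s \<xi>))\<^sup>2)"
proof -
  let ?n = "\<lambda>s. snorm N (\<lambda>\<xi>. \<beta>' s \<xi> - \<beta> s \<xi>)"
  have sym: "snorm N (\<lambda>\<xi>. \<beta> s \<xi> - \<beta>' s \<xi>) = ?n s" for s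
    unfolding snorm_def by (simp add: norm_minus_commute)
  have "continuous_on {0..T} ?n"
    by (intro snorm_continuous continuous_on_diff adm_continuous[OF assms(1)] adm_continuous[OF assms(2)])
  then have c: "continuous_on {t..T} ?n" using assms(3) by (elim continuous_on_subset) auto
  let ?I = "integral {t..T} ?n" and ?Q = "integral {t..T} (\<lambda>s. (?n s)\<^sup>2)"
  have Q: "0 \<le> ?Q" by (intro integral_nonneg integrable_continuous_real continuous_on_power c) auto
  have "(norm (v \<beta> t \<xi> - v \<beta>' t \<xi>))\<^sup>2 \<le> gen_gap_const\<^sup>2 * T * ?Q" if "\<xi> \<in> states N" for \<xi>
  proof -
    have "\<bar>v \<beta> t \<xi> - v \<beta>' t \<xi>\<bar> \<le> gen_gap_const * ?I"
      using value_gap[OF assms that] value_gap[OF assms(2,1,3) that] sym by simp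
    then have "(norm (v \<beta> t \<xi> - v \<beta>' t \<xi>))\<^sup>2 \<le> (gen_gap_const * ?I)\<^sup>2"
      by (intro power_mono) auto
    also have "\<dots> = gen_gap_const\<^sup>2 * ?I\<^sup>2" by (rule power_mult_distrib)
    also have "\<dots> \<le> gen_gap_const\<^sup>2 * ((T - t) * ?Q)"
      using assms(3) by (intro mult_left_mono integral_cauchy_schwarz c) auto
    also have "\<dots> \<le> gen_gap_const\<^sup>2 * (T * ?Q)"
      using assms(3) Q by (intro mult_left_mono mult_right_mono) auto
    finally show ?thesis by (simp add: mult.assoc)
  qed
  then have "(snorm N (\<lambda>\<xi>. v \<beta> t \<xi> - v \<beta>' t \<xi>))\<^sup>2 \<le> (\<Sum>\<xi>\<in>(states N :: 'd state set). gen_gap_const\<^sup>2 * T * ?Q)"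
    unfolding snorm_sq by (intro sum_mono)
  also have "\<dots> \<le> stability_const * ?Q"
    using Q by (simp add: stability_const_def algebra_simps)
  finally show ?thesis .
qed

lemma best_response_stability:
  "snorm N (\<lambda>\<xi>. br \<beta> t \<xi> - br \<beta>' t \<xi>) \<le> best_response_const * snorm N (\<lambda>\<xi>. v \<beta> t \<xi> - v \<beta>' t \<xi>)"
  using best_response_lipschitz[of "v \<beta> t" "v \<beta>' t"] by (simp add: best_response_def case_prod_unfold)

lemma play_adm:
  assumes "0 \<le> \<rho>" "\<rho> \<le> 1" "\<beta>0 \<in> adm N T"
  shows "play br \<rho> \<beta>0 n \<in> adm N T"
proof (induction n)
  case (Suc n)
  then show ?case using assms by (auto intro!: adm_convex_comb best_response_adm)
qed (use assms in simp)

lemma perturbed_play_adm: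
  assumes "0 \<le> \<rho>" "\<rho> \<le> 1" "\<beta>0 \<in> adm N T" "\<And>n. n \<ge> 1 \<Longrightarrow> \<epsilon> n \<in> adm N T"
  shows "perturbed_play br \<rho> \<epsilon> \<beta>0 n \<in> adm N T"
proof (induction n)
  case (Suc n)
  \<comment> \<open>Admissible controls form a convex cone, so adding an error of any size preserves
    admissibility.\<close>
  have "(\<lambda>t \<xi>. 1 *\<^sub>R br (perturbed_play br \<rho> \<epsilon> \<beta>0 n) t \<xi> + 1 *\<^sub>R \<epsilon> (Suc n) t \<xi>) \<in> adm N T"
    using Suc assms(4) by (intro adm_convex_comb best_response_adm) auto
  then show ?case using adm_convex_comb[OF Suc _ assms(1), of _ "1 - \<rho>"] assms(2) by simp
qed (use assms in simp)

text \<open>The difference of the two updates is a convex combination of the old difference and of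
  the change of best response plus the error, so \<open>snorm_sq_step\<close> and the two stability
  estimates give the recursion.\<close>

lemma play_error_recursion:
  assumes \<rho>: "0 < \<rho>" "\<rho> < 1" and "\<beta>0 \<in> adm N T" and \<epsilon>: "\<And>n. n \<ge> 1 \<Longrightarrow> \<epsilon> n \<in> adm N T"
  shows "error_recursion T best_response_const stability_const \<rho> (\<lambda>m. norm_S N T (\<epsilon> m))
    (gamma_err N br \<rho> \<epsilon> \<beta>0) (q_err N v br \<rho> \<epsilon> \<beta>0)"
proof
  let ?p = "play br \<rho> \<beta>0" and ?pp = "perturbed_play br \<rho> \<epsilon> \<beta>0"
  have p: "?p n \<in> adm N T" for n using \<rho> assms(3) by (intro play_adm) auto
  have pp: "?pp n \<in> adm N T" for n using \<rho> assms(3) \<epsilon> by (intro perturbed_play_adm) auto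
  show "continuous_on {0..T} (gamma_err N br \<rho> \<epsilon> \<beta>0 n)" for n
    unfolding gamma_err_def
    by (intro continuous_on_power snorm_continuous continuous_on_diff adm_continuous[OF p] adm_continuous[OF pp])
  show "gamma_err N br \<rho> \<epsilon> \<beta>0 0 t = 0" for t
    by (simp add: gamma_err_def snorm_def)
  show "q_err N v br \<rho> \<epsilon> \<beta>0 (Suc n) t \<le> stability_const * integral {t..T} (gamma_err N br \<rho> \<epsilon> \<beta>0 n)"
    if t: "t \<in> {0..T}" for n t
  proof -
    have "snorm N (\<lambda>\<xi>. ?p n s \<xi> - ?pp n s \<xi>) = snorm N (\<lambda>\<xi>. ?pp n s \<xi> - ?p n s \<xi>)" for s
      unfolding snorm_def by (simp add: norm_minus_commute)
    then show ?thesis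
      using value_stability[OF pp[of n] p[of n] t] by (simp add: q_err_def gamma_err_def[abs_def])
  qed
  show "gamma_err N br \<rho> \<epsilon> \<beta>0 (Suc n) t \<le> \<rho> * gamma_err N br \<rho> \<epsilon> \<beta>0 n t
      + c_hat best_response_const \<rho> * (q_err N v br \<rho> \<epsilon> \<beta>0 (Suc n) t + (norm_S N T (\<epsilon> (Suc n)))\<^sup>2)"
    if t: "t \<in> {0..T}" for n t
  proof -
    let ?y = "\<lambda>\<xi>. br (?pp n) t \<xi> - br (?p n) t \<xi>" and ?c = "max (best_response_const\<^sup>2) 1"
    let ?q = "q_err N v br \<rho> \<epsilon> \<beta>0 (Suc n) t" and ?e = "norm_S N T (\<epsilon> (Suc n))"
    have "gamma_err N br \<rho> \<epsilon> \<beta>0 (Suc n) t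
      = (snorm N (\<lambda>\<xi>. \<rho> *\<^sub>R (?pp n t \<xi> - ?p n t \<xi>) + (1 - \<rho>) *\<^sub>R (?y \<xi> + \<epsilon> (Suc n) t \<xi>)))\<^sup>2"
      unfolding gamma_err_def by (simp add: algebra_simps)
    also have "\<dots> \<le> \<rho> * gamma_err N br \<rho> \<epsilon> \<beta>0 n t + 2 * (1 - \<rho>) * ((snorm N ?y)\<^sup>2 + (snorm N (\<epsilon> (Suc n) t))\<^sup>2)"
      unfolding gamma_err_def using \<rho> by (intro snorm_sq_step) auto
    \<comment> \<open>The maximum with 1 lets value error and fresh error share one coefficient, as
      in \<open>c_hat\<close>.\<close>
    also have "\<dots> \<le> \<rho> * gamma_err N br \<rho> \<epsilon> \<beta>0 n t + 2 * (1 - \<rho>) * (?c * ?q + ?c * ?e\<^sup>2)"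
    proof (intro add_left_mono mult_left_mono add_mono)
      have "(snorm N ?y)\<^sup>2 \<le> best_response_const\<^sup>2 * ?q"
        unfolding q_err_def power_mult_distrib[symmetric]
        using best_response_stability[of "?pp n" t "?p n"] by (intro power_mono) auto
      also have "\<dots> \<le> ?c * ?q" by (intro mult_right_mono) (auto simp: q_err_def)
      finally show "(snorm N ?y)\<^sup>2 \<le> ?c * ?q" .
      have "(snorm N (\<epsilon> (Suc n) t))\<^sup>2 \<le> 1 * ?e\<^sup>2"
        using snorm_le_norm_S[OF \<epsilon> t, of "Suc n"] by (auto intro: power_mono)
      also have "\<dots> \<le> ?c * ?e\<^sup>2" by (intro mult_right_mono) auto
      finally show "(snorm N (\<epsilon> (Suc n) t))\<^sup>2 \<le> ?c * ?e\<^sup>2" .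
    qed (use \<rho> in auto)
    finally show ?thesis by (simp add: c_hat_def algebra_simps)
  qed
qed (use T_pos stability_const_pos \<rho> in auto)

lemma explicit_error_bounds:
  assumes "0 < \<rho>" "\<rho> < 1" "\<beta>0 \<in> adm N T" "\<And>n. n \<ge> 1 \<Longrightarrow> \<epsilon> n \<in> adm N T" "n \<ge> 2" "t \<in> {0..T}"
  shows "gamma_err N br \<rho> \<epsilon> \<beta>0 (n - 1) t
      \<le> Gamma_bound T best_response_const stability_const \<rho> (\<lambda>m. norm_S N T (\<epsilon> m)) n t"
    and "q_err N v br \<rho> \<epsilon> \<beta>0 n t
      \<le> Q_bound T best_response_const stability_const \<rho> (\<lambda>m. norm_S N T (\<epsilon> m)) n t"
  using error_recursion.explicit_bounds[OF play_error_recursion[OF assms(1-4)] assms(6), where n="n - 1"] assms(5)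
  by auto

text \<open>Extended reals allow an unbounded sequence of errors; then the right-hand side is
  infinite because the constant is positive. In the finite case the supremum serves as
  \<open>E\<close>, and the time weight is largest at \<open>t = 0\<close>.\<close>

lemma uniform_error_bound:
  assumes \<rho>: "0 < \<rho>" "\<rho> < 1" and \<beta>0: "\<beta>0 \<in> adm N T" and \<epsilon>: "\<And>n. n \<ge> 1 \<Longrightarrow> \<epsilon> n \<in> adm N T"
  defines "r \<equiv> growth_rate best_response_const stability_const \<rho>" and "a \<equiv> amplitude best_response_const \<rho>"
  shows "(SUP n\<in>{1..}. ereal ((SUP t\<in>{0..T}. \<bar>gamma_err N br \<rho> \<epsilon> \<beta>0 n t\<bar>)
        + (SUP t\<in>{0..T}. \<bar>q_err N v br \<rho> \<epsilon> \<beta>0 n t\<bar>)))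
    \<le> ereal ((a + 1) * exp (r * T)) * (SUP n\<in>{1..}. ereal ((norm_S N T (\<epsilon> n))\<^sup>2))"
    (is "?lhs \<le> ereal ?c * ?E")
proof -
  interpret error_recursion T best_response_const stability_const \<rho> "\<lambda>m. norm_S N T (\<epsilon> m)"
    "gamma_err N br \<rho> \<epsilon> \<beta>0" "q_err N v br \<rho> \<epsilon> \<beta>0"
    by (rule play_error_recursion[OF \<rho> \<beta>0 \<epsilon>])
  have a: "0 < a" and r: "0 < r" using amp_pos rate_pos by (simp_all add: a_def r_def)
  then have c: "0 < ?c" by (simp add: add_pos_pos)
  have ge: "ereal ((norm_S N T (\<epsilon> n))\<^sup>2) \<le> ?E" if "n \<ge> 1" for n
    using that by (intro SUP_upper) auto
  show ?thesis
  proof (cases ?E)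
    case (real E)
    have e: "(norm_S N T (\<epsilon> n))\<^sup>2 \<le> E" if "n \<ge> 1" for n using ge[OF that] real by simp
    have E: "0 \<le> E" using e[of 1] zero_le_power2[of "norm_S N T (\<epsilon> 1)"] by linarith
    have "(SUP t\<in>{0..T}. \<bar>gamma_err N br \<rho> \<epsilon> \<beta>0 n t\<bar>) + (SUP t\<in>{0..T}. \<bar>q_err N v br \<rho> \<epsilon> \<beta>0 n t\<bar>) \<le> ?c * E"
      if n: "n \<ge> 1" for n
    proof -
      have w: "exp (r * (T - t)) * E \<le> exp (r * T) * E" if "t \<in> {0..T}" for t
        using that r E by (intro mult_right_mono) auto
      have "\<bar>gamma_err N br \<rho> \<epsilon> \<beta>0 n t\<bar> \<le> a * (exp (r * T) * E)" if t: "t \<in> {0..T}" for t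
      proof -
        have "gamma_err N br \<rho> \<epsilon> \<beta>0 n t \<le> a * (exp (r * (T - t)) * E)"
          using uniform_bounds[OF e t, of n] by (simp add: a_def r_def mult.assoc)
        also have "\<dots> \<le> a * (exp (r * T) * E)" using a w[OF t] by (intro mult_left_mono) auto
        finally show ?thesis by (simp add: gamma_err_def)
      qed
      then have 1: "(SUP t\<in>{0..T}. \<bar>gamma_err N br \<rho> \<epsilon> \<beta>0 n t\<bar>) \<le> a * (exp (r * T) * E)"
        using T_pos by (intro cSUP_least) auto
      have "\<bar>q_err N v br \<rho> \<epsilon> \<beta>0 n t\<bar> \<le> exp (r * T) * E" if t: "t \<in> {0..T}" for t
      proof -
        have "q_err N v br \<rho> \<epsilon> \<beta>0 n t \<le> exp (r * (T - t)) * E"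
          using uniform_bounds[OF e t, of "n - 1"] n by (simp add: r_def)
        then show ?thesis using w[OF t] by (simp add: q_err_def)
      qed
      then have 2: "(SUP t\<in>{0..T}. \<bar>q_err N v br \<rho> \<epsilon> \<beta>0 n t\<bar>) \<le> exp (r * T) * E"
        using T_pos by (intro cSUP_least) auto
      from 1 2 show ?thesis by (simp add: algebra_simps)
    qed
    then have "?lhs \<le> ereal (?c * E)" by (intro SUP_least) auto
    then show ?thesis by (simp only: real times_ereal.simps)
  next
    case PInf
    have "ereal C * \<infinity> = \<infinity>" if "0 < C" for C using that by simp
    from this[OF c] show ?thesis unfolding PInf by (simp only: ereal_less_eq)
  next
    case MInf
    then show ?thesis using ge[of 1] by simp
  qed
qed

end

theorem theorem5p1:
  fixes N :: nat and T ca :: real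
    and lam0 lam1 :: "'d::finite state \<Rightarrow> real ^ 'd"
    and l :: "'d state \<Rightarrow> real ^ 'd \<Rightarrow> real"
    and g :: "'d state \<Rightarrow> real"
  assumes "0 < N" and "0 < T" and "0 < ca"
    and "\<forall>(x,\<mu>)\<in>states N. lam0 (x,\<mu>) \<in> orthant x"
    and "\<forall>(x,\<mu>)\<in>states N. lam1 (x,\<mu>) \<in> orthant x"
    and "\<forall>\<xi>\<in>states N. 0 \<le> g \<xi>"
    and "\<forall>(x,\<mu>)\<in>states N. \<forall>a\<in>orthant x. 0 \<le> l (x,\<mu>) a"
    and "\<forall>(x,\<mu>)\<in>states N. continuous_on (orthant x) (l (x,\<mu>))"
    and "\<exists>\<gamma>>0. \<forall>(x,\<mu>)\<in>states N. \<forall>a\<in>orthant x. \<forall>a'\<in>orthant x. \<forall>\<tau>\<in>{0..1}.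
           \<tau> * l (x,\<mu>) a' + (1 - \<tau>) * l (x,\<mu>) a - l (x,\<mu>) (\<tau> *\<^sub>R a' + (1 - \<tau>) *\<^sub>R a)
             \<ge> \<gamma> * \<tau> * (1 - \<tau>) * (norm (a' - a))\<^sup>2"
  shows "\<exists>c0>0. \<exists>cs>0.
    \<forall>(Xi :: real \<Rightarrow> 'w \<Rightarrow> 'd state) P.
      is_controlled_chain N T lam0 lam1 Xi P \<longrightarrow>
      (let v = value_fn N T l g Xi P; br = best_response N T lam0 lam1 l g Xi P in
        (\<forall>\<beta>\<in>adm N T. \<forall>t\<in>{0..T}. \<forall>\<xi>\<in>states N. norm (br \<beta> t \<xi>) \<le> ca) \<longrightarrow>
        (\<forall>\<beta>\<in>adm N T. \<forall>\<beta>'\<in>adm N T. \<forall>t\<in>{0..T}.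
           snorm N (\<lambda>\<xi>. br \<beta> t \<xi> - br \<beta>' t \<xi>) \<le> c0 * snorm N (\<lambda>\<xi>. v \<beta> t \<xi> - v \<beta>' t \<xi>)) \<and>
        (\<forall>\<beta>\<in>adm_star N T ca. \<forall>\<beta>'\<in>adm_star N T ca. \<forall>t\<in>{0..T}.
           (snorm N (\<lambda>\<xi>. v \<beta> t \<xi> - v \<beta>' t \<xi>))\<^sup>2
             \<le> cs * (LBINT s:{t..T}. (snorm N (\<lambda>\<xi>. \<beta>' s \<xi> - \<beta> s \<xi>))\<^sup>2)) \<and>
        (\<forall>\<rho>\<in>{0<..<1}. \<forall>\<beta>0\<in>adm_star N T ca. \<forall>\<epsilon>. (\<forall>n\<ge>1. \<epsilon> n \<in> adm N T) \<longrightarrow>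
           (\<forall>n\<ge>2. \<forall>t\<in>{0..T}.
              gamma_err N br \<rho> \<epsilon> \<beta>0 (n - 1) t
                \<le> Gamma_bound T c0 cs \<rho> (\<lambda>m. norm_S N T (\<epsilon> m)) n t \<and>
              q_err N v br \<rho> \<epsilon> \<beta>0 n t
                \<le> Q_bound T c0 cs \<rho> (\<lambda>m. norm_S N T (\<epsilon> m)) n t)) \<and>
        (\<forall>\<rho>\<in>{0<..<1}. \<exists>ct>0. \<forall>\<beta>0\<in>adm_star N T ca. \<forall>\<epsilon>. (\<forall>n\<ge>1. \<epsilon> n \<in> adm N T) \<longrightarrow>
           (SUP n\<in>{1..}. ereal ((SUP t\<in>{0..T}. \<bar>gamma_err N br \<rho> \<epsilon> \<beta>0 n t\<bar>)
                               + (SUP t\<in>{0..T}. \<bar>q_err N v br \<rho> \<epsilon> \<beta>0 n t\<bar>)))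
             \<le> ereal ct * (SUP n\<in>{1..}. ereal ((norm_S N T (\<epsilon> n))\<^sup>2))))"
proof -
  obtain \<gamma> where \<gamma>: "\<gamma> > 0" "\<forall>(x,\<mu>)\<in>states N. \<forall>a\<in>orthant x. \<forall>a'\<in>orthant x. \<forall>\<tau>\<in>{0..1}.
      \<tau> * l (x,\<mu>) a' + (1 - \<tau>) * l (x,\<mu>) a - l (x,\<mu>) (\<tau> *\<^sub>R a' + (1 - \<tau>) *\<^sub>R a)
        \<ge> \<gamma> * \<tau> * (1 - \<tau>) * (norm (a' - a))\<^sup>2"
    using assms(9) by blast
  interpret mfg_data N T lam0 lam1 l g \<gamma>
    by unfold_locales (use assms(1,2,4-8) \<gamma> in fastforce)+
  show ?thesis
  \<comment> \<open>Both witnesses are built from the data and \<gamma> before a chain is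
    introduced, as the order of the quantifiers demands.\<close>
  proof (rule exI[of _ best_response_const], rule conjI[OF best_response_const_pos],
      rule exI[of _ stability_const], rule conjI[OF stability_const_pos], intro allI impI)
    fix Xi :: "real \<Rightarrow> 'w \<Rightarrow> 'd state" and P
    assume "is_controlled_chain N T lam0 lam1 Xi P"
    then interpret mfg_chain N T lam0 lam1 l g \<gamma> Xi P by unfold_locales
    let ?v = "value_fn N T l g Xi P" and ?br = "best_response N T lam0 lam1 l g Xi P"
    have star: "\<beta> \<in> adm N T" if "\<beta> \<in> adm_star N T ca" for \<beta> using that by (simp add: adm_star_def)
    have "(snorm N (\<lambda>\<xi>. ?v \<beta> t \<xi> - ?v \<beta>' t \<xi>))\<^sup>2
        \<le> stability_const * (LBINT s:{t..T}. (snorm N (\<lambda>\<xi>. \<beta>' s \<xi> - \<beta> s \<xi>))\<^sup>2)"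
      if "\<beta> \<in> adm_star N T ca" "\<beta>' \<in> adm_star N T ca" "t \<in> {0..T}" for \<beta> \<beta>' t
    proof -
      have "continuous_on {0..T} (\<lambda>s. (snorm N (\<lambda>\<xi>. \<beta>' s \<xi> - \<beta> s \<xi>))\<^sup>2)"
        by (intro continuous_on_power snorm_continuous continuous_on_diff
            adm_continuous[OF star[OF that(1)]] adm_continuous[OF star[OF that(2)]])
      then have "continuous_on {t..T} (\<lambda>s. (snorm N (\<lambda>\<xi>. \<beta>' s \<xi> - \<beta> s \<xi>))\<^sup>2)"
        using that(3) by (elim continuous_on_subset) auto
      from set_borel_integral_eq_integral(2)[OF borel_integrable_atLeastAtMost'[OF this]]
      show ?thesis using value_stability[OF star[OF that(1)] star[OF that(2)] that(3)] by simp
    qed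
    moreover have "\<exists>ct>0. \<forall>\<beta>0\<in>adm_star N T ca. \<forall>\<epsilon>. (\<forall>n\<ge>1. \<epsilon> n \<in> adm N T) \<longrightarrow>
           (SUP n\<in>{1..}. ereal ((SUP t\<in>{0..T}. \<bar>gamma_err N ?br \<rho> \<epsilon> \<beta>0 n t\<bar>)
                               + (SUP t\<in>{0..T}. \<bar>q_err N ?v ?br \<rho> \<epsilon> \<beta>0 n t\<bar>)))
             \<le> ereal ct * (SUP n\<in>{1..}. ereal ((norm_S N T (\<epsilon> n))\<^sup>2))"
      if "0 < \<rho>" "\<rho> < 1" for \<rho>
    \<comment> \<open>The constant adds the control bound \<open>amplitude\<close> and the value
      bound 1, both multiplied by the weight at time 0.\<close>
    proof (intro exI conjI ballI allI impI)
      show "0 < (amplitude best_response_const \<rho> + 1) * exp (growth_rate best_response_const stability_const \<rho> * T)"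
        using amplitude_pos[OF that(2)] by (simp add: add_pos_pos)
    qed (rule uniform_error_bound[OF that star], auto)
    ultimately show "let v = ?v; br = ?br in
        (\<forall>\<beta>\<in>adm N T. \<forall>t\<in>{0..T}. \<forall>\<xi>\<in>states N. norm (br \<beta> t \<xi>) \<le> ca) \<longrightarrow>
        (\<forall>\<beta>\<in>adm N T. \<forall>\<beta>'\<in>adm N T. \<forall>t\<in>{0..T}.
           snorm N (\<lambda>\<xi>. br \<beta> t \<xi> - br \<beta>' t \<xi>) \<le> best_response_const * snorm N (\<lambda>\<xi>. v \<beta> t \<xi> - v \<beta>' t \<xi>)) \<and>
        (\<forall>\<beta>\<in>adm_star N T ca. \<forall>\<beta>'\<in>adm_star N T ca. \<forall>t\<in>{0..T}.
           (snorm N (\<lambda>\<xi>. v \<beta> t \<xi> - v \<beta>' t \<xi>))\<^sup>2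
             \<le> stability_const * (LBINT s:{t..T}. (snorm N (\<lambda>\<xi>. \<beta>' s \<xi> - \<beta> s \<xi>))\<^sup>2)) \<and>
        (\<forall>\<rho>\<in>{0<..<1}. \<forall>\<beta>0\<in>adm_star N T ca. \<forall>\<epsilon>. (\<forall>n\<ge>1. \<epsilon> n \<in> adm N T) \<longrightarrow>
           (\<forall>n\<ge>2. \<forall>t\<in>{0..T}.
              gamma_err N br \<rho> \<epsilon> \<beta>0 (n - 1) t
                \<le> Gamma_bound T best_response_const stability_const \<rho> (\<lambda>m. norm_S N T (\<epsilon> m)) n t \<and>
              q_err N v br \<rho> \<epsilon> \<beta>0 n t
                \<le> Q_bound T best_response_const stability_const \<rho> (\<lambda>m. norm_S N T (\<epsilon> m)) n t)) \<and>
        (\<forall>\<rho>\<in>{0<..<1}. \<exists>ct>0. \<forall>\<beta>0\<in>adm_star N T ca. \<forall>\<epsilon>. (\<forall>n\<ge>1. \<epsilon> n \<in> adm N T) \<longrightarrow>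
           (SUP n\<in>{1..}. ereal ((SUP t\<in>{0..T}. \<bar>gamma_err N br \<rho> \<epsilon> \<beta>0 n t\<bar>)
                               + (SUP t\<in>{0..T}. \<bar>q_err N v br \<rho> \<epsilon> \<beta>0 n t\<bar>)))
             \<le> ereal ct * (SUP n\<in>{1..}. ereal ((norm_S N T (\<epsilon> n))\<^sup>2)))"
      unfolding Let_def
      by (intro impI conjI ballI allI best_response_stability explicit_error_bounds) (auto intro: star)
  qed
qed

end
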